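(* Let $\mathcal E$ be a complex separable Hilbert space and let $\mu$ be a $\mathcal B(\mathcal E)$-valued semi-spectral measure on the unit circle $\mathbb T$. Then for every positive integer $n$ and every $f\in \mathcal H_{\mu,n}(\mathcal E)$, $$D_{\mu,n}(f_r)\leqslant D_{\mu,n}(f),\qquad 0<r<1,$$ and consequently $D_{\mu,n}(f_r-f)\to 0$ as $r\to 1$ (with $0<r<1$).
   Context: $\mathbb D$ is the open unit disc, $\mathbb T$ the unit circle, $dA$ the normalized Lebesgue area measure on $\mathbb D$, and $\mathcal O(\mathbb D,\mathcal E)$ the space of $\mathcal E$-valued holomorphic functions on $\mathbb D$. A $\mathcal B(\mathcal E)$-valued semi-spectral measure on $\mathbb T$ is a finitely additive set function $\mu$ from the Borel $\sigma$-algebra of $\mathbb T$ into the positive operators in $\mathcal B(\mathcal E)$ such that $\mu_{x,y}(\cdot):=\langle \mu(\cdot)x,y\rangle$ is a regular complex Borel measure on $\mathbb T$ for all $x,y\in\mathcal E$. Its Poisson integral is $P_\mu(z)=\int_{\mathbb T}\frac{1-|z|^2}{|z-\zeta|^2}\,d\mu(\zeta)$, $z\in\mathbb D$ (i.e. $\langle P_\mu(z)x,y\rangle=\int_{\mathbb T}\frac{1-|z|^2}{|z-\zeta|^2}\,d\mu_{x,y}(\zeta)$), a positive operator in $\mathcal B(\mathcal E)$. For a positive integer $n$ and $f\in\mathcal O(\mathbb D,\mathcal E)$, with $f^{(n)}$ the $n$-th complex derivative, $$D_{\mu,n}(f):=\frac{1}{n!(n-1)!}\int_{\mathbb D}\langle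 P_\mu(z)f^{(n)}(z),f^{(n)}(z)\rangle(1-|z|^2)^{n-1}\,dA(z)\in[0,\infty],$$ and $\mathcal H_{\mu,n}(\mathcal E):=\{f\in\mathcal O(\mathbb D,\mathcal E):D_{\mu,n}(f)<\infty\}$. For $0<r<1$, $f_r(z):=f(rz)$ is the $r$-dilation of $f$. *)

theory Defs
  imports "HOL-Analysis.Analysis"
begin

text \<open>The inner product is linear in its first argument. The axiom \<open>cinner_self\<close> says that the norm is
  the one induced by the inner product, and so contains positive definiteness.\<close>

class complex_hilbert_space = banach +
  fixes scaleC :: "complex \<Rightarrow> 'a \<Rightarrow> 'a"  (infixr \<open>*\<^sub>C\<close> 75)
    and cinner :: "'a \<Rightarrow> 'a \<Rightarrow> complex"
  assumes scaleC_add_right: "a *\<^sub>C (x + y) = a *\<^sub>C x + a *\<^sub>C y"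
    and scaleC_add_left: "(a + b) *\<^sub>C x = a *\<^sub>C x + b *\<^sub>C x"
    and scaleC_scaleC: "a *\<^sub>C b *\<^sub>C x = (a * b) *\<^sub>C x"
    and scaleR_scaleC: "scaleR r x = complex_of_real r *\<^sub>C x"
    and cinner_add_left: "cinner (x + y) z = cinner x z + cinner y z"
    and cinner_scaleC_left: "cinner (a *\<^sub>C x) y = a * cinner x y"
    and cinner_commute: "cinner x y = cnj (cinner y x)"
    and cinner_self: "cinner x x = complex_of_real ((norm x)\<^sup>2)"

definition bounded_clinear :: "('a::complex_hilbert_space \<Rightarrow> 'a) \<Rightarrow> bool" where
  "bounded_clinear T \<longleftrightarrow> bounded_linear T \<and> (\<forall>c x. T (c *\<^sub>C x) = c *\<^sub>C T x)"

definition positive_operator :: "('a::complex_hilbert_space \<Rightarrow> 'a) \<Rightarrow> bool" where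
  "positive_operator T \<longleftrightarrow> bounded_clinear T \<and> (\<forall>x. cinner (T x) x \<in> \<real>\<^sub>\<ge>\<^sub>0)"


text \<open>Set functions are total functions on sets; only their values on \<open>sets M\<close> are relevant.\<close>

definition complex_measure :: "'b measure \<Rightarrow> ('b set \<Rightarrow> complex) \<Rightarrow> bool" where
  "complex_measure M \<nu> \<longleftrightarrow>
    (\<forall>A::nat \<Rightarrow> 'b set. range A \<subseteq> sets M \<longrightarrow> disjoint_family A \<longrightarrow>
      (\<lambda>i. \<nu> (A i)) sums \<nu> (\<Union>i. A i))"

text \<open>Regularity of the total variation of \<open>\<nu>\<close>, expressed without it: for every \<open>C\<close> in \<open>sets M\<close>, the
  total variation of \<open>C\<close> lies between the supremum of \<open>cmod (\<nu> B)\<close> over measurable \<open>B \<subseteq> C\<close> and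
  four times that supremum.\<close>

definition regular_complex_measure ::
    "'b::topological_space measure \<Rightarrow> ('b set \<Rightarrow> complex) \<Rightarrow> bool" where
  "regular_complex_measure M \<nu> \<longleftrightarrow> complex_measure M \<nu> \<and>
    (\<forall>A\<in>sets M. \<forall>e>0. \<exists>K U. compact K \<and> open U \<and> K \<subseteq> A \<and> A \<subseteq> U \<and>
      (\<forall>B\<in>sets M. B \<subseteq> U - K \<longrightarrow> cmod (\<nu> B) < e))"

text \<open>The positive part in the Jordan decomposition of a real-valued measure \<open>\<nu>\<close>. The supremum ranges
  over a set containing the empty set, so it does not matter that \<open>ennreal\<close> truncates at 0. The
  negative part is the positive part of \<open>-\<nu>\<close>.\<close>

definition jordan_pos :: "'b measure \<Rightarrow> ('b set \<Rightarrow> real) \<Rightarrow> 'b measure" where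
  "jordan_pos M \<nu> =
    measure_of (space M) (sets M) (\<lambda>A. SUP B\<in>{B\<in>sets M. B \<subseteq> A}. ennreal (\<nu> B))"

definition signed_integral :: "'b measure \<Rightarrow> ('b set \<Rightarrow> real) \<Rightarrow> ('b \<Rightarrow> complex) \<Rightarrow> complex" where
  "signed_integral M \<nu> g =
    (LINT x|jordan_pos M \<nu>. g x) - (LINT x|jordan_pos M (\<lambda>A. - \<nu> A). g x)"

definition complex_measure_integral ::
    "'b measure \<Rightarrow> ('b set \<Rightarrow> complex) \<Rightarrow> ('b \<Rightarrow> complex) \<Rightarrow> complex" where
  "complex_measure_integral M \<nu> g =
    signed_integral M (\<lambda>A. Re (\<nu> A)) g + \<i> * signed_integral M (\<lambda>A. Im (\<nu> A)) g"


definition circle_borel :: "complex measure" where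
  "circle_borel = restrict_space borel (sphere 0 1)"

definition semi_spectral_measure :: "(complex set \<Rightarrow> 'a::complex_hilbert_space \<Rightarrow> 'a) \<Rightarrow> bool" where
  "semi_spectral_measure \<mu> \<longleftrightarrow>
    (\<forall>A\<in>sets circle_borel. positive_operator (\<mu> A)) \<and>
    (\<forall>A\<in>sets circle_borel. \<forall>B\<in>sets circle_borel. A \<inter> B = {} \<longrightarrow>
      \<mu> (A \<union> B) = (\<lambda>x. \<mu> A x + \<mu> B x)) \<and>
    (\<forall>x y. regular_complex_measure circle_borel (\<lambda>A. cinner (\<mu> A x) y))"

definition poisson_kernel :: "complex \<Rightarrow> complex \<Rightarrow> real" where
  "poisson_kernel z \<zeta> = (1 - (cmod z)\<^sup>2) / (cmod (z - \<zeta>))\<^sup>2"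

text \<open>The operator is determined weakly: nondegeneracy of the inner product makes it unique.\<close>

definition poisson_integral ::
    "(complex set \<Rightarrow> 'a::complex_hilbert_space \<Rightarrow> 'a) \<Rightarrow> complex \<Rightarrow> 'a \<Rightarrow> 'a" where
  "poisson_integral \<mu> z = (THE T. bounded_clinear T \<and>
    (\<forall>x y. cinner (T x) y =
      complex_measure_integral circle_borel (\<lambda>A. cinner (\<mu> A x) y)
        (\<lambda>\<zeta>. complex_of_real (poisson_kernel z \<zeta>))))"


definition has_cderiv :: "(complex \<Rightarrow> 'a::complex_hilbert_space) \<Rightarrow> 'a \<Rightarrow> complex \<Rightarrow> bool" where
  "has_cderiv f d z \<longleftrightarrow> (f has_derivative (\<lambda>h. h *\<^sub>C d)) (at z)"

definition cderiv :: "(complex \<Rightarrow> 'a::complex_hilbert_space) \<Rightarrow> complex \<Rightarrow> 'a" where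
  "cderiv f z = (THE d. has_cderiv f d z)"

text \<open>Elements of \<open>\<O>(\<bbbD>,\<E>)\<close> are represented by functions on the whole plane, whose values outside the
  open unit disc are irrelevant.\<close>

definition holomorphic_on_disc :: "(complex \<Rightarrow> 'a::complex_hilbert_space) \<Rightarrow> bool" where
  "holomorphic_on_disc f \<longleftrightarrow> (\<forall>z\<in>ball 0 1. \<exists>d. has_cderiv f d z)"

definition disc_area :: "complex measure" where
  "disc_area = uniform_measure lborel (ball 0 1)"

definition dirichlet_integral ::
    "(complex set \<Rightarrow> 'a::complex_hilbert_space \<Rightarrow> 'a) \<Rightarrow> nat \<Rightarrow> (complex \<Rightarrow> 'a) \<Rightarrow> ennreal" where
  "dirichlet_integral \<mu> n f = ennreal (1 / (fact n * fact (n - 1))) *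
    (\<integral>\<^sup>+z\<in>ball 0 1. ennreal
      (Re (cinner (poisson_integral \<mu> z ((cderiv ^^ n) f z)) ((cderiv ^^ n) f z))
        * (1 - (cmod z)\<^sup>2) ^ (n - 1)) \<partial>disc_area)"

definition dirichlet_space ::
    "(complex set \<Rightarrow> 'a::complex_hilbert_space \<Rightarrow> 'a) \<Rightarrow> nat \<Rightarrow> (complex \<Rightarrow> 'a) set" where
  "dirichlet_space \<mu> n = {f. holomorphic_on_disc f \<and> dirichlet_integral \<mu> n f < \<infinity>}"

definition dilation :: "real \<Rightarrow> (complex \<Rightarrow> 'a) \<Rightarrow> complex \<Rightarrow> 'a" where
  "dilation r f z = f (complex_of_real r * z)"

end

theory Submission
  imports Defs "HOL-Complex_Analysis.Complex_Analysis"
begin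

text \<open>Write \<open>q z x\<close> for \<open>\<langle>P\<^sub>\<mu>(z) x, x\<rangle>\<close> and \<open>g\<close> for the \<open>n\<close>-th derivative of \<open>f\<close>. The \<open>n\<close>-th derivative of
  \<open>f\<^sub>r\<close> is \<open>r\<^sup>n g(r z)\<close>, so up to a constant both Dirichlet integrals are energies: integrals over the disc of
  \<open>q z (h z) (1 - |z|\<^sup>2)\<^sup>l\<close> with \<open>l = n - 1\<close>.

  First integrate only over \<open>|z| \<le> R\<close> with \<open>R < 1\<close>, and let \<open>g(z) = \<Sum> z\<^sup>j b\<^sub>j\<close> be a polynomial. The function \<open>P\<^sub>\<mu>\<close>
  has a Fourier expansion, and area measure is invariant under rotations, so the energy of \<open>g\<close> is
  \<open>\<Sum> \<kappa>(max j k) \<alpha>\<^sub>j\<^sub>k\<close>, where \<open>\<kappa>(m)\<close> is the integral of \<open>t\<^sup>m (1 - t)\<^sup>l\<close> over \<open>0 \<le> t \<le> R\<^sup>2\<close> and \<open>\<alpha>\<^sub>j\<^sub>k\<close> comes from a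
  Fourier coefficient of \<open>\<mu>\<close> paired with \<open>b\<^sub>j, b\<^sub>k\<close> (\<open>polynomial_energy\<close>). Dilation multiplies the \<open>(j, k)\<close>
  term by \<open>s\<^sub>j s\<^sub>k\<close> with \<open>s\<^sub>m = r\<^sup>m\<^sup>+\<^sup>n\<close>. Positivity of \<open>P\<^sub>\<mu>\<close> makes \<open>\<alpha>\<close> a nonnegative form on real vectors
  (\<open>boundary_form_nonneg\<close>). It remains to see that multiplying \<open>\<alpha>\<close> entrywise by
  \<open>\<kappa>(max j k) (1 - s\<^sub>j s\<^sub>k)\<close> keeps the sum of all entries nonnegative. Since
  \<open>2 (1 - s\<^sub>j s\<^sub>k) = (1 - s\<^sub>j) (1 + s\<^sub>k) + (1 + s\<^sub>j) (1 - s\<^sub>k)\<close>, this kernel is half the sum of two kernels of the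
  form \<open>u(min j k) v(max j k)\<close>, and such a kernel is harmless when \<open>u / v\<close> is nondecreasing
  (\<open>min_max_kernel_nonneg\<close>). For the two kernels at hand this follows from two facts: \<open>(m + n) \<kappa>(m)\<close> decreases in
  \<open>m\<close> (\<open>radial_moment_step\<close>), and \<open>p (1 + r\<^sup>p) / (1 - r\<^sup>p)\<close> increases in \<open>p\<close> (\<open>power_ratio_mono\<close>).

  On \<open>|z| \<le> R\<close> the Taylor polynomials of \<open>g\<close> converge uniformly, so the inequality passes to every
  holomorphic \<open>g\<close>; then \<open>R\<close> tends to 1 by monotone convergence (\<open>energy_dilation_le\<close>). The truncation
  matters: over the whole disc a finite energy need not be the limit of the energies of Taylor polynomials.

  For the second claim, let \<open>g\<^sub>r\<close> be \<open>r\<^sup>n g(r z)\<close>. By the parallelogram law the energies of \<open>g\<^sub>r - g\<close> and \<open>g\<^sub>r + g\<close>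
  add up to at most four times the energy of \<open>g\<close>, and by Fatou's lemma the energy of \<open>g\<^sub>r + g\<close> is in the
  limit at least that much (\<open>energy_tendsto_zero\<close>).

  Two preparations give meaning to these formulas. The operator \<open>P\<^sub>\<mu>(z)\<close>, a definite description, must be
  shown to exist: it is the limit of sums of operators \<open>\<mu> A\<close> over level sets of the Poisson kernel
  (\<open>spectral_integral_exists\<close>). And the derivatives of a vector-valued holomorphic function must be
  holomorphic again: Taylor coefficients are circle integrals, identified through scalar products with
  Cauchy's formula (\<open>vector_Taylor_coefficients\<close>).\<close>

section \<open>Vectors in a complex Hilbert space\<close>

lemma scaleC_zero_left [simp]: "0 *\<^sub>C x = (0::'a::complex_hilbert_space)"
  using scaleC_add_left[of 0 0 x] by simp

lemma scaleC_zero_right [simp]: "a *\<^sub>C 0 = (0::'a::complex_hilbert_space)"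
  using scaleC_add_right[of a 0 0] by simp

lemma scaleC_one [simp]: "1 *\<^sub>C x = (x::'a::complex_hilbert_space)"
  using scaleR_scaleC[of 1 x] by simp

lemma scaleC_minus_right: "a *\<^sub>C (- x) = - (a *\<^sub>C (x::'a::complex_hilbert_space))"
  using scaleC_add_right[of a x "-x"] by (simp add: eq_neg_iff_add_eq_0 add.commute)

lemma scaleC_diff_right: "a *\<^sub>C (x - y) = a *\<^sub>C x - a *\<^sub>C (y::'a::complex_hilbert_space)"
  using scaleC_add_right[of a x "-y"] by (simp add: scaleC_minus_right)

lemma scaleC_sum_right: "a *\<^sub>C (\<Sum>i\<in>I. g i) = (\<Sum>i\<in>I. a *\<^sub>C (g i::'a::complex_hilbert_space))"
  by (induction I rule: infinite_finite_induct) (auto simp: scaleC_add_right)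

lemma cinner_add_right: "cinner x (y + z) = cinner x y + cinner (x::'a::complex_hilbert_space) z"
  by (metis cinner_add_left cinner_commute complex_cnj_add)

lemma cinner_scaleC_right: "cinner x (a *\<^sub>C y) = cnj a * cinner (x::'a::complex_hilbert_space) y"
  by (metis cinner_commute cinner_scaleC_left complex_cnj_mult)

lemma cinner_zero_left [simp]: "cinner 0 (y::'a::complex_hilbert_space) = 0"
  using cinner_add_left[of 0 0 y] by simp

lemma cinner_zero_right [simp]: "cinner (y::'a::complex_hilbert_space) 0 = 0"
  using cinner_add_right[of y 0 0] by simp

lemma cinner_minus_left: "cinner (- x) y = - cinner (x::'a::complex_hilbert_space) y"
  using cinner_add_left[of x "-x" y] by (simp add: eq_neg_iff_add_eq_0 add.commute)

lemma cinner_minus_right: "cinner x (- y) = - cinner (x::'a::complex_hilbert_space) y"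
  using cinner_add_right[of x y "-y"] by (simp add: eq_neg_iff_add_eq_0 add.commute)

lemma cinner_diff_left: "cinner (x - y) z = cinner x z - cinner (y::'a::complex_hilbert_space) z"
  using cinner_add_left[of x "-y" z] by (simp add: cinner_minus_left)

lemma cinner_diff_right: "cinner x (y - z) = cinner x y - cinner (x::'a::complex_hilbert_space) z"
  using cinner_add_right[of x y "-z"] by (simp add: cinner_minus_right)

lemma cinner_scaleR_left: "cinner (r *\<^sub>R x) y = of_real r * cinner (x::'a::complex_hilbert_space) y"
  by (simp add: scaleR_scaleC cinner_scaleC_left)

lemma cinner_scaleR_right: "cinner x (r *\<^sub>R y) = of_real r * cinner (x::'a::complex_hilbert_space) y"
  by (simp add: scaleR_scaleC cinner_scaleC_right)

lemma cinner_sum_left: "cinner (\<Sum>i\<in>I. g i) y = (\<Sum>i\<in>I. cinner (g i::'a::complex_hilbert_space) y)"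
  by (induction I rule: infinite_finite_induct) (auto simp: cinner_add_left)

lemma cinner_sum_right: "cinner y (\<Sum>i\<in>I. g i) = (\<Sum>i\<in>I. cinner y (g i::'a::complex_hilbert_space))"
  by (induction I rule: infinite_finite_induct) (auto simp: cinner_add_right)

lemma norm_scaleC [simp]: "norm (a *\<^sub>C x) = cmod a * norm (x::'a::complex_hilbert_space)"
proof -
  have "complex_of_real ((norm (a *\<^sub>C x))\<^sup>2) = of_real ((cmod a * norm x)\<^sup>2)"
    unfolding cinner_self[symmetric] cinner_scaleC_left cinner_scaleC_right
    by (simp add: cinner_self power_mult_distrib complex_norm_square mult.assoc flip: of_real_power)
  hence "(norm (a *\<^sub>C x))\<^sup>2 = (cmod a * norm x)\<^sup>2"
    using of_real_eq_iff by blast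
  thus ?thesis by (metis norm_ge_zero power2_eq_iff_nonneg zero_le_mult_iff)
qed

text \<open>The vector \<open>p\<close> in the proof is the part of \<open>x\<close> orthogonal to \<open>y\<close>; the inequality says that its norm is
  not negative.\<close>

lemma cinner_Cauchy_Schwarz: "cmod (cinner x y) \<le> norm x * norm (y::'a::complex_hilbert_space)"
proof (cases "y = 0")
  case False
  define u where "u = cinner x y"
  define p where "p = x - (u / of_real ((norm y)\<^sup>2)) *\<^sub>C y"
  have ny: "norm y > 0" using False by simp
  have "cinner p y = 0"
    using ny by (simp add: p_def cinner_diff_left cinner_scaleC_left cinner_self u_def)
  hence "cinner p p = cinner p x" by (simp add: p_def cinner_diff_right cinner_scaleC_right)
  also have "\<dots> = of_real ((norm x)\<^sup>2) - u * cnj u / of_real ((norm y)\<^sup>2)"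
    by (simp add: p_def cinner_diff_left cinner_scaleC_left cinner_self cinner_commute[of y x] u_def)
  also have "\<dots> = of_real ((norm x)\<^sup>2 - (cmod u)\<^sup>2 / (norm y)\<^sup>2)"
    using complex_norm_square[of u] by simp
  finally have "(norm p)\<^sup>2 = (norm x)\<^sup>2 - (cmod u)\<^sup>2 / (norm y)\<^sup>2"
    unfolding cinner_self of_real_eq_iff .
  hence "(cmod u)\<^sup>2 / (norm y)\<^sup>2 \<le> (norm x)\<^sup>2" by (metis diff_ge_0_iff_ge zero_le_power2)
  hence "(cmod u)\<^sup>2 \<le> (norm x * norm y)\<^sup>2"
    using ny by (simp add: field_simps power_mult_distrib)
  thus ?thesis unfolding u_def by (rule power2_le_imp_le) simp
qed simp

lemma bounded_bilinear_scaleC: "bounded_bilinear (\<lambda>a (x::'a::complex_hilbert_space). a *\<^sub>C x)"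
  by standard (auto simp: scaleC_add_left scaleC_add_right scaleR_scaleC scaleC_scaleC mult_ac
      scaleR_conv_of_real intro!: exI[of _ 1])

lemma bounded_bilinear_cinner: "bounded_bilinear (\<lambda>x (y::'a::complex_hilbert_space). cinner x y)"
  by standard (auto simp: cinner_add_left cinner_add_right cinner_scaleR_left cinner_scaleR_right
      scaleR_conv_of_real cinner_Cauchy_Schwarz intro!: exI[of _ 1])

lemmas tendsto_scaleC = bounded_bilinear.tendsto[OF bounded_bilinear_scaleC]
lemmas tendsto_cinner = bounded_bilinear.tendsto[OF bounded_bilinear_cinner]

lemma cinner_ext:
  fixes x x' :: "'a::complex_hilbert_space"
  assumes "\<And>y. cinner x y = cinner x' y" shows "x = x'"
proof -
  have "cinner (x - x') (x - x') = 0" using assms by (simp add: cinner_diff_left)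
  thus ?thesis by (simp add: cinner_self)
qed

text \<open>The unit vector in the direction of \<open>x\<close> attains the norm, so estimates of operators can be made on
  scalar products.\<close>

lemma norm_le_of_cinner_le:
  fixes x :: "'a::complex_hilbert_space"
  assumes "\<And>y. norm y \<le> 1 \<Longrightarrow> cmod (cinner x y) \<le> B"
  shows "norm x \<le> B"
proof (cases "x = 0")
  case True thus ?thesis using assms[of 0] by simp
next
  case False
  have "norm x = cmod (cinner x ((1 / norm x) *\<^sub>R x))"
    using False by (simp add: cinner_scaleR_right cinner_self power2_eq_square norm_mult)
  also have "\<dots> \<le> B" using False by (intro assms) simp
  finally show ?thesis .
qed

lemma polarization:
  fixes T :: "'a::complex_hilbert_space \<Rightarrow> 'a"
  assumes "bounded_clinear T"
  defines "q \<equiv> \<lambda>v. cinner (T v) v"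
  shows "cinner (T x) y = (q (x + y) - q (x - y) + \<i> * (q (x + \<i> *\<^sub>C y) - q (x - \<i> *\<^sub>C y))) / 4"
proof -
  interpret T: bounded_linear T using assms by (simp add: bounded_clinear_def)
  have TC: "T (c *\<^sub>C v) = c *\<^sub>C T v" for c v using assms by (simp add: bounded_clinear_def)
  show ?thesis
    by (simp add: q_def T.add T.diff TC cinner_add_left cinner_add_right cinner_diff_left
        cinner_diff_right cinner_scaleC_left cinner_scaleC_right algebra_simps)
qed

lemma parallelogram:
  fixes T :: "'a::complex_hilbert_space \<Rightarrow> 'a"
  assumes "bounded_clinear T"
  shows "cinner (T (x + y)) (x + y) + cinner (T (x - y)) (x - y)
     = 2 * cinner (T x) x + 2 * cinner (T y) y"
proof -
  interpret T: bounded_linear T using assms by (simp add: bounded_clinear_def)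
  show ?thesis
    by (simp add: T.add T.diff cinner_add_left cinner_add_right cinner_diff_left
        cinner_diff_right algebra_simps)
qed

section \<open>Power series of vector-valued holomorphic functions\<close>

lemma has_cderiv_unique:
  assumes "has_cderiv f d z" "has_cderiv f d' z" shows "d = d'"
proof -
  have "(\<lambda>h. h *\<^sub>C d) = (\<lambda>h. h *\<^sub>C d')"
    using assms unfolding has_cderiv_def by (rule has_derivative_unique)
  from fun_cong[OF this, of 1] show ?thesis by simp
qed

lemma cderiv_eqI: "has_cderiv f d z \<Longrightarrow> cderiv f z = d"
  unfolding cderiv_def using has_cderiv_unique by blast

lemma has_cderiv_cderiv:
  "holomorphic_on_disc f \<Longrightarrow> cmod z < 1 \<Longrightarrow> has_cderiv f (cderiv f z) z"
  unfolding holomorphic_on_disc_def by (metis cderiv_eqI dist_0_norm mem_ball)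

text \<open>The disc is open, so an identity that holds only there may be differentiated. This is needed because the
  values of \<open>cderiv ^^ n\<close> outside the disc are arbitrary.\<close>

lemma has_cderiv_cong_disc:
  assumes "\<And>z. cmod z < 1 \<Longrightarrow> f z = g z" "cmod z < 1" "has_cderiv f d z"
  shows "has_cderiv g d z"
  using assms(3) unfolding has_cderiv_def
  by (rule has_derivative_transform_within_open[where s="ball 0 1"]) (use assms(1,2) in auto)

lemma has_field_derivative_cinner:
  assumes "has_cderiv f d z"
  shows "((\<lambda>z. cinner (f z) y) has_field_derivative cinner d y) (at z)"
proof -
  have "((\<lambda>z. cinner (f z) y) has_derivative (\<lambda>h. cinner (h *\<^sub>C d) y)) (at z)"
    using assms unfolding has_cderiv_def
    by (rule bounded_linear.has_derivative[OF bounded_bilinear.bounded_linear_left[OF bounded_bilinear_cinner]])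
  thus ?thesis by (simp add: has_field_derivative_def cinner_scaleC_left mult.commute[of _ "cinner d y"])
qed

lemma holomorphic_on_cinner:
  assumes "holomorphic_on_disc f" shows "(\<lambda>z. cinner (f z) y) holomorphic_on ball 0 1"
  using has_field_derivative_cinner[OF has_cderiv_cderiv[OF assms]]
  by (intro holomorphic_onI) (auto simp: field_differentiable_def intro: has_field_derivative_at_within)

lemma continuous_on_holomorphic_on_disc:
  assumes "holomorphic_on_disc f" shows "continuous_on (ball 0 1) f"
proof (intro continuous_at_imp_continuous_on ballI)
  fix z :: complex assume "z \<in> ball 0 1"
  thus "isCont f z"
    using has_cderiv_cderiv[OF assms, of z] has_derivative_continuous unfolding has_cderiv_def by auto
qed

text \<open>The coefficients are integrals over the circle of radius \<open>R\<close>, which gives the Cauchy estimate. Scalar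
  products with a fixed vector commute with the integral, so Cauchy's formula for scalar functions
  identifies them and shows that they do not depend on \<open>R\<close>.\<close>

lemma vector_Taylor_coefficients:
  fixes f :: "complex \<Rightarrow> 'a::complex_hilbert_space"
  assumes f: "holomorphic_on_disc f" and R: "0 < R" "R < 1"
  shows "\<exists>a M. (\<forall>k. norm (a k) \<le> M / R ^ k) \<and>
    (\<forall>k y. cinner (a k) y = (deriv ^^ k) (\<lambda>z. cinner (f z) y) 0 / fact k)"
proof -
  define c where "c = circlepath 0 R"
  have c: "cmod (c t) = R" "c t \<noteq> 0" for t
    using R by (auto simp: c_def circlepath norm_mult)
  have vd: "vector_derivative c (at t within {0..1}) = 2 * pi * \<i> * c t" if "t \<in> {0..1}" for t
  proof -
    have "vector_derivative c (at t within {0..1}) = 2 * pi * \<i> * R * exp (2 * of_real pi * \<i> * t)"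
      unfolding c_def by (rule vector_derivative_circlepath01) (use that in auto)
    thus ?thesis by (simp add: c_def circlepath)
  qed
  have cont_c: "continuous_on {0..1} c" unfolding c_def using path_circlepath path_def by blast
  have cont_fc: "continuous_on {0..1} (\<lambda>t. f (c t))"
    by (rule continuous_on_compose2[OF continuous_on_holomorphic_on_disc[OF f] cont_c]) (use c R in auto)
  define I where "I k t = inverse (c t) ^ k *\<^sub>C f (c t)" for k t
  have cont_I: "continuous_on {0..1} (I k)" for k
    unfolding I_def using c(2) 
    by (intro bounded_bilinear.continuous_on[OF bounded_bilinear_scaleC] cont_fc
        continuous_on_power continuous_on_inverse cont_c) auto
  define a where "a k = integral {0..1} (I k)" for k
  have "bounded ((\<lambda>t. f (c t)) ` {0..1})"
    using compact_continuous_image[OF cont_fc] compact_imp_bounded by blast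
  then obtain M where "\<forall>x\<in>(\<lambda>t. f (c t)) ` {0..1}. norm x \<le> M"
    unfolding bounded_iff by blast
  hence M: "\<And>t. t \<in> {0..1} \<Longrightarrow> norm (f (c t)) \<le> M" by blast
  have "norm (a k) \<le> M / R ^ k" for k
  proof -
    have "norm (integral {0..1} (I k)) \<le> (M / R ^ k) * (1 - 0)"
    proof (rule integral_bound)
      fix t :: real assume "t \<in> {0..1}"
      thus "norm (I k t) \<le> M / R ^ k"
        using M[of t] R unfolding I_def norm_scaleC norm_power norm_inverse c
        by (simp add: field_simps)
    qed (use cont_I in auto)
    thus ?thesis by (simp add: a_def)
  qed
  moreover have "cinner (a k) y = (deriv ^^ k) (\<lambda>z. cinner (f z) y) 0 / fact k" for k y
  proof -
    let ?\<phi> = "\<lambda>z. cinner (f z) y"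
    have hol: "?\<phi> holomorphic_on ball 0 1" by (rule holomorphic_on_cinner[OF f])
    have sub: "cball (0::complex) R \<subseteq> ball 0 1" "ball (0::complex) R \<subseteq> ball 0 1" using R by auto
    have "((\<lambda>u. ?\<phi> u / (u - 0) ^ Suc k) has_contour_integral
            (2 * pi * \<i>) / fact k * (deriv ^^ k) ?\<phi> 0) (circlepath 0 R)"
      by (rule Cauchy_has_contour_integral_higher_derivative_circlepath)
        (use R holomorphic_on_imp_continuous_on[OF holomorphic_on_subset[OF hol sub(1)]]
           holomorphic_on_subset[OF hol sub(2)] in auto)
    hence "((\<lambda>t. ?\<phi> (c t) / c t ^ Suc k * (2 * pi * \<i> * c t)) has_integral
            (2 * pi * \<i>) / fact k * (deriv ^^ k) ?\<phi> 0) {0..1}"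
      unfolding has_contour_integral_def c_def[symmetric]
      by (rule has_integral_eq[rotated]) (simp add: vd)
    hence "((\<lambda>t. (1 / (2 * pi * \<i>)) * (?\<phi> (c t) / c t ^ Suc k * (2 * pi * \<i> * c t))) has_integral
            (1 / (2 * pi * \<i>)) * ((2 * pi * \<i>) / fact k * (deriv ^^ k) ?\<phi> 0)) {0..1}"
      by (rule has_integral_mult_right)
    moreover have "(\<lambda>t. (1 / (2 * pi * \<i>)) * (?\<phi> (c t) / c t ^ Suc k * (2 * pi * \<i> * c t)))
         = (\<lambda>t. cinner (I k t) y)"
      using c(2) by (auto simp: fun_eq_iff I_def cinner_scaleC_left field_simps)
    ultimately have "((\<lambda>t. cinner (I k t) y) has_integral (deriv ^^ k) ?\<phi> 0 / fact k) {0..1}" by simp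
    moreover have "((\<lambda>t. cinner (I k t) y) has_integral cinner (a k) y) {0..1}"
      using has_integral_linear[OF integrable_integral[OF integrable_continuous_interval[OF cont_I[of k]]]
          bounded_bilinear.bounded_linear_left[OF bounded_bilinear_cinner]]
      unfolding a_def o_def .
    ultimately show ?thesis using has_integral_unique by blast
  qed
  ultimately show ?thesis by blast
qed

lemma cinner_sums:
  "(\<lambda>k. x k) sums s \<Longrightarrow> (\<lambda>k. cinner (x k) y) sums cinner (s::'a::complex_hilbert_space) y"
  by (rule bounded_linear.sums[OF bounded_bilinear.bounded_linear_left[OF bounded_bilinear_cinner]])

definition disc_power_series :: "(nat \<Rightarrow> 'a::complex_hilbert_space) \<Rightarrow> (complex \<Rightarrow> 'a) \<Rightarrow> bool" where
  "disc_power_series a f \<longleftrightarrow> (\<forall>z. cmod z < 1 \<longrightarrow>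
     summable (\<lambda>k. norm (a k) * cmod z ^ k) \<and> (\<lambda>k. z ^ k *\<^sub>C a k) sums f z)"

text \<open>Coefficients found for different radii agree, because their scalar products with every vector do.
  The Cauchy estimate then gives absolute convergence in norm, and the sum is \<open>f\<close> because this holds
  for all scalar products.\<close>

lemma holomorphic_on_disc_power_series:
  fixes f :: "complex \<Rightarrow> 'a::complex_hilbert_space"
  assumes f: "holomorphic_on_disc f"
  obtains a where "disc_power_series a f"
proof -
  obtain a where a: "\<And>k y. cinner (a k) y = (deriv ^^ k) (\<lambda>z. cinner (f z) y) 0 / fact k"
  proof -
    have "0 < (1/2::real)" "1/2 < (1::real)" by simp_all
    from vector_Taylor_coefficients[OF f this] show thesis using that by blast
  qed
  have "summable (\<lambda>k. norm (a k) * cmod z ^ k) \<and> (\<lambda>k. z ^ k *\<^sub>C a k) sums f z" if z: "cmod z < 1" for z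
  proof
    obtain R where R: "cmod z < R" "R < 1" using dense[OF z] by blast
    have R0: "R > 0" using R by (meson norm_ge_zero order_le_less_trans)
    obtain b M where b: "\<And>k. norm (b k) \<le> M / R ^ k"
      "\<And>k y. cinner (b k) y = (deriv ^^ k) (\<lambda>z. cinner (f z) y) 0 / fact k"
      using vector_Taylor_coefficients[OF f R0 R(2)] by blast
    have ab: "a k = b k" for k by (rule cinner_ext) (simp add: a b(2))
    show s: "summable (\<lambda>k. norm (a k) * cmod z ^ k)"
    proof (rule summable_comparison_test')
      show "summable (\<lambda>k. M * (cmod z / R) ^ k)" using R R0 by (intro summable_mult summable_geometric) simp
      show "norm (norm (a k) * cmod z ^ k) \<le> M * (cmod z / R) ^ k" if "k \<ge> 0" for k
        using mult_right_mono[OF b(1)[of k], of "cmod z ^ k"] by (simp add: ab power_divide)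
    qed
    have "summable (\<lambda>k. z ^ k *\<^sub>C a k)"
      by (rule summable_norm_cancel) (use s in \<open>simp add: norm_power mult.commute\<close>)
    moreover have "(\<Sum>k. z ^ k *\<^sub>C a k) = f z"
    proof (rule cinner_ext)
      fix y
      have "(\<lambda>k. cinner (z ^ k *\<^sub>C a k) y) sums cinner (\<Sum>k. z ^ k *\<^sub>C a k) y"
        using calculation by (intro cinner_sums) (simp add: summable_sums)
      moreover have "(\<lambda>k. cinner (z ^ k *\<^sub>C a k) y) sums cinner (f z) y"
        using holomorphic_power_series[OF holomorphic_on_cinner[OF f, of y], of z] z
        by (simp add: cinner_scaleC_left a mult.commute)
      ultimately show "cinner (\<Sum>k. z ^ k *\<^sub>C a k) y = cinner (f z) y" by (rule sums_unique2)
    qed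
    ultimately show "(\<lambda>k. z ^ k *\<^sub>C a k) sums f z" by (metis summable_sums)
  qed
  thus thesis by (intro that[of a]) (simp add: disc_power_series_def)
qed

text \<open>Termwise differentiation, uniformly on a smaller disc of radius \<open>\<rho>\<close>.\<close>

lemma disc_power_series_has_cderiv:
  fixes f :: "complex \<Rightarrow> 'a::complex_hilbert_space"
  assumes f: "disc_power_series a f" and z: "cmod z < 1"
  defines "a' \<equiv> \<lambda>k. of_nat (Suc k) *\<^sub>C a (Suc k)"
  shows "summable (\<lambda>k. norm (a' k) * cmod z ^ k)"
    and "has_cderiv f (\<Sum>k. z ^ k *\<^sub>C a' k) z"
proof -
  obtain \<rho> where \<rho>: "cmod z < \<rho>" "\<rho> < 1" using dense[OF z] by blast
  have \<rho>0: "\<rho> > 0" using \<rho> by (meson norm_ge_zero order_le_less_trans)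
  \<comment> \<open>The scalar theorem on differentiating power series, applied to the coefficients \<open>norm (a k)\<close>.\<close>
  have diffs: "summable (\<lambda>k. norm (a' k) * t ^ k)" if "0 \<le> t" "t < 1" for t
  proof -
    have "summable (\<lambda>k. diffs (\<lambda>k. norm (a k)) k * t ^ k)"
    proof (rule termdiff_converges)
      show "norm t < 1" using that by simp
      fix x :: real assume x: "norm x < 1"
      have "summable (\<lambda>k. norm (a k) * cmod (of_real x) ^ k)"
        using f x unfolding disc_power_series_def by (metis norm_of_real real_norm_def)
      thus "summable (\<lambda>k. norm (a k) * x ^ k)"
        by (intro summable_norm_cancel[of "\<lambda>k. norm (a k) * x ^ k"]) (simp add: abs_mult power_abs)
    qed
    thus ?thesis by (simp add: diffs_def a'_def del: of_nat_Suc)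
  qed
  show sz: "summable (\<lambda>k. norm (a' k) * cmod z ^ k)" using z by (intro diffs) auto
  define F' where "F' k x h = (of_nat k * x ^ (k - 1) * h) *\<^sub>C a k" for k x h
  define u where "u k = real k * \<rho> ^ (k - 1) * norm (a k)" for k
  have "summable (\<lambda>k. u (Suc k))"
    using diffs[of \<rho>] \<rho> \<rho>0 by (simp add: u_def a'_def mult_ac del: of_nat_Suc)
  hence su: "summable u" by (simp add: summable_Suc_iff)
  have u0: "u k \<ge> 0" for k using \<rho>0 by (simp add: u_def)
  have F'_le: "norm (F' k x h) \<le> u k * norm h" if "x \<in> ball 0 \<rho>" for k x h
  proof -
    have "cmod x ^ (k - 1) \<le> \<rho> ^ (k - 1)" using that by (intro power_mono) auto
    hence "real k * cmod x ^ (k - 1) * cmod h * norm (a k) \<le> real k * \<rho> ^ (k - 1) * cmod h * norm (a k)"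
      by (intro mult_right_mono mult_left_mono) auto
    thus ?thesis by (simp add: F'_def u_def norm_mult norm_power mult_ac)
  qed
  have sF': "summable (\<lambda>k. F' k x h)" "summable (\<lambda>k. norm (F' k x h))" if "x \<in> ball 0 \<rho>" for x h
  proof -
    show "summable (\<lambda>k. norm (F' k x h))"
      by (rule summable_comparison_test'[where g="\<lambda>k. u k * norm h" and N=0])
        (use F'_le[OF that] su summable_mult2 in auto)
    thus "summable (\<lambda>k. F' k x h)" by (rule summable_norm_cancel)
  qed
  have "\<exists>g. \<forall>x\<in>ball 0 \<rho>. (\<lambda>k. x ^ k *\<^sub>C a k) sums g x \<and> (g has_derivative (\<lambda>h. \<Sum>k. F' k x h)) (at x within ball 0 \<rho>)"
  proof (rule has_derivative_series)
    show "convex (ball (0::complex) \<rho>)" by simp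
    show "((\<lambda>x. x ^ k *\<^sub>C a k) has_derivative F' k x) (at x within ball 0 \<rho>)" if "x \<in> ball 0 \<rho>" for k x
    proof -
      have "((\<lambda>x. x ^ k) has_derivative (\<lambda>h. of_nat k * x ^ (k - 1) * h)) (at x within ball 0 \<rho>)"
        by (auto intro!: derivative_eq_intros simp: mult_ac)
      from bounded_linear.has_derivative[OF bounded_bilinear.bounded_linear_left[OF bounded_bilinear_scaleC] this]
      show ?thesis unfolding F'_def[abs_def] .
    qed
    show "\<forall>\<^sub>F n in sequentially. \<forall>x\<in>ball 0 \<rho>. \<forall>h. norm (sum (\<lambda>i. F' i x h) {..<n} - (\<Sum>k. F' k x h)) \<le> e * norm h"
      if "e > 0" for e
    proof -
      have "(\<lambda>n. (\<Sum>k. u k) - sum u {..<n}) \<longlonglongrightarrow> (\<Sum>k. u k) - (\<Sum>k. u k)"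
        by (intro tendsto_diff tendsto_const summable_LIMSEQ su)
      hence "\<forall>\<^sub>F n in sequentially. (\<Sum>k. u k) - sum u {..<n} < e"
        using \<open>e > 0\<close> by (intro order_tendstoD(2)) auto
      thus ?thesis
      proof eventually_elim
        case (elim n)
        show ?case
        proof (intro ballI allI)
          fix x h :: complex assume x: "x \<in> ball 0 \<rho>"
          have "norm (sum (\<lambda>i. F' i x h) {..<n} - (\<Sum>k. F' k x h)) = norm (\<Sum>k. F' (k + n) x h)"
            using suminf_minus_initial_segment[OF sF'(1)[OF x, of h], of n] by (simp add: norm_minus_commute)
          also have "\<dots> \<le> (\<Sum>k. norm (F' (k + n) x h))"
            by (intro summable_norm summable_ignore_initial_segment sF'(2)[OF x])
          also have "\<dots> \<le> (\<Sum>k. u (k + n) * norm h)"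
            by (intro suminf_le F'_le[OF x] summable_mult2 summable_ignore_initial_segment[OF su]
                  summable_ignore_initial_segment[OF sF'(2)[OF x]])
          also have "\<dots> = ((\<Sum>k. u k) - sum u {..<n}) * norm h"
            unfolding suminf_minus_initial_segment[OF su, symmetric]
            by (rule suminf_mult2[OF summable_ignore_initial_segment[OF su], symmetric])
          also have "\<dots> \<le> e * norm h" using elim by (intro mult_right_mono) auto
          finally show "norm (sum (\<lambda>i. F' i x h) {..<n} - (\<Sum>k. F' k x h)) \<le> e * norm h" .
        qed
      qed
    qed
    show "0 \<in> ball (0::complex) \<rho>" using \<rho>0 by simp
    show "(\<lambda>k. 0 ^ k *\<^sub>C a k) sums f 0" using f by (simp add: disc_power_series_def)
  qed
  then obtain g where g: "\<And>x. x \<in> ball 0 \<rho> \<Longrightarrow> (\<lambda>k. x ^ k *\<^sub>C a k) sums g x"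
    "\<And>x. x \<in> ball 0 \<rho> \<Longrightarrow> (g has_derivative (\<lambda>h. \<Sum>k. F' k x h)) (at x within ball 0 \<rho>)" by blast
  have gf: "g x = f x" if "x \<in> ball 0 \<rho>" for x
  proof -
    have "(\<lambda>k. x ^ k *\<^sub>C a k) sums f x" using f that \<rho>(2) by (simp add: disc_power_series_def)
    thus ?thesis using g(1)[OF that] sums_unique2 by blast
  qed
  have zb: "z \<in> ball 0 \<rho>" using \<rho> by simp
  have "(g has_derivative (\<lambda>h. \<Sum>k. F' k z h)) (at z)"
    using g(2)[OF zb] at_within_open[OF zb open_ball] by simp
  hence "(f has_derivative (\<lambda>h. \<Sum>k. F' k z h)) (at z)"
    by (rule has_derivative_transform_within_open[OF _ open_ball zb]) (rule gf)
  moreover have "(\<Sum>k. F' k z h) = h *\<^sub>C (\<Sum>k. z ^ k *\<^sub>C a' k)" for h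
  proof -
    have "summable (\<lambda>k. z ^ k *\<^sub>C a' k)"
      by (rule summable_norm_cancel) (use sz in \<open>simp add: norm_power mult.commute\<close>)
    hence "(\<lambda>k. h *\<^sub>C (z ^ k *\<^sub>C a' k)) sums (h *\<^sub>C (\<Sum>k. z ^ k *\<^sub>C a' k))"
      by (intro bounded_linear.sums[OF bounded_bilinear.bounded_linear_right[OF bounded_bilinear_scaleC]]) (rule summable_sums)
    hence "(\<lambda>k. F' (Suc k) z h) sums (h *\<^sub>C (\<Sum>k. z ^ k *\<^sub>C a' k))"
      by (simp add: F'_def a'_def scaleC_scaleC mult_ac del: of_nat_Suc)
    hence "(\<lambda>k. F' k z h) sums (h *\<^sub>C (\<Sum>k. z ^ k *\<^sub>C a' k) + F' 0 z h)" by (rule sums_Suc)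
    thus ?thesis by (simp add: F'_def sums_iff)
  qed
  ultimately show "has_cderiv f (\<Sum>k. z ^ k *\<^sub>C a' k) z" unfolding has_cderiv_def by simp
qed

lemma holomorphic_on_disc_cderiv:
  assumes f: "holomorphic_on_disc f" shows "holomorphic_on_disc (cderiv f)"
proof -
  obtain a where a: "disc_power_series a f" using holomorphic_on_disc_power_series[OF f] .
  define a' where "a' k = of_nat (Suc k) *\<^sub>C a (Suc k)" for k
  have a': "summable (\<lambda>k. norm (a' k) * cmod z ^ k)" "cderiv f z = (\<Sum>k. z ^ k *\<^sub>C a' k)" if "cmod z < 1" for z
    using disc_power_series_has_cderiv[OF a that] cderiv_eqI unfolding a'_def[symmetric] by blast+
  have "summable (\<lambda>k. z ^ k *\<^sub>C a' k)" if "cmod z < 1" for z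
    by (rule summable_norm_cancel) (use a'(1)[OF that] in \<open>simp add: norm_power mult.commute\<close>)
  hence "disc_power_series a' (cderiv f)"
    unfolding disc_power_series_def by (metis a' summable_sums)
  thus ?thesis unfolding holomorphic_on_disc_def
    using disc_power_series_has_cderiv(2) by (metis dist_0_norm mem_ball)
qed

lemma holomorphic_on_disc_funpow_cderiv:
  "holomorphic_on_disc f \<Longrightarrow> holomorphic_on_disc ((cderiv ^^ n) f)"
  by (induction n) (auto intro: holomorphic_on_disc_cderiv)

lemma cmod_dilate_less_one:
  assumes "0 < r" "r < 1" "cmod z < 1" shows "cmod (of_real r * z) < 1"
proof -
  have "r * cmod z \<le> 1 * cmod z" using assms by (intro mult_right_mono) auto
  thus ?thesis using assms by (simp add: norm_mult)
qed

lemma funpow_cderiv_dilation: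
  assumes f: "holomorphic_on_disc f" and r: "0 < r" "r < 1" and z: "cmod z < 1"
  shows "(cderiv ^^ n) (dilation r f) z = of_real (r ^ n) *\<^sub>C (cderiv ^^ n) f (of_real r * z)"
  using z
proof (induction n arbitrary: z)
  case 0 show ?case by (simp add: dilation_def)
next
  case (Suc n)
  let ?F = "(cderiv ^^ n) f"
  have rz: "cmod (of_real r * z) < 1"
    using r Suc.prems by (intro cmod_dilate_less_one) auto
  have "has_cderiv ?F (cderiv ?F (of_real r * z)) (of_real r * z)"
    by (rule has_cderiv_cderiv[OF holomorphic_on_disc_funpow_cderiv[OF f] rz])
  hence "(?F has_derivative (\<lambda>h. h *\<^sub>C cderiv ?F (of_real r * z))) (at (of_real r * z))"
    unfolding has_cderiv_def .
  moreover have "((\<lambda>z. of_real r * z) has_derivative (\<lambda>h. of_real r * h)) (at z)"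
    by (auto intro!: derivative_eq_intros)
  ultimately have "((\<lambda>z. ?F (of_real r * z)) has_derivative (\<lambda>h. (of_real r * h) *\<^sub>C cderiv ?F (of_real r * z))) (at z)"
    by (rule has_derivative_compose[rotated])
  from bounded_linear.has_derivative[OF bounded_bilinear.bounded_linear_right[OF bounded_bilinear_scaleC] this, of "of_real (r ^ n)"]
  have "has_cderiv (\<lambda>z. of_real (r ^ n) *\<^sub>C ?F (of_real r * z)) (of_real (r ^ Suc n) *\<^sub>C cderiv ?F (of_real r * z)) z"
    unfolding has_cderiv_def by (simp add: scaleC_scaleC mult_ac)
  hence "has_cderiv ((cderiv ^^ n) (dilation r f)) (of_real (r ^ Suc n) *\<^sub>C cderiv ?F (of_real r * z)) z"
    by (rule has_cderiv_cong_disc[rotated 2]) (use Suc in auto)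
  thus ?case using cderiv_eqI by fastforce
qed

lemma holomorphic_on_disc_dilation:
  assumes f: "holomorphic_on_disc f" and r: "0 < r" "r < 1"
  shows "holomorphic_on_disc (dilation r f)"
  unfolding holomorphic_on_disc_def
proof
  fix z :: complex assume "z \<in> ball 0 1"
  hence "cmod z < 1" by simp
  hence "cmod (of_real r * z) < 1"
    using r by (intro cmod_dilate_less_one) auto
  hence "(f has_derivative (\<lambda>h. h *\<^sub>C cderiv f (of_real r * z))) (at (of_real r * z))"
    using has_cderiv_cderiv[OF f] unfolding has_cderiv_def by blast
  moreover have "((\<lambda>z. of_real r * z) has_derivative (\<lambda>h. of_real r * h)) (at z)"
    by (auto intro!: derivative_eq_intros)
  ultimately have "((\<lambda>z. f (of_real r * z)) has_derivative (\<lambda>h. (of_real r * h) *\<^sub>C cderiv f (of_real r * z))) (at z)"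
    by (rule has_derivative_compose[rotated])
  hence "has_cderiv (dilation r f) (of_real r *\<^sub>C cderiv f (of_real r * z)) z"
    unfolding has_cderiv_def dilation_def by (simp add: scaleC_scaleC mult_ac)
  thus "\<exists>d. has_cderiv (dilation r f) d z" ..
qed

lemma funpow_cderiv_diff:
  assumes f: "holomorphic_on_disc f" and g: "holomorphic_on_disc g" and z: "cmod z < 1"
  shows "(cderiv ^^ n) (\<lambda>z. f z - g z) z = (cderiv ^^ n) f z - (cderiv ^^ n) g z"
  using z
proof (induction n arbitrary: z)
  case (Suc n)
  have "has_cderiv (\<lambda>z. (cderiv ^^ n) f z - (cderiv ^^ n) g z)
      (cderiv ((cderiv ^^ n) f) z - cderiv ((cderiv ^^ n) g) z) z"
    using has_cderiv_cderiv[OF holomorphic_on_disc_funpow_cderiv[OF f, of n] Suc.prems]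
      has_cderiv_cderiv[OF holomorphic_on_disc_funpow_cderiv[OF g, of n] Suc.prems]
    unfolding has_cderiv_def scaleC_diff_right by (rule has_derivative_diff)
  hence "has_cderiv ((cderiv ^^ n) (\<lambda>z. f z - g z)) (cderiv ((cderiv ^^ n) f) z - cderiv ((cderiv ^^ n) g) z) z"
    by (rule has_cderiv_cong_disc[rotated 2]) (use Suc in auto)
  thus ?case using cderiv_eqI by fastforce
qed simp

section \<open>Integrals against differences of finite measures\<close>

text \<open>On subsets of \<open>A\<close> the set function \<open>\<nu>\<close> is largest at \<open>A \<inter> Y\<close> when \<open>Y\<close> is a Hahn set, so the supremum that defines
  the positive part is attained and inherits countable additivity from \<open>\<nu>\<close>.\<close>

lemma emeasure_jordan_pos:
  fixes \<nu> :: "'b set \<Rightarrow> real"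
  assumes N: "finite_measure N1" "finite_measure N2" "sets N1 = sets M" "sets N2 = sets M"
    and \<nu>: "\<And>A. A \<in> sets M \<Longrightarrow> \<nu> A = measure N1 A - measure N2 A"
    and Y: "Y \<in> sets M" "\<And>X. X \<in> sets M \<Longrightarrow> X \<subseteq> Y \<Longrightarrow> \<nu> X \<ge> 0"
      "\<And>X. X \<in> sets M \<Longrightarrow> X \<inter> Y = {} \<Longrightarrow> \<nu> X \<le> 0"
    and A: "A \<in> sets M"
  shows "emeasure (jordan_pos M \<nu>) A = ennreal (\<nu> (A \<inter> Y))"
proof -
  interpret N1: finite_measure N1 by fact
  interpret N2: finite_measure N2 by fact
  have sup: "(SUP B\<in>{B\<in>sets M. B \<subseteq> A}. ennreal (\<nu> B)) = ennreal (\<nu> (A \<inter> Y))" if A: "A \<in> sets M" for A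
  proof (rule antisym)
    show "(SUP B\<in>{B\<in>sets M. B \<subseteq> A}. ennreal (\<nu> B)) \<le> ennreal (\<nu> (A \<inter> Y))"
    proof (rule SUP_least, clarify)
      fix B assume B: "B \<in> sets M" "B \<subseteq> A"
      have add: "\<nu> (C \<union> D) = \<nu> C + \<nu> D" if "C \<in> sets M" "D \<in> sets M" "C \<inter> D = {}" for C D
        using that N by (simp add: \<nu> N1.finite_measure_Union N2.finite_measure_Union)
      have "\<nu> B = \<nu> (B \<inter> Y) + \<nu> (B - Y)"
        using add[of "B \<inter> Y" "B - Y"] B Y(1) by (simp add: Int_Diff_Un Int_Diff_disjoint)
      also have "\<nu> (B - Y) \<le> 0" using B Y(1) by (intro Y(3)) auto
      also have "\<nu> (B \<inter> Y) \<le> \<nu> (A \<inter> Y)"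
      proof -
        have "\<nu> (A \<inter> Y) = \<nu> (B \<inter> Y) + \<nu> (A \<inter> Y - B)"
        proof -
          have "A \<inter> Y = (B \<inter> Y) \<union> (A \<inter> Y - B)" using B(2) by blast
          thus ?thesis using add[of "B \<inter> Y" "A \<inter> Y - B"] A B(1) Y(1) by auto
        qed
        moreover have "\<nu> (A \<inter> Y - B) \<ge> 0" using A B Y(1) by (intro Y(2)) auto
        ultimately show ?thesis by simp
      qed
      finally show "ennreal (\<nu> B) \<le> ennreal (\<nu> (A \<inter> Y))" by (simp add: ennreal_leI)
    qed
    show "ennreal (\<nu> (A \<inter> Y)) \<le> (SUP B\<in>{B\<in>sets M. B \<subseteq> A}. ennreal (\<nu> B))"
      using A Y(1) by (intro SUP_upper) auto
  qed
  let ?m = "\<lambda>A. SUP B\<in>{B\<in>sets M. B \<subseteq> A}. ennreal (\<nu> B)"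
  have "emeasure (jordan_pos M \<nu>) A = ?m A"
  proof (rule emeasure_measure_of[OF jordan_pos_def])
    show "sets M \<subseteq> Pow (space M)" by (rule sets.space_closed)
    have s: "sets (jordan_pos M \<nu>) = sets M" by (simp add: jordan_pos_def)
    show "A \<in> sets (jordan_pos M \<nu>)" using A s by simp
    show "positive (sets (jordan_pos M \<nu>)) ?m"
      unfolding positive_def by (subst sup) (simp_all add: \<nu>)
    show "countably_additive (sets (jordan_pos M \<nu>)) ?m"
      unfolding s
    proof (rule countably_additiveI)
      fix F :: "nat \<Rightarrow> 'b set"
      assume F: "range F \<subseteq> sets M" "disjoint_family F" "\<Union> (range F) \<in> sets M"
      have FY: "range (\<lambda>i. F i \<inter> Y) \<subseteq> sets M" "disjoint_family (\<lambda>i. F i \<inter> Y)"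
        using F Y(1) by (auto simp: disjoint_family_on_def)
      have U: "(\<Union>i. F i \<inter> Y) \<in> sets M" using FY(1) by (rule sets.countable_UN)
      have "(\<lambda>i. measure N1 (F i \<inter> Y) - measure N2 (F i \<inter> Y)) sums
         (measure N1 (\<Union>i. F i \<inter> Y) - measure N2 (\<Union>i. F i \<inter> Y))"
        using FY N by (intro sums_diff N1.finite_measure_UNION N2.finite_measure_UNION) auto
      also have "(\<lambda>i. measure N1 (F i \<inter> Y) - measure N2 (F i \<inter> Y)) = (\<lambda>i. \<nu> (F i \<inter> Y))"
        using FY(1) by (intro ext \<nu>[symmetric]) auto
      also have "measure N1 (\<Union>i. F i \<inter> Y) - measure N2 (\<Union>i. F i \<inter> Y) = \<nu> (\<Union>i. F i \<inter> Y)"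
        using U by (rule \<nu>[symmetric])
      also have "(\<Union>i. F i \<inter> Y) = \<Union> (range F) \<inter> Y" by blast
      finally have s: "(\<lambda>i. \<nu> (F i \<inter> Y)) sums \<nu> (\<Union> (range F) \<inter> Y)" .
      have "(\<Sum>i. ?m (F i)) = (\<Sum>i. ennreal (\<nu> (F i \<inter> Y)))"
        using F(1) by (intro arg_cong[where f=suminf] ext sup) auto
      also have "\<dots> = ennreal (\<Sum>i. \<nu> (F i \<inter> Y))"
        using FY(1) s by (intro suminf_ennreal2 Y(2)) (auto simp: sums_iff)
      also have "\<dots> = ?m (\<Union> (range F))" using s F(3) by (simp add: sums_iff sup)
      finally show "(\<Sum>i. ?m (F i)) = ?m (\<Union> (range F))" .
    qed
  qed
  thus ?thesis by (simp add: sup[OF A])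
qed

text \<open>The Jordan parts differ by \<open>\<nu>\<close>, just as \<open>N1\<close> and \<open>N2\<close> do, which is why any representation of \<open>\<nu>\<close> as a
  difference of finite measures can be used to compute integrals against \<open>\<nu>\<close>.\<close>

lemma jordan_decomposition:
  fixes \<nu> :: "'b set \<Rightarrow> real"
  assumes N: "finite_measure N1" "finite_measure N2" "sets N1 = sets M" "sets N2 = sets M"
    and \<nu>: "\<And>A. A \<in> sets M \<Longrightarrow> \<nu> A = measure N1 A - measure N2 A"
  defines "J1 \<equiv> jordan_pos M \<nu>" and "J2 \<equiv> jordan_pos M (\<lambda>A. - \<nu> A)"
  shows "finite_measure J1" "finite_measure J2" "sets J1 = sets M" "sets J2 = sets M"
    and "A \<in> sets M \<Longrightarrow> measure J1 A - measure J2 A = measure N1 A - measure N2 A"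
proof -
  interpret N1: finite_measure N1 by fact
  interpret N2: finite_measure N2 by fact
  show s: "sets J1 = sets M" "sets J2 = sets M" by (simp_all add: J1_def J2_def jordan_pos_def)
  \<comment> \<open>A Hahn set for \<open>\<nu>\<close>; its complement is one for \<open>- \<nu>\<close>.\<close>
  obtain Y where Y: "Y \<in> sets M" "\<And>X. X \<in> sets M \<Longrightarrow> X \<subseteq> Y \<Longrightarrow> emeasure N2 X \<le> emeasure N1 X"
      "\<And>X. X \<in> sets M \<Longrightarrow> X \<inter> Y = {} \<Longrightarrow> emeasure N1 X \<le> emeasure N2 X"
    using finite_unsigned_Hahn_decomposition[of N1 N2] N by auto
  have Yp: "\<nu> X \<ge> 0" if "X \<in> sets M" "X \<subseteq> Y" for X
    using Y(2)[OF that] \<nu>[OF that(1)] by (simp add: N1.emeasure_eq_measure N2.emeasure_eq_measure)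
  have Yn: "\<nu> X \<le> 0" if "X \<in> sets M" "X \<inter> Y = {}" for X
    using Y(3)[OF that] \<nu>[OF that(1)] by (simp add: N1.emeasure_eq_measure N2.emeasure_eq_measure)
  have e1: "emeasure J1 A = ennreal (\<nu> (A \<inter> Y))" if "A \<in> sets M" for A
    unfolding J1_def using N \<nu> Y(1) Yp Yn that by (rule emeasure_jordan_pos)
  have e2: "emeasure J2 A = ennreal (- \<nu> (A \<inter> (space M - Y)))" if "A \<in> sets M" for A
    unfolding J2_def
  proof (rule emeasure_jordan_pos[OF N(2,1,4,3)])
    show "- \<nu> X \<ge> 0" if "X \<in> sets M" "X \<subseteq> space M - Y" for X
      using Yn[of X] that by auto
    show "- \<nu> X \<le> 0" if "X \<in> sets M" "X \<inter> (space M - Y) = {}" for X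
      using Yp[of X] that sets.sets_into_space[OF that(1)] by auto
  qed (use Y(1) \<nu> that in auto)
  show "finite_measure J1" "finite_measure J2"
    using e1[OF sets.top] e2[OF sets.top] sets_eq_imp_space_eq[OF s(1)] sets_eq_imp_space_eq[OF s(2)]
    by (auto intro!: finite_measureI)
  assume A: "A \<in> sets M"
  have "measure J1 A = \<nu> (A \<inter> Y)" "measure J2 A = - \<nu> (A \<inter> (space M - Y))"
  proof -
    have "A \<inter> (space M - Y) \<inter> Y = {}" by blast
    hence "\<nu> (A \<inter> (space M - Y)) \<le> 0" using A Y(1) by (intro Yn) auto
    thus "measure J1 A = \<nu> (A \<inter> Y)" "measure J2 A = - \<nu> (A \<inter> (space M - Y))"
      using e1[OF A] e2[OF A] Yp[of "A \<inter> Y"] A Y(1) by (simp_all add: measure_def)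
  qed
  moreover have "\<nu> A = \<nu> (A \<inter> Y) + \<nu> (A \<inter> (space M - Y))"
  proof -
    have "A = (A \<inter> Y) \<union> (A \<inter> (space M - Y))" using sets.sets_into_space[OF A] by auto
    moreover have "\<nu> ((A \<inter> Y) \<union> (A \<inter> (space M - Y))) = \<nu> (A \<inter> Y) + \<nu> (A \<inter> (space M - Y))"
    proof -
      have "measure N1 ((A \<inter> Y) \<union> (A \<inter> (space M - Y))) = measure N1 (A \<inter> Y) + measure N1 (A \<inter> (space M - Y))"
        by (rule N1.finite_measure_Union) (use A Y(1) N in auto)
      moreover have "measure N2 ((A \<inter> Y) \<union> (A \<inter> (space M - Y))) = measure N2 (A \<inter> Y) + measure N2 (A \<inter> (space M - Y))"
        by (rule N2.finite_measure_Union) (use A Y(1) N in auto)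
      ultimately show ?thesis using A Y(1) by (subst (1 2 3) \<nu>) auto
    qed
    ultimately show ?thesis by simp
  qed
  ultimately show "measure J1 A - measure J2 A = measure N1 A - measure N2 A"
    using \<nu>[OF A] by simp
qed

definition level_set :: "'b measure \<Rightarrow> ('b \<Rightarrow> real) \<Rightarrow> nat \<Rightarrow> nat \<Rightarrow> 'b set" where
  "level_set M g p i = {x\<in>space M. real (Suc i) \<le> real (Suc p) * g x}"

lemma level_set_sets [measurable]: "g \<in> borel_measurable M \<Longrightarrow> level_set M g p i \<in> sets M"
  unfolding level_set_def by measurable

text \<open>The sum counts the positive integers up to \<open>Suc p * g x\<close>, so it is \<open>\<lfloor>Suc p * g x\<rfloor>\<close>. The number of
  terms, \<open>Suc p * K\<close>, does not depend on \<open>x\<close>, so the same approximation works for sums of operators.\<close>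

lemma level_set_approximation:
  assumes "x \<in> space M" "0 \<le> g x" "g x \<le> real K"
  shows "\<bar>(\<Sum>i<Suc p * K. indicator (level_set M g p i) x) / real (Suc p) - g x\<bar> \<le> 1 / real (Suc p)"
proof -
  define m where "m = nat \<lfloor>real (Suc p) * g x\<rfloor>"
  have pos: "real (Suc p) * g x \<ge> 0" using assms by simp
  have m: "real m \<le> real (Suc p) * g x" "real (Suc p) * g x < real m + 1"
    using pos by (simp_all add: m_def)
  have "real m \<le> real (Suc p * K)"
    using m(1) mult_left_mono[OF assms(3), of "real (Suc p)"] by (simp only: of_nat_mult) linarith
  hence mK: "m \<le> Suc p * K" by linarith
  have "real (Suc i) \<le> real (Suc p) * g x \<longleftrightarrow> i < m" for i
    using m by (smt (verit) less_eq_Suc_le of_nat_Suc of_nat_le_iff of_nat_less_iff not_less not_less_eq_eq)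
  hence "(\<Sum>i<Suc p * K. indicator (level_set M g p i) x) = (\<Sum>i<Suc p * K. if i < m then 1 else 0 :: real)"
    using assms(1) by (intro sum.cong) (auto simp: level_set_def indicator_def)
  also have "\<dots> = (\<Sum>i<m. 1)"
    using mK by (intro sum.mono_neutral_cong_right) auto
  finally have s: "(\<Sum>i<Suc p * K. indicator (level_set M g p i) x) = real m" by simp
  have "real m / real (Suc p) \<le> g x" "g x \<le> (real m + 1) / real (Suc p)"
    using m by (simp_all add: pos_divide_le_eq pos_le_divide_eq mult.commute del: of_nat_Suc)
  thus ?thesis unfolding s add_divide_distrib by linarith
qed

lemma integral_level_set_approximation:
  fixes g :: "'b \<Rightarrow> real"
  assumes N: "finite_measure N" and sN: "sets N = sets M"
    and g: "g \<in> borel_measurable M" "\<And>x. x \<in> space M \<Longrightarrow> 0 \<le> g x \<and> g x \<le> real K"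
  shows "integrable N g"
    and "\<bar>(\<Sum>i<Suc p * K. measure N (level_set M g p i)) / real (Suc p) - (LINT x|N. g x)\<bar>
          \<le> measure N (space N) / real (Suc p)"
proof -
  interpret finite_measure N by fact
  have sp: "space N = space M" using sN by (rule sets_eq_imp_space_eq)
  have gN[measurable]: "g \<in> borel_measurable N" using g(1) sN by (simp cong: measurable_cong_sets)
  show int: "integrable N g"
    by (rule integrable_const_bound[where B="real K"]) (use g(2) sp in \<open>auto intro!: AE_I2\<close>)
  have ls: "level_set M g p i \<in> sets N" for i using level_set_sets[OF g(1)] sN by simp
  define h where "h x = (\<Sum>i<Suc p * K. indicator (level_set M g p i) x) / real (Suc p)" for x
  have ih: "integrable N h" unfolding h_def using ls by (intro integrable_divide integrable_sum integrable_real_indicator) (auto simp: emeasure_eq_measure)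
  have "(LINT x|N. h x) = (\<Sum>i<Suc p * K. measure N (level_set M g p i)) / real (Suc p)"
    unfolding h_def using ls
    by (subst integral_divide_zero, subst Bochner_Integration.integral_sum)
       (auto simp: emeasure_eq_measure sets.Int_space_eq2 simp del: of_nat_Suc)
  hence "\<bar>(\<Sum>i<Suc p * K. measure N (level_set M g p i)) / real (Suc p) - (LINT x|N. g x)\<bar> 
     = \<bar>LINT x|N. h x - g x\<bar>" using ih int by simp
  also have "\<dots> \<le> (LINT x|N. \<bar>h x - g x\<bar>)" by (rule integral_abs_bound)
  also have "\<dots> \<le> (LINT x|N. 1 / real (Suc p))"
    using level_set_approximation[of _ M g K p] g(2) sp
    by (intro integral_mono integrable_abs Bochner_Integration.integrable_diff ih int)
      (auto simp: h_def simp del: of_nat_Suc)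
  also have "\<dots> = measure N (space N) / real (Suc p)" by simp
  finally show "\<bar>(\<Sum>i<Suc p * K. measure N (level_set M g p i)) / real (Suc p) - (LINT x|N. g x)\<bar>
          \<le> measure N (space N) / real (Suc p)" .
qed

lemma tendsto_const_over_Suc: "(\<lambda>p. c / real (Suc p)) \<longlonglongrightarrow> 0"
  using tendsto_mult[OF tendsto_const[of c] LIMSEQ_inverse_real_of_nat] by (simp add: divide_inverse)

lemma integral_level_set_limit:
  fixes g :: "'b \<Rightarrow> real"
  assumes "finite_measure N" "sets N = sets M"
    and "g \<in> borel_measurable M" "\<And>x. x \<in> space M \<Longrightarrow> 0 \<le> g x \<and> g x \<le> real K"
  shows "(\<lambda>p. (\<Sum>i<Suc p * K. measure N (level_set M g p i)) / real (Suc p)) \<longlonglongrightarrow> (LINT x|N. g x)"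
  by (rule LIM_zero_cancel, rule Lim_null_comparison[OF _ tendsto_const_over_Suc[of "measure N (space N)"]])
    (use integral_level_set_approximation(2)[OF assms] in \<open>auto simp del: of_nat_Suc\<close>)

text \<open>Both sides are limits of the same sums over level sets, since these only involve \<open>\<nu>\<close>.\<close>

lemma signed_integral_eq_diff:
  fixes g :: "'b \<Rightarrow> real"
  assumes N: "finite_measure N1" "finite_measure N2" "sets N1 = sets M" "sets N2 = sets M"
    and \<nu>: "\<And>A. A \<in> sets M \<Longrightarrow> \<nu> A = measure N1 A - measure N2 A"
    and g: "g \<in> borel_measurable M" "\<And>x. x \<in> space M \<Longrightarrow> 0 \<le> g x \<and> g x \<le> real K"
  shows "signed_integral M \<nu> (\<lambda>x. of_real (g x)) = of_real ((LINT x|N1. g x) - (LINT x|N2. g x))"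
proof -
  note J = jordan_decomposition[OF N \<nu>]
  let ?J1 = "jordan_pos M \<nu>" and ?J2 = "jordan_pos M (\<lambda>A. - \<nu> A)"
  let ?S = "\<lambda>N p. (\<Sum>i<Suc p * K. measure N (level_set M g p i)) / real (Suc p)"
  have limJ: "(\<lambda>p. ?S ?J1 p - ?S ?J2 p) \<longlonglongrightarrow> (LINT x|?J1. g x) - (LINT x|?J2. g x)"
    using J g by (intro tendsto_diff integral_level_set_limit) auto
  have same: "(\<lambda>p. ?S ?J1 p - ?S ?J2 p) = (\<lambda>p. ?S N1 p - ?S N2 p)"
  proof
    fix p
    have S_diff: "?S A p - ?S B p = (\<Sum>i<Suc p * K. measure A (level_set M g p i) - measure B (level_set M g p i)) / real (Suc p)"
      for A B by (simp only: sum_subtractf diff_divide_distrib)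
    show "?S ?J1 p - ?S ?J2 p = ?S N1 p - ?S N2 p"
      unfolding S_diff using J(5)[OF _ level_set_sets[OF g(1)]] by (intro arg_cong2[where f="(/)"] sum.cong refl) auto
  qed
  have limN: "(\<lambda>p. ?S N1 p - ?S N2 p) \<longlonglongrightarrow> (LINT x|N1. g x) - (LINT x|N2. g x)"
    using N g by (intro tendsto_diff integral_level_set_limit) auto
  have "(LINT x|?J1. g x) - (LINT x|?J2. g x) = (LINT x|N1. g x) - (LINT x|N2. g x)"
    using limJ limN unfolding same by (rule LIMSEQ_unique)
  thus ?thesis
    by (simp only: signed_integral_def integral_complex_of_real of_real_diff[symmetric])
qed

section \<open>Integrals of bounded functions against a semi-spectral measure\<close>

text \<open>The quadratic bound is what polarization delivers; homogeneity reduces it to unit vectors and makes it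
  linear.\<close>

lemma bounded_clinear_intro:
  fixes T :: "'a::complex_hilbert_space \<Rightarrow> 'a"
  assumes "\<And>x y. T (x + y) = T x + T y" "\<And>c x. T (c *\<^sub>C x) = c *\<^sub>C T x"
    and "\<And>x. norm (T x) \<le> B * (norm x + 1)\<^sup>2"
  shows "bounded_clinear T"
  unfolding bounded_clinear_def
proof
  have "T (r *\<^sub>R x) = r *\<^sub>R T x" for r x by (simp add: scaleR_scaleC assms(2))
  moreover have "norm (T x) \<le> norm x * (4 * B)" for x
  proof (cases "x = 0")
    case True thus ?thesis using assms(2)[of 0 0] by simp
  next
    case False
    hence "T x = norm x *\<^sub>R T (x /\<^sub>R norm x)" by (simp add: calculation flip: assms(1))
    hence "norm (T x) = norm x * norm (T (x /\<^sub>R norm x))" by (metis abs_norm_cancel norm_scaleR)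
    also have "\<dots> \<le> norm x * (B * (norm (x /\<^sub>R norm x) + 1)\<^sup>2)" by (intro mult_left_mono assms(3)) simp
    also have "norm (x /\<^sub>R norm x) = 1" using False by simp
    finally show ?thesis by (simp add: mult_ac)
  qed
  ultimately show "bounded_linear T" using assms(1) by (intro bounded_linear_intro)
qed (use assms(2) in auto)

lemma bounded_clinear_add: "bounded_clinear T \<Longrightarrow> T (x + y) = T x + T y"
  and bounded_clinear_scaleC: "bounded_clinear T \<Longrightarrow> T (c *\<^sub>C x) = c *\<^sub>C T x"
  unfolding bounded_clinear_def by (auto simp: bounded_linear.axioms linear_add bounded_linear.linear)

lemma positive_operator_real:
  assumes "positive_operator T"
  shows "cinner (T x) x = of_real (Re (cinner (T x) x))" "Re (cinner (T x) x) \<ge> 0"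
  using assms unfolding positive_operator_def by (auto simp: complex_nonneg_Reals_iff complex_eq_iff)

lemma space_circle_borel [simp]: "space circle_borel = sphere 0 1"
  by (simp add: circle_borel_def space_restrict_space)

definition quadratic_measure ::
    "(complex set \<Rightarrow> 'a::complex_hilbert_space \<Rightarrow> 'a) \<Rightarrow> 'a \<Rightarrow> complex measure" where
  "quadratic_measure \<mu> x =
     measure_of (space circle_borel) (sets circle_borel) (\<lambda>A. ennreal (Re (cinner (\<mu> A x) x)))"

lemma quadratic_measure:
  assumes \<mu>: "semi_spectral_measure \<mu>"
  shows sets_quadratic_measure: "sets (quadratic_measure \<mu> x) = sets circle_borel"
    and finite_quadratic_measure: "finite_measure (quadratic_measure \<mu> x)"
    and measure_quadratic_measure:
      "A \<in> sets circle_borel \<Longrightarrow> measure (quadratic_measure \<mu> x) A = Re (cinner (\<mu> A x) x)"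
proof -
  show s: "sets (quadratic_measure \<mu> x) = sets circle_borel"
    by (simp add: quadratic_measure_def del: space_circle_borel)
  have nonneg: "Re (cinner (\<mu> A x) x) \<ge> 0" if "A \<in> sets circle_borel" for A
    using \<mu> that positive_operator_real(2) by (auto simp: semi_spectral_measure_def)
  have e: "emeasure (quadratic_measure \<mu> x) A = ennreal (Re (cinner (\<mu> A x) x))"
    if A: "A \<in> sets circle_borel" for A
  proof (rule emeasure_measure_of[OF quadratic_measure_def])
    show "sets circle_borel \<subseteq> Pow (space circle_borel)" by (rule sets.space_closed)
    show "A \<in> sets (quadratic_measure \<mu> x)" using A s by simp
    have "\<mu> ({} \<union> {}) = (\<lambda>x. \<mu> {} x + \<mu> {} x)"
      using \<mu> unfolding semi_spectral_measure_def by blast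
    hence "\<mu> {} x = \<mu> {} x + \<mu> {} x" by (simp add: fun_eq_iff)
    thus "positive (sets (quadratic_measure \<mu> x)) (\<lambda>A. ennreal (Re (cinner (\<mu> A x) x)))"
      by (simp add: positive_def)
    show "countably_additive (sets (quadratic_measure \<mu> x)) (\<lambda>A. ennreal (Re (cinner (\<mu> A x) x)))"
      unfolding s
    proof (rule countably_additiveI)
      fix F :: "nat \<Rightarrow> complex set"
      assume F: "range F \<subseteq> sets circle_borel" "disjoint_family F"
      have "(\<lambda>i. cinner (\<mu> (F i) x) x) sums cinner (\<mu> (\<Union>i. F i) x) x"
        using \<mu> F unfolding semi_spectral_measure_def regular_complex_measure_def complex_measure_def
        by blast
      hence R: "(\<lambda>i. Re (cinner (\<mu> (F i) x) x)) sums Re (cinner (\<mu> (\<Union>i. F i) x) x)" by (rule sums_Re)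
      have "(\<Sum>i. ennreal (Re (cinner (\<mu> (F i) x) x))) = ennreal (\<Sum>i. Re (cinner (\<mu> (F i) x) x))"
        using F(1) R by (intro suminf_ennreal2 nonneg) (auto simp: sums_iff)
      thus "(\<Sum>i. ennreal (Re (cinner (\<mu> (F i) x) x))) = ennreal (Re (cinner (\<mu> (\<Union> (range F)) x) x))"
        using R by (simp add: sums_iff)
    qed
  qed
  show "finite_measure (quadratic_measure \<mu> x)"
    using e[OF sets.top] sets_eq_imp_space_eq[OF s] by (intro finite_measureI) auto
  show "A \<in> sets circle_borel \<Longrightarrow> measure (quadratic_measure \<mu> x) A = Re (cinner (\<mu> A x) x)"
    using e nonneg by (simp add: measure_def)
qed

text \<open>This is the form in which \<open>signed_integral_eq_diff\<close> applies to real and imaginary part of \<open>cinner (\<mu> A x) y\<close>.\<close>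

lemma semi_spectral_measure_polarization:
  assumes \<mu>: "semi_spectral_measure \<mu>" and A: "A \<in> sets circle_borel"
  defines "m \<equiv> \<lambda>v. measure (quadratic_measure \<mu> ((1/2) *\<^sub>R v)) A"
  shows "Re (cinner (\<mu> A x) y) = m (x + y) - m (x - y)"
    and "Im (cinner (\<mu> A x) y) = m (x + \<i> *\<^sub>C y) - m (x - \<i> *\<^sub>C y)"
proof -
  have pos: "positive_operator (\<mu> A)" using \<mu> A by (auto simp: semi_spectral_measure_def)
  hence lin: "bounded_clinear (\<mu> A)" by (simp add: positive_operator_def)
  have m: "cinner (\<mu> A v) v = of_real (4 * m v)" for v
  proof -
    have "m v = Re (cinner (\<mu> A ((1/2) *\<^sub>R v)) ((1/2) *\<^sub>R v))"
      by (simp only: m_def measure_quadratic_measure[OF \<mu> A])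
    also have "\<dots> = Re (cinner (\<mu> A v) v) / 4"
      by (simp add: scaleR_scaleC bounded_clinear_scaleC[OF lin] cinner_scaleC_left cinner_scaleC_right)
    finally have e: "4 * m v = Re (cinner (\<mu> A v) v)" by simp
    show ?thesis unfolding e by (rule positive_operator_real(1)[OF pos])
  qed
  have *: "cinner (\<mu> A x) y = of_real (m (x + y) - m (x - y)) + \<i> * of_real (m (x + \<i> *\<^sub>C y) - m (x - \<i> *\<^sub>C y))"
    unfolding polarization[OF lin, of x y] m by (simp add: field_simps)
  show "Re (cinner (\<mu> A x) y) = m (x + y) - m (x - y)"
    "Im (cinner (\<mu> A x) y) = m (x + \<i> *\<^sub>C y) - m (x - \<i> *\<^sub>C y)"
    unfolding * by simp_all
qed

lemma quadratic_measure_total: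
  fixes \<mu> :: "complex set \<Rightarrow> 'a::complex_hilbert_space \<Rightarrow> 'a"
  assumes \<mu>: "semi_spectral_measure \<mu>"
  obtains C where "C \<ge> 0" "\<And>x. measure (quadratic_measure \<mu> x) (space (quadratic_measure \<mu> x)) \<le> C * (norm x)\<^sup>2"
proof -
  have "bounded_linear (\<mu> (space circle_borel))"
    using \<mu> sets.top[of circle_borel] by (auto simp: semi_spectral_measure_def positive_operator_def bounded_clinear_def)
  then obtain C where C: "C \<ge> 0" "\<And>x. norm (\<mu> (space circle_borel) x) \<le> norm x * C"
    using bounded_linear.nonneg_bounded by blast
  have "measure (quadratic_measure \<mu> x) (space (quadratic_measure \<mu> x)) \<le> C * (norm x)\<^sup>2" for x
  proof -
    have "measure (quadratic_measure \<mu> x) (space (quadratic_measure \<mu> x)) = Re (cinner (\<mu> (space circle_borel) x) x)"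
      unfolding sets_eq_imp_space_eq[OF sets_quadratic_measure[OF \<mu>]]
      by (rule measure_quadratic_measure[OF \<mu> sets.top])
    also have "\<dots> \<le> norm (\<mu> (space circle_borel) x) * norm x"
      using complex_Re_le_cmod cinner_Cauchy_Schwarz by (rule order_trans)
    also have "\<dots> \<le> (norm x * C) * norm x" using C(2) by (intro mult_right_mono) auto
    finally show ?thesis by (simp add: power2_eq_square mult_ac)
  qed
  thus thesis using C(1) that by blast
qed

text \<open>The operator is the pointwise limit of \<open>S p\<close>, the sum of \<open>\<mu> A\<close> over level sets \<open>A\<close> of \<open>g\<close>, divided by \<open>Suc p\<close>. The
  quadratic forms of \<open>S p\<close> converge at a rate controlled by the total mass of the quadratic measures,
  and polarization carries this over to \<open>cinner (S p x) y\<close>, with limit \<open>J x y\<close>, and hence to norms. The same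
  polarization turns \<open>J x y\<close> into the integral against the complex measure.\<close>

lemma spectral_integral_exists:
  fixes \<mu> :: "complex set \<Rightarrow> 'a::complex_hilbert_space \<Rightarrow> 'a" and g :: "complex \<Rightarrow> real"
  assumes \<mu>: "semi_spectral_measure \<mu>"
    and g: "g \<in> borel_measurable circle_borel" "\<And>\<zeta>. \<zeta> \<in> space circle_borel \<Longrightarrow> 0 \<le> g \<zeta> \<and> g \<zeta> \<le> real K"
  obtains T where "bounded_clinear T"
    and "\<And>x y. cinner (T x) y = complex_measure_integral circle_borel (\<lambda>A. cinner (\<mu> A x) y)
               (\<lambda>\<zeta>. complex_of_real (g \<zeta>))"
    and "\<And>x. cinner (T x) x = of_real (LINT \<zeta>|quadratic_measure \<mu> x. g \<zeta>)"
proof -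
  note fin = finite_quadratic_measure[OF \<mu>] and sets = sets_quadratic_measure[OF \<mu>]
  define L where "L p i = level_set circle_borel g p i" for p i
  have L: "L p i \<in> sets circle_borel" for p i unfolding L_def by (rule level_set_sets[OF g(1)])
  have lin: "bounded_clinear (\<mu> A)" if "A \<in> sets circle_borel" for A
    using \<mu> that by (auto simp: semi_spectral_measure_def positive_operator_def)
  define S where "S p x = (1 / real (Suc p)) *\<^sub>R (\<Sum>i<Suc p * K. \<mu> (L p i) x)" for p x
  define Q where "Q x = (LINT \<zeta>|quadratic_measure \<mu> x. g \<zeta>)" for x
  have S_lin: "bounded_clinear (S p)" for p
    unfolding bounded_clinear_def
  proof
    show "bounded_linear (S p)"
      unfolding S_def using lin[OF L]
      by (intro bounded_linear_const_scaleR bounded_linear_sum) (auto simp: bounded_clinear_def)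
    show "\<forall>c x. S p (c *\<^sub>C x) = c *\<^sub>C S p x"
      by (simp add: S_def scaleR_scaleC scaleC_scaleC bounded_clinear_scaleC[OF lin[OF L]] mult.commute
          flip: scaleC_sum_right)
  qed
  have S_diag: "cinner (S p x) x = of_real ((\<Sum>i<Suc p * K. measure (quadratic_measure \<mu> x) (L p i)) / real (Suc p))" for p x
  proof -
    have "cinner (\<mu> (L p i) x) x = of_real (measure (quadratic_measure \<mu> x) (L p i))" for i
      using \<mu> L positive_operator_real(1)[of "\<mu> (L p i)" x]
      by (simp add: measure_quadratic_measure[OF \<mu> L] semi_spectral_measure_def)
    thus ?thesis by (simp add: S_def cinner_scaleR_left cinner_sum_left del: of_nat_Suc)
  qed
  obtain C where C: "C \<ge> 0" "\<And>x. measure (quadratic_measure \<mu> x) (space (quadratic_measure \<mu> x)) \<le> C * (norm x)\<^sup>2"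
    using quadratic_measure_total[OF \<mu>] by blast
  have Q_approx: "cmod (cinner (S p v) v - of_real (Q v)) \<le> C * (norm v)\<^sup>2 / real (Suc p)" for p v
  proof -
    have "cmod (cinner (S p v) v - of_real (Q v))
      = \<bar>(\<Sum>i<Suc p * K. measure (quadratic_measure \<mu> v) (L p i)) / real (Suc p) - Q v\<bar>"
      unfolding S_diag of_real_diff[symmetric] norm_of_real ..
    also have "\<dots> \<le> measure (quadratic_measure \<mu> v) (space (quadratic_measure \<mu> v)) / real (Suc p)"
      unfolding L_def Q_def by (rule integral_level_set_approximation(2)[OF fin sets g])
    also have "\<dots> \<le> C * (norm v)\<^sup>2 / real (Suc p)" using C(2) by (intro divide_right_mono) auto
    finally show ?thesis .
  qed
  have Q_bound: "\<bar>Q v\<bar> \<le> real K * C * (norm v)\<^sup>2" for v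
  proof -
    interpret finite_measure "quadratic_measure \<mu> v" by (rule fin)
    have sp: "space (quadratic_measure \<mu> v) = space circle_borel" using sets by (rule sets_eq_imp_space_eq)
    have "0 \<le> Q v" unfolding Q_def using g(2) sp by (intro integral_nonneg_AE) auto
    moreover have "Q v \<le> (LINT \<zeta>|quadratic_measure \<mu> v. real K)"
      unfolding Q_def using integral_level_set_approximation(1)[OF fin sets g] g(2) sp by (intro integral_mono) auto
    moreover have "(LINT \<zeta>|quadratic_measure \<mu> v. real K) \<le> real K * (C * (norm v)\<^sup>2)"
      using mult_left_mono[OF C(2)[of v], of "real K"] by (simp add: mult.commute)
    ultimately show ?thesis by (simp add: mult_ac)
  qed
  define J where "J x y = (of_real (Q (x + y)) - of_real (Q (x - y))
      + \<i> * (of_real (Q (x + \<i> *\<^sub>C y)) - of_real (Q (x - \<i> *\<^sub>C y)))) / 4" for x y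
  have four: "cmod ((a - b + \<i> * (c - d)) / 4) \<le> B"
    if "cmod a \<le> B" "cmod b \<le> B" "cmod c \<le> B" "cmod d \<le> B" for a b c d B
  proof -
    have "cmod (a - b + \<i> * (c - d)) \<le> cmod (a - b) + cmod (\<i> * (c - d))" by (rule norm_triangle_ineq)
    also have "\<dots> = cmod (a - b) + cmod (c - d)" by (simp add: norm_mult)
    also have "\<dots> \<le> (cmod a + cmod b) + (cmod c + cmod d)" by (intro add_mono norm_triangle_ineq4)
    finally show ?thesis using that by (simp add: norm_divide)
  qed
  have le_sum: "(norm (x + y))\<^sup>2 \<le> (norm x + norm y)\<^sup>2" "(norm (x - y))\<^sup>2 \<le> (norm x + norm y)\<^sup>2" for x y :: 'a
    by (intro power_mono norm_triangle_ineq norm_triangle_ineq4 norm_ge_zero)+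
  have le_sum_i: "(norm (x + \<i> *\<^sub>C y))\<^sup>2 \<le> (norm x + norm y)\<^sup>2" "(norm (x - \<i> *\<^sub>C y))\<^sup>2 \<le> (norm x + norm y)\<^sup>2" for x y :: 'a
    using le_sum[of x "\<i> *\<^sub>C y"] by simp_all
  have J_approx: "cmod (cinner (S p x) y - J x y) \<le> C * (norm x + norm y)\<^sup>2 / real (Suc p)" for p x y
  proof -
    let ?e = "\<lambda>v. cinner (S p v) v - of_real (Q v)"
    have le: "cmod (?e v) \<le> C * (norm x + norm y)\<^sup>2 / real (Suc p)"
      if "(norm v)\<^sup>2 \<le> (norm x + norm y)\<^sup>2" for v
      using Q_approx[of p v] that C(1) by (rule order_trans[OF _ divide_right_mono[OF mult_left_mono]]) auto
    have "cinner (S p x) y - J x y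
      = (?e (x + y) - ?e (x - y) + \<i> * (?e (x + \<i> *\<^sub>C y) - ?e (x - \<i> *\<^sub>C y))) / 4"
      unfolding polarization[OF S_lin, of p x y] J_def by (simp add: field_simps)
    also have "cmod \<dots> \<le> C * (norm x + norm y)\<^sup>2 / real (Suc p)"
      by (intro four le le_sum le_sum_i)
    finally show ?thesis .
  qed
  have lim0: "(\<lambda>p. c / real (Suc p)) \<longlonglongrightarrow> 0" for c by (rule tendsto_const_over_Suc)
  have S_J: "(\<lambda>p. cinner (S p x) y) \<longlonglongrightarrow> J x y" for x y
    by (rule LIM_zero_cancel, rule Lim_null_comparison[OF _ lim0[of "C * (norm x + norm y)\<^sup>2"]])
      (use J_approx in auto)
  have S_Q: "(\<lambda>p. cinner (S p v) v) \<longlonglongrightarrow> of_real (Q v)" for v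
    by (rule LIM_zero_cancel, rule Lim_null_comparison[OF _ lim0[of "C * (norm v)\<^sup>2"]])
      (use Q_approx in auto)
  have "Cauchy (\<lambda>p. S p x)" for x
  proof (rule CauchyI)
    define D where "D = C * (norm x + 1)\<^sup>2"
    fix e :: real assume "e > 0"
    hence "\<forall>\<^sub>F p in sequentially. D / real (Suc p) < e / 2" using lim0[of D] by (intro order_tendstoD(2)) auto
    then obtain N where N: "\<And>p. p \<ge> N \<Longrightarrow> D / real (Suc p) < e / 2" unfolding eventually_sequentially by blast
    have "norm (S p x - S q x) < e" if "p \<ge> N" "q \<ge> N" for p q
    proof -
      have "norm (S p x - S q x) \<le> D / real (Suc p) + D / real (Suc q)"
      proof (rule norm_le_of_cinner_le)
        fix y :: 'a assume y: "norm y \<le> 1"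
        have "C * (norm x + norm y)\<^sup>2 \<le> D"
          unfolding D_def using y C(1) by (intro mult_left_mono power_mono) auto
        hence le: "cmod (cinner (S p x) y - J x y) \<le> D / real (Suc p)" for p
          using J_approx[of p x y] divide_right_mono[of _ D "real (Suc p)"] by (meson of_nat_0_le_iff order_trans)
        have "cinner (S p x - S q x) y = (cinner (S p x) y - J x y) - (cinner (S q x) y - J x y)"
          by (simp add: cinner_diff_left)
        also have "cmod \<dots> \<le> D / real (Suc p) + D / real (Suc q)"
          using norm_triangle_ineq4 add_mono[OF le le] by (rule order_trans)
        finally show "cmod (cinner (S p x - S q x) y) \<le> D / real (Suc p) + D / real (Suc q)" .
      qed
      also have "\<dots> < e" using N[OF that(1)] N[OF that(2)] by linarith
      finally show ?thesis .
    qed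
    thus "\<exists>N. \<forall>p\<ge>N. \<forall>q\<ge>N. norm (S p x - S q x) < e" by blast
  qed
  hence "\<exists>t. (\<lambda>p. S p x) \<longlonglongrightarrow> t" for x using Cauchy_convergent_iff convergent_def by blast
  then obtain T where T: "\<And>x. (\<lambda>p. S p x) \<longlonglongrightarrow> T x" by metis
  have T_J: "cinner (T x) y = J x y" for x y
    using tendsto_cinner[OF T tendsto_const] S_J by (rule LIMSEQ_unique)
  have T_diag: "cinner (T x) x = of_real (Q x)" for x
    using tendsto_cinner[OF T tendsto_const] S_Q by (rule LIMSEQ_unique)
  have T_lin: "bounded_clinear T"
  proof (rule bounded_clinear_intro)
    fix x y :: 'a and c :: complex
    show "T (x + y) = T x + T y"
      using T[of "x + y"] tendsto_add[OF T[of x] T[of y]]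
      unfolding bounded_clinear_add[OF S_lin] by (rule LIMSEQ_unique)
    show "T (c *\<^sub>C x) = c *\<^sub>C T x"
      using T[of "c *\<^sub>C x"] tendsto_scaleC[OF tendsto_const T[of x]]
      unfolding bounded_clinear_scaleC[OF S_lin] by (rule LIMSEQ_unique)
    show "norm (T x) \<le> (real K * C) * (norm x + 1)\<^sup>2"
    proof (rule norm_le_of_cinner_le)
      fix y :: 'a assume y: "norm y \<le> 1"
      have le: "cmod (of_real (Q v)) \<le> real K * C * (norm x + 1)\<^sup>2" if "(norm v)\<^sup>2 \<le> (norm x + norm y)\<^sup>2" for v
      proof -
        have "(norm x + norm y)\<^sup>2 \<le> (norm x + 1)\<^sup>2" using y by (intro power_mono) auto
        hence "real K * C * (norm v)\<^sup>2 \<le> real K * C * (norm x + 1)\<^sup>2" using that C(1) by (intro mult_left_mono) auto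
        thus ?thesis using Q_bound[of v] by simp
      qed
      show "cmod (cinner (T x) y) \<le> (real K * C) * (norm x + 1)\<^sup>2"
        unfolding T_J J_def by (intro four le le_sum le_sum_i)
    qed
  qed
  have Q_half: "Q ((1/2) *\<^sub>R v) = Q v / 4" for v
  proof -
    have "complex_of_real (Q ((1/2) *\<^sub>R v)) = of_real (Q v / 4)"
      unfolding T_diag[symmetric] scaleR_scaleC bounded_clinear_scaleC[OF T_lin] cinner_scaleC_left cinner_scaleC_right
      by (simp add: T_diag)
    thus ?thesis by (simp only: of_real_eq_iff)
  qed
  have J_integral: "J x y = complex_measure_integral circle_borel (\<lambda>A. cinner (\<mu> A x) y) (\<lambda>\<zeta>. complex_of_real (g \<zeta>))" for x y
  proof -
    \<comment> \<open>Halving the vectors absorbs the factor \<open>1/4\<close> of the polarization identity into the measures.\<close>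
    let ?N = "\<lambda>v. quadratic_measure \<mu> ((1/2) *\<^sub>R v)"
    have re: "signed_integral circle_borel (\<lambda>A. Re (cinner (\<mu> A x) y)) (\<lambda>\<zeta>. complex_of_real (g \<zeta>))
        = of_real ((LINT \<zeta>|?N (x + y). g \<zeta>) - (LINT \<zeta>|?N (x - y). g \<zeta>))"
      using semi_spectral_measure_polarization(1)[OF \<mu>] g fin sets by (intro signed_integral_eq_diff) auto
    have im: "signed_integral circle_borel (\<lambda>A. Im (cinner (\<mu> A x) y)) (\<lambda>\<zeta>. complex_of_real (g \<zeta>))
        = of_real ((LINT \<zeta>|?N (x + \<i> *\<^sub>C y). g \<zeta>) - (LINT \<zeta>|?N (x - \<i> *\<^sub>C y). g \<zeta>))"
      using semi_spectral_measure_polarization(2)[OF \<mu>] g fin sets by (intro signed_integral_eq_diff) auto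
    show ?thesis
      unfolding complex_measure_integral_def re im Q_def[symmetric] Q_half J_def by (simp add: field_simps)
  qed
  show thesis
  proof (rule that[OF T_lin])
    show "cinner (T x) y = complex_measure_integral circle_borel (\<lambda>A. cinner (\<mu> A x) y)
        (\<lambda>\<zeta>. complex_of_real (g \<zeta>))" for x y by (simp only: T_J J_integral)
    show "cinner (T x) x = of_real (LINT \<zeta>|quadratic_measure \<mu> x. g \<zeta>)" for x
      by (simp only: T_diag Q_def)
  qed
qed

section \<open>The Poisson integral and its Fourier expansion\<close>

lemma poisson_kernel_bounds:
  assumes "cmod z < 1" "cmod \<zeta> = 1"
  shows "0 \<le> poisson_kernel z \<zeta>" "poisson_kernel z \<zeta> \<le> 2 / (1 - cmod z)"
proof -
  let ?t = "cmod z"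
  have d: "1 - ?t \<le> cmod (z - \<zeta>)" using norm_triangle_ineq2[of \<zeta> z] assms by (simp add: norm_minus_commute)
  have t: "?t\<^sup>2 \<le> 1" using assms(1) by (simp add: power_le_one)
  show "0 \<le> poisson_kernel z \<zeta>" using t by (simp add: poisson_kernel_def)
  have "poisson_kernel z \<zeta> \<le> (1 - ?t\<^sup>2) / (1 - ?t)\<^sup>2"
    unfolding poisson_kernel_def using d t assms(1) by (intro divide_left_mono power_mono mult_pos_pos) auto
  also have "1 - ?t\<^sup>2 = (1 + ?t) * (1 - ?t)" by (simp add: power2_eq_square algebra_simps)
  also have "(1 + ?t) * (1 - ?t) / (1 - ?t)\<^sup>2 = (1 + ?t) / (1 - ?t)"
    using assms(1) by (simp add: power2_eq_square)
  also have "\<dots> \<le> 2 / (1 - ?t)" using assms(1) by (intro divide_right_mono) auto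
  finally show "poisson_kernel z \<zeta> \<le> 2 / (1 - cmod z)" .
qed

lemma borel_measurable_circle_borel:
  "f \<in> borel_measurable borel \<Longrightarrow> f \<in> borel_measurable circle_borel"
  unfolding circle_borel_def by (rule measurable_restrict_space1)

lemma poisson_kernel_measurable: "poisson_kernel z \<in> borel_measurable circle_borel"
  unfolding poisson_kernel_def[abs_def] by (intro borel_measurable_circle_borel) measurable

text \<open>With \<open>w = z * cnj \<zeta>\<close>, this is the identity \<open>1 / (1 - w) + 1 / (1 - cnj w) - 1 = (1 - |w|\<^sup>2) / |1 - w|\<^sup>2\<close>.\<close>

lemma poisson_kernel_sums:
  assumes "cmod z < 1" "cmod \<zeta> = 1"
  shows "(\<lambda>m. if m = 0 then 1 else z ^ m * cnj \<zeta> ^ m + cnj z ^ m * \<zeta> ^ m)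
           sums complex_of_real (poisson_kernel z \<zeta>)"
proof -
  define w where "w = z * cnj \<zeta>"
  have w: "cmod w = cmod z" using assms by (simp add: w_def norm_mult)
  have \<zeta>: "\<zeta> * cnj \<zeta> = 1" using assms complex_norm_square[of \<zeta>] by simp
  have w1: "1 - w \<noteq> 0" "1 - cnj w \<noteq> 0" using w assms(1) by auto
  have "(\<lambda>m. w ^ m + cnj w ^ m - (if m = 0 then 1 else 0)) sums (1 / (1 - w) + 1 / (1 - cnj w) - 1)"
    using w assms(1) by (intro sums_diff sums_add geometric_sums sums_single) auto
  moreover have "(\<lambda>m. w ^ m + cnj w ^ m - (if m = 0 then 1 else 0))
      = (\<lambda>m. if m = 0 then 1 else z ^ m * cnj \<zeta> ^ m + cnj z ^ m * \<zeta> ^ m)"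
    by (auto simp: fun_eq_iff w_def power_mult_distrib)
  moreover have "1 / (1 - w) + 1 / (1 - cnj w) - 1 = complex_of_real (poisson_kernel z \<zeta>)"
  proof -
    have "z - \<zeta> = - \<zeta> * (1 - w)" using \<zeta> by (simp add: w_def algebra_simps)
    hence n: "cmod (z - \<zeta>) = cmod (1 - w)" using assms(2) by (simp add: norm_mult)
    have "complex_of_real (poisson_kernel z \<zeta>) = (1 - w * cnj w) / ((1 - w) * cnj (1 - w))"
      unfolding poisson_kernel_def n w[symmetric] by (simp add: complex_norm_square del: of_real_power flip: of_real_power)
    also have "\<dots> = 1 / (1 - w) + 1 / (1 - cnj w) - 1"
      using w1 by (simp add: divide_simps) (simp add: algebra_simps)
    finally show ?thesis ..
  qed
  ultimately show ?thesis by simp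
qed

text \<open>The terms of the expansion of a harmonic function with Fourier coefficients \<open>c\<close>, where the frequencies
  \<open>m\<close> and \<open>- m\<close> are grouped together.\<close>

definition harmonic_term :: "(int \<Rightarrow> complex) \<Rightarrow> complex \<Rightarrow> nat \<Rightarrow> complex" where
  "harmonic_term c z m = (if m = 0 then c 0 else z ^ m * c (int m) + cnj z ^ m * c (- int m))"

lemma poisson_integral_of_measure_sums:
  assumes N: "finite_measure N" and sN: "sets N = sets circle_borel"
  defines "B \<equiv> measure N (space N)"
  obtains c where "\<And>m. cmod (c m) \<le> B"
    and "\<And>z. cmod z < 1 \<Longrightarrow> harmonic_term c z sums of_real (LINT \<zeta>|N. poisson_kernel z \<zeta>)"
proof -
  interpret finite_measure N by fact
  have sp: "space N = sphere 0 1" using sets_eq_imp_space_eq[OF sN] by simp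
  have meas: "f \<in> borel_measurable borel \<Longrightarrow> f \<in> borel_measurable N" for f :: "complex \<Rightarrow> complex"
    using borel_measurable_circle_borel sN by (metis measurable_cong_sets)
  define e where "e m \<zeta> = (if m \<ge> 0 then cnj \<zeta> ^ nat m else \<zeta> ^ nat (- m))" for m :: int and \<zeta> :: complex
  have e_meas: "e m \<in> borel_measurable N" for m
    unfolding e_def[abs_def] by (intro meas borel_measurable_continuous_onI, cases "m \<ge> 0") (auto intro!: continuous_intros)
  have e_norm: "cmod (e m \<zeta>) = 1" if "\<zeta> \<in> space N" for m \<zeta>
    using that sp by (simp add: e_def norm_power)
  have e_int: "integrable N (e m)" for m
    by (rule integrable_const_bound[where B=1]) (use e_meas e_norm in auto)
  define c where "c m = (LINT \<zeta>|N. e m \<zeta>)" for m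
  have "cmod (c m) \<le> B" for m
  proof -
    have "cmod (c m) \<le> (LINT \<zeta>|N. cmod (e m \<zeta>))" unfolding c_def by (rule integral_norm_bound)
    also have "\<dots> = (LINT \<zeta>|N. 1)" using e_norm by (intro Bochner_Integration.integral_cong) auto
    finally show ?thesis by (simp add: B_def)
  qed
  moreover have "harmonic_term c z sums of_real (LINT \<zeta>|N. poisson_kernel z \<zeta>)" if z: "cmod z < 1" for z
  proof -
    define F where "F m \<zeta> = harmonic_term (\<lambda>i. e i \<zeta>) z m" for m \<zeta>
    have F_int: "integrable N (F m)" for m
      unfolding F_def[abs_def] harmonic_term_def using e_int by (cases "m = 0") auto
    have F_norm: "norm (F m \<zeta>) \<le> 2 * cmod z ^ m" if "\<zeta> \<in> space N" for m \<zeta>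
    proof (cases "m = 0")
      case True thus ?thesis using e_norm[OF that] by (simp add: F_def harmonic_term_def)
    next
      case False
      have "norm (F m \<zeta>) \<le> cmod (z ^ m * e (int m) \<zeta>) + cmod (cnj z ^ m * e (- int m) \<zeta>)"
        using False by (simp add: F_def harmonic_term_def norm_triangle_ineq)
      thus ?thesis using e_norm[OF that] by (simp add: norm_mult norm_power)
    qed
    have geo: "summable (\<lambda>m. 2 * cmod z ^ m)" using z by (intro summable_mult summable_geometric) simp
    have "(\<lambda>m. LINT \<zeta>|N. F m \<zeta>) sums (LINT \<zeta>|N. (\<Sum>m. F m \<zeta>))"
    proof (rule sums_integral)
      show "AE \<zeta> in N. summable (\<lambda>m. norm (F m \<zeta>))"
        by (intro AE_I2 summable_comparison_test'[OF geo, of 0]) (use F_norm in auto)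
      show "summable (\<lambda>m. LINT \<zeta>|N. norm (F m \<zeta>))"
      proof (rule summable_comparison_test')
        show "summable (\<lambda>m. B * (2 * cmod z ^ m))" by (intro summable_mult geo)
        show "norm (LINT \<zeta>|N. norm (F m \<zeta>)) \<le> B * (2 * cmod z ^ m)" if "m \<ge> 0" for m
        proof -
          have "(LINT \<zeta>|N. norm (F m \<zeta>)) \<le> (LINT \<zeta>|N. 2 * cmod z ^ m)"
            using F_norm F_int by (intro integral_mono integrable_norm) auto
          thus ?thesis by (simp add: B_def)
        qed
      qed
    qed (rule F_int)
    moreover have "(\<lambda>m. LINT \<zeta>|N. F m \<zeta>) = harmonic_term c z"
      unfolding F_def harmonic_term_def c_def using e_int by (auto simp: fun_eq_iff)
    moreover have "(LINT \<zeta>|N. (\<Sum>m. F m \<zeta>)) = (LINT \<zeta>|N. of_real (poisson_kernel z \<zeta>))"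
    proof (rule Bochner_Integration.integral_cong[OF refl])
      fix \<zeta> assume "\<zeta> \<in> space N"
      hence "cmod \<zeta> = 1" using sp by simp
      moreover have "F m \<zeta> = (if m = 0 then 1 else z ^ m * cnj \<zeta> ^ m + cnj z ^ m * \<zeta> ^ m)" for m
        by (auto simp: F_def harmonic_term_def e_def)
      ultimately show "(\<Sum>m. F m \<zeta>) = of_real (poisson_kernel z \<zeta>)"
        using poisson_kernel_sums[OF z] by (simp add: sums_iff)
    qed
    ultimately show ?thesis by simp
  qed
  ultimately show thesis using that by blast
qed

lemma poisson_integral:
  fixes \<mu> :: "complex set \<Rightarrow> 'a::complex_hilbert_space \<Rightarrow> 'a"
  assumes \<mu>: "semi_spectral_measure \<mu>" and z: "cmod z < 1"
  shows bounded_clinear_poisson_integral: "bounded_clinear (poisson_integral \<mu> z)"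
    and poisson_integral_diagonal:
      "cinner (poisson_integral \<mu> z x) x = of_real (LINT \<zeta>|quadratic_measure \<mu> x. poisson_kernel z \<zeta>)"
proof -
  obtain K :: nat where K: "2 / (1 - cmod z) \<le> real K" using real_arch_simple by blast
  have "0 \<le> poisson_kernel z \<zeta> \<and> poisson_kernel z \<zeta> \<le> real K" if "\<zeta> \<in> space circle_borel" for \<zeta>
    using poisson_kernel_bounds[OF z, of \<zeta>] that K by auto
  then obtain T where T: "bounded_clinear T"
    "\<And>x y. cinner (T x) y = complex_measure_integral circle_borel (\<lambda>A. cinner (\<mu> A x) y)
               (\<lambda>\<zeta>. complex_of_real (poisson_kernel z \<zeta>))"
    "\<And>x. cinner (T x) x = of_real (LINT \<zeta>|quadratic_measure \<mu> x. poisson_kernel z \<zeta>)"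
    using spectral_integral_exists[OF \<mu> poisson_kernel_measurable] by metis
  have "poisson_integral \<mu> z = T"
    unfolding poisson_integral_def
  proof (rule the_equality)
    fix S assume "bounded_clinear S \<and> (\<forall>x y. cinner (S x) y =
      complex_measure_integral circle_borel (\<lambda>A. cinner (\<mu> A x) y) (\<lambda>\<zeta>. complex_of_real (poisson_kernel z \<zeta>)))"
    hence "cinner (S x) y = cinner (T x) y" for x y using T(2) by simp
    thus "S = T" using cinner_ext by blast
  qed (use T in auto)
  thus "bounded_clinear (poisson_integral \<mu> z)"
    "cinner (poisson_integral \<mu> z x) x = of_real (LINT \<zeta>|quadratic_measure \<mu> x. poisson_kernel z \<zeta>)"
    using T by auto
qed

lemma poisson_integral_sums:
  fixes \<mu> :: "complex set \<Rightarrow> 'a::complex_hilbert_space \<Rightarrow> 'a"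
  assumes \<mu>: "semi_spectral_measure \<mu>"
  obtains c B where "\<And>m. cmod (c m) \<le> B"
    and "\<And>z. cmod z < 1 \<Longrightarrow> harmonic_term c z sums cinner (poisson_integral \<mu> z x) y"
proof -
  have "\<exists>c. (\<forall>m. cmod (c m) \<le> measure (quadratic_measure \<mu> v) (space (quadratic_measure \<mu> v)))
     \<and> (\<forall>z. cmod z < 1 \<longrightarrow> harmonic_term c z sums cinner (poisson_integral \<mu> z v) v)" for v
    using poisson_integral_of_measure_sums[OF finite_quadratic_measure[OF \<mu>] sets_quadratic_measure[OF \<mu>]]
      poisson_integral_diagonal[OF \<mu>] by metis
  then obtain C where C: "\<And>v m. cmod (C v m) \<le> measure (quadratic_measure \<mu> v) (space (quadratic_measure \<mu> v))"
    "\<And>v z. cmod z < 1 \<Longrightarrow> harmonic_term (C v) z sums cinner (poisson_integral \<mu> z v) v" by metis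
  define b where "b v = measure (quadratic_measure \<mu> v) (space (quadratic_measure \<mu> v))" for v
  define c where "c m = (C (x + y) m - C (x - y) m + \<i> * (C (x + \<i> *\<^sub>C y) m - C (x - \<i> *\<^sub>C y) m)) / 4" for m
  show thesis
  proof (rule that)
    fix m
    have "cmod (C (x + y) m - C (x - y) m + \<i> * (C (x + \<i> *\<^sub>C y) m - C (x - \<i> *\<^sub>C y) m))
      \<le> cmod (C (x + y) m - C (x - y) m) + cmod (\<i> * (C (x + \<i> *\<^sub>C y) m - C (x - \<i> *\<^sub>C y) m))"
      by (rule norm_triangle_ineq)
    also have "\<dots> \<le> (b (x + y) + b (x - y)) + (b (x + \<i> *\<^sub>C y) + b (x - \<i> *\<^sub>C y))"
      using C(1) unfolding norm_mult b_def
      by (intro add_mono order_trans[OF norm_triangle_ineq4]) (auto intro!: add_mono order_trans[OF norm_triangle_ineq4])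
    finally show "cmod (c m) \<le> ((b (x + y) + b (x - y)) + (b (x + \<i> *\<^sub>C y) + b (x - \<i> *\<^sub>C y))) / 4"
      unfolding c_def by (simp add: norm_divide)
  next
    fix z :: complex assume z: "cmod z < 1"
    have "(\<lambda>m. (harmonic_term (C (x + y)) z m - harmonic_term (C (x - y)) z m
       + \<i> * (harmonic_term (C (x + \<i> *\<^sub>C y)) z m - harmonic_term (C (x - \<i> *\<^sub>C y)) z m)) / 4)
      sums cinner (poisson_integral \<mu> z x) y"
      unfolding polarization[OF bounded_clinear_poisson_integral[OF \<mu> z], of x y]
      by (intro sums_divide sums_add sums_diff sums_mult C(2)[OF z])
    moreover have "(\<lambda>m. (harmonic_term (C (x + y)) z m - harmonic_term (C (x - y)) z m
       + \<i> * (harmonic_term (C (x + \<i> *\<^sub>C y)) z m - harmonic_term (C (x - \<i> *\<^sub>C y)) z m)) / 4) = harmonic_term c z"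
      by (auto simp: fun_eq_iff harmonic_term_def c_def field_simps)
    ultimately show "harmonic_term c z sums cinner (poisson_integral \<mu> z x) y" by simp
  qed
qed

lemma poisson_integral_bounds:
  fixes \<mu> :: "complex set \<Rightarrow> 'a::complex_hilbert_space \<Rightarrow> 'a"
  assumes \<mu>: "semi_spectral_measure \<mu>"
  obtains C where "\<And>z x. cmod z < 1 \<Longrightarrow> 0 \<le> Re (cinner (poisson_integral \<mu> z x) x)
      \<and> Re (cinner (poisson_integral \<mu> z x) x) \<le> C / (1 - cmod z) * (norm x)\<^sup>2"
proof -
  obtain C where C: "C \<ge> 0" "\<And>x. measure (quadratic_measure \<mu> x) (space (quadratic_measure \<mu> x)) \<le> C * (norm x)\<^sup>2"
    using quadratic_measure_total[OF \<mu>] by blast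
  have "0 \<le> (LINT \<zeta>|quadratic_measure \<mu> x. poisson_kernel z \<zeta>)
      \<and> (LINT \<zeta>|quadratic_measure \<mu> x. poisson_kernel z \<zeta>) \<le> (2 * C) / (1 - cmod z) * (norm x)\<^sup>2"
    if z: "cmod z < 1" for z x
  proof
    interpret finite_measure "quadratic_measure \<mu> x" by (rule finite_quadratic_measure[OF \<mu>])
    have sp: "space (quadratic_measure \<mu> x) = sphere 0 1"
      using sets_eq_imp_space_eq[OF sets_quadratic_measure[OF \<mu>]] by simp
    have bnd: "0 \<le> poisson_kernel z \<zeta>" "poisson_kernel z \<zeta> \<le> 2 / (1 - cmod z)"
      if "\<zeta> \<in> space (quadratic_measure \<mu> x)" for \<zeta>
      using poisson_kernel_bounds[OF z, of \<zeta>] that sp by auto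
    have int: "integrable (quadratic_measure \<mu> x) (poisson_kernel z)"
      by (rule integrable_const_bound[where B="2 / (1 - cmod z)"])
        (use bnd poisson_kernel_measurable[of z] sets_quadratic_measure[OF \<mu>, of x] in \<open>auto cong: measurable_cong_sets\<close>)
    show "0 \<le> (LINT \<zeta>|quadratic_measure \<mu> x. poisson_kernel z \<zeta>)"
      using bnd(1) by (intro integral_nonneg_AE) auto
    have "(LINT \<zeta>|quadratic_measure \<mu> x. poisson_kernel z \<zeta>) \<le> (LINT \<zeta>|quadratic_measure \<mu> x. 2 / (1 - cmod z))"
      using int bnd(2) by (intro integral_mono) auto
    also have "\<dots> = measure (quadratic_measure \<mu> x) (space (quadratic_measure \<mu> x)) * (2 / (1 - cmod z))" by simp
    also have "\<dots> \<le> C * (norm x)\<^sup>2 * (2 / (1 - cmod z))" using C(2) z by (intro mult_right_mono) auto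
    finally show "(LINT \<zeta>|quadratic_measure \<mu> x. poisson_kernel z \<zeta>) \<le> (2 * C) / (1 - cmod z) * (norm x)\<^sup>2"
      by (simp add: mult_ac)
  qed
  thus thesis by (intro that[of "2 * C"]) (simp add: poisson_integral_diagonal[OF \<mu>])
qed

section \<open>Rotation invariance and radial moments of area measure\<close>

lemma lborel_complex_eq_distr_prod:
  "(lborel :: complex measure) = distr (lborel :: (real \<times> real) measure) borel (\<lambda>p. Complex (fst p) (snd p))"
proof (rule lborel_eqI)
  have [measurable]: "(\<lambda>p. Complex (fst p) (snd p)) \<in> borel_measurable (borel :: (real \<times> real) measure)"
    by (intro borel_measurable_continuous_onI continuous_intros)
  fix l u :: complex assume lu: "\<And>b. b \<in> Basis \<Longrightarrow> l \<bullet> b \<le> u \<bullet> b"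
  have "emeasure (distr (lborel :: (real \<times> real) measure) borel (\<lambda>p. Complex (fst p) (snd p))) (box l u)
     = emeasure (lborel :: (real \<times> real) measure) (box (Re l, Im l) (Re u, Im u))"
    by (subst emeasure_distr) (auto simp: box_def Basis_prod_def Basis_complex_def inner_complex_def
         intro!: arg_cong[where f="emeasure lborel"])
  also have "\<dots> = ennreal (\<Prod>b\<in>Basis. (u - l) \<bullet> b)"
    using lu[of 1] lu[of \<i>] by (subst emeasure_lborel_box) 
      (auto simp: Basis_prod_def Basis_complex_def inner_complex_def complex_eq_iff mult.commute)
  finally show "emeasure (distr (lborel :: (real \<times> real) measure) borel (\<lambda>p. Complex (fst p) (snd p))) (box l u) = ennreal (\<Prod>b\<in>Basis. (u - l) \<bullet> b)" .
qed simp

lemma nn_integral_complex_iterated: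
  assumes [measurable]: "f \<in> borel_measurable borel"
  shows "(\<integral>\<^sup>+z. f z \<partial>lborel) = (\<integral>\<^sup>+y. \<integral>\<^sup>+x. f (Complex x y) \<partial>lborel \<partial>lborel)"
    and "(\<integral>\<^sup>+z. f z \<partial>lborel) = (\<integral>\<^sup>+x. \<integral>\<^sup>+y. f (Complex x y) \<partial>lborel \<partial>lborel)"
proof -
  have [measurable]: "(\<lambda>p. Complex (fst p) (snd p)) \<in> borel_measurable (borel :: (real \<times> real) measure)"
    by (intro borel_measurable_continuous_onI continuous_intros)
  have *: "(\<integral>\<^sup>+z. f z \<partial>lborel) = (\<integral>\<^sup>+p. f (Complex (fst p) (snd p)) \<partial>(lborel \<Otimes>\<^sub>M lborel))"
    unfolding lborel_prod by (subst lborel_complex_eq_distr_prod) (simp add: nn_integral_distr)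
  have m: "(\<lambda>p. f (Complex (fst p) (snd p))) \<in> borel_measurable (lborel \<Otimes>\<^sub>M lborel)"
    unfolding lborel_prod by measurable
  show "(\<integral>\<^sup>+z. f z \<partial>lborel) = (\<integral>\<^sup>+x. \<integral>\<^sup>+y. f (Complex x y) \<partial>lborel \<partial>lborel)"
    unfolding * by (subst lborel.nn_integral_fst[OF m, symmetric]) simp
  show "(\<integral>\<^sup>+z. f z \<partial>lborel) = (\<integral>\<^sup>+y. \<integral>\<^sup>+x. f (Complex x y) \<partial>lborel \<partial>lborel)"
    unfolding * by (subst lborel_pair.nn_integral_snd[symmetric]) (use m in \<open>simp_all add: case_prod_beta'\<close>)
qed

text \<open>Integrating first along the direction of the shear, each inner integral is only translated.\<close>

lemma nn_integral_shear:
  assumes [measurable]: "f \<in> borel_measurable borel"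
  shows "(\<integral>\<^sup>+z. f (Complex (Re z + t * Im z) (Im z)) \<partial>lborel) = (\<integral>\<^sup>+z. f z \<partial>lborel)"
    and "(\<integral>\<^sup>+z. f (Complex (Re z) (Im z + t * Re z)) \<partial>lborel) = (\<integral>\<^sup>+z. f z \<partial>lborel)"
proof -
  have [measurable]: "(\<lambda>z. Complex (Re z + t * Im z) (Im z)) \<in> borel_measurable borel"
     "(\<lambda>z. Complex (Re z) (Im z + t * Re z)) \<in> borel_measurable borel"
     "(\<lambda>x. Complex x y) \<in> borel_measurable borel" "(\<lambda>y. Complex x y) \<in> borel_measurable borel" for x y
    by (intro borel_measurable_continuous_onI continuous_intros)+
  have tr: "(\<integral>\<^sup>+x. h (x + a) \<partial>lborel) = (\<integral>\<^sup>+x. h x \<partial>lborel)" if [measurable]: "h \<in> borel_measurable borel" 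
    for h :: "real \<Rightarrow> ennreal" and a
    by (subst (2) lborel_distr_plus[of a, symmetric]) (simp add: nn_integral_distr add.commute)
  show "(\<integral>\<^sup>+z. f (Complex (Re z + t * Im z) (Im z)) \<partial>lborel) = (\<integral>\<^sup>+z. f z \<partial>lborel)"
  proof -
    have "(\<integral>\<^sup>+x. f (Complex (x + t * y) y) \<partial>lborel) = (\<integral>\<^sup>+x. f (Complex x y) \<partial>lborel)" for y
      by (rule tr[of "\<lambda>x. f (Complex x y)"]) simp
    thus ?thesis by (subst (1 2) nn_integral_complex_iterated(1)) simp_all
  qed
  show "(\<integral>\<^sup>+z. f (Complex (Re z) (Im z + t * Re z)) \<partial>lborel) = (\<integral>\<^sup>+z. f z \<partial>lborel)"
  proof -
    have "(\<integral>\<^sup>+y. f (Complex x (y + t * x)) \<partial>lborel) = (\<integral>\<^sup>+y. f (Complex x y) \<partial>lborel)" for x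
      by (rule tr[of "\<lambda>y. f (Complex x y)"]) simp
    thus ?thesis by (subst (1 2) nn_integral_complex_iterated(2)) simp_all
  qed
qed

text \<open>A rotation that is not a half turn is a product of three shears.\<close>

lemma lborel_distr_rotation:
  assumes "cmod w = 1" "Im w \<noteq> 0"
  shows "distr lborel borel (\<lambda>z. w * z) = lborel"
proof (rule measure_eqI)
  fix A :: "complex set" assume A: "A \<in> sets (distr lborel borel (\<lambda>z. w * z))"
  hence [measurable]: "A \<in> sets borel" by simp
  \<comment> \<open>With \<open>w = cis \<theta>\<close>, these are \<open>- tan (\<theta> / 2)\<close> and \<open>sin \<theta>\<close>.\<close>
  define t s where "t = (Re w - 1) / Im w" and "s = Im w"
  define F :: "complex \<Rightarrow> ennreal" where "F = indicator A"
  have F[measurable]: "F \<in> borel_measurable borel" by (simp add: F_def)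
  define F1 where "F1 z = F (Complex (Re z + t * Im z) (Im z))" for z
  define F2 where "F2 z = F1 (Complex (Re z) (Im z + s * Re z))" for z
  have meas: "(\<lambda>z. Complex (Re z + t * Im z) (Im z)) \<in> borel_measurable borel"
     "(\<lambda>z. Complex (Re z) (Im z + s * Re z)) \<in> borel_measurable borel"
    by (intro borel_measurable_continuous_onI continuous_intros)+
  have F1: "F1 \<in> borel_measurable borel" unfolding F1_def
    by (rule measurable_compose[OF meas(1) F])
  have F2: "F2 \<in> borel_measurable borel" unfolding F2_def
    by (rule measurable_compose[OF meas(2) F1])
  have sq: "(Re w)\<^sup>2 + (Im w)\<^sup>2 = 1" using assms(1) by (simp add: cmod_def)
  have 1: "1 + t * s = Re w" using assms(2) by (simp add: t_def s_def)
  have 2: "t * (2 + t * s) = - s"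
  proof -
    have "t * (2 + t * s) * s = (Re w - 1) * (Re w + 1)"
    proof -
      have "t * s = Re w - 1" using 1 by simp
      hence "t * s * (2 + t * s) = (Re w - 1) * (Re w + 1)" by simp
      thus ?thesis by (simp add: mult_ac)
    qed
    also have "\<dots> = - s * s" using sq by (simp add: s_def algebra_simps power2_eq_square)
    finally show ?thesis using assms(2) mult_right_cancel[of s "t * (2 + t * s)" "- s"]
      by (simp add: s_def)
  qed
  have rot: "F (w * z) = F2 (Complex (Re z + t * Im z) (Im z))" for z
  proof -
    let ?x = "Re z + t * Im z"
    have y: "Im z + s * ?x = Im (w * z)" 
      using 1 by (simp add: s_def algebra_simps flip: 1)
    have "?x + t * (Im z + s * ?x) = Re z * (1 + t * s) + Im z * (t * (2 + t * s))"
      by (simp add: algebra_simps)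
    hence x: "?x + t * (Im z + s * ?x) = Re (w * z)" unfolding 1 2 by (simp add: s_def)
    show ?thesis unfolding F2_def F1_def complex.sel y using x unfolding y 
      by (metis complex.collapse)
  qed
  have "emeasure (distr lborel borel (\<lambda>z. w * z)) A = (\<integral>\<^sup>+z. F z \<partial>distr lborel borel (\<lambda>z. w * z))"
    by (simp add: F_def)
  also have "\<dots> = (\<integral>\<^sup>+z. F (w * z) \<partial>lborel)"
    by (rule nn_integral_distr) simp_all
  also have "\<dots> = (\<integral>\<^sup>+z. F z \<partial>lborel)"
    unfolding rot nn_integral_shear(1)[OF F2] unfolding F2_def nn_integral_shear(2)[OF F1]
    unfolding F1_def nn_integral_shear(1)[OF F] ..
  also have "\<dots> = emeasure lborel A" by (simp add: F_def)
  finally show "emeasure (distr lborel borel (\<lambda>z. w * z)) A = emeasure lborel A" .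
qed simp

text \<open>A rotation by \<open>w\<close> leaves the integral unchanged but multiplies the integrand by \<open>w ^ a * cnj w ^ b\<close>.
  The angle is a quarter turn divided by \<open>a - b\<close>, which makes this factor equal to \<open>\<i>\<close>; it is never a half
  turn, so the three shears of \<open>lborel_distr_rotation\<close> apply.\<close>

lemma integral_monomial_orthogonal:
  fixes v :: "real \<Rightarrow> real"
  assumes "a \<noteq> b"
  shows "(LINT z|lborel. of_real (v (cmod z)) * (z ^ a * cnj z ^ b)) = (0::complex)"
proof (cases "(\<lambda>z. of_real (v (cmod z)) * (z ^ a * cnj z ^ b) :: complex) \<in> borel_measurable borel")
  case False
  hence "\<not> integrable lborel (\<lambda>z. of_real (v (cmod z)) * (z ^ a * cnj z ^ b) :: complex)"
    by (auto dest: borel_measurable_integrable)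
  thus ?thesis by (rule not_integrable_integral_eq)
next
  case True
  define h where "h z = (of_real (v (cmod z)) * (z ^ a * cnj z ^ b) :: complex)" for z
  define d where "d = real_of_int (int a - int b)"
  have d: "d \<noteq> 0" using assms by (simp add: d_def)
  define w where "w = cis (pi / (2 * d))"
  have d1: "\<bar>d\<bar> \<ge> 1" using assms by (auto simp: d_def)
  have "sin (pi / (2 * d)) \<noteq> 0"
  proof -
    have "\<bar>pi / (2 * d)\<bar> \<le> pi / 2"
      using divide_left_mono[of 2 "2 * \<bar>d\<bar>" pi] d1 by (simp add: abs_mult)
    moreover have "0 < \<bar>pi / (2 * d)\<bar>" using d by simp
    ultimately have "sin \<bar>pi / (2 * d)\<bar> > 0" by (intro sin_gt_zero) linarith+
    moreover have "sin \<bar>x\<bar> = sin x \<or> sin \<bar>x\<bar> = - sin x" for x :: real by (simp add: abs_if)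
    ultimately show ?thesis by (metis less_irrefl neg_0_equal_iff_equal)
  qed
  hence w: "Im w \<noteq> 0" "cmod w = 1" by (auto simp: w_def)
  have wab: "w ^ a * cnj w ^ b = \<i>"
  proof -
    have "w ^ a * cnj w ^ b = cis (real a * (pi / (2 * d)) + real b * - (pi / (2 * d)))"
      by (simp add: w_def Complex.DeMoivre cis_cnj cis_mult)
    also have "real a * (pi / (2 * d)) + real b * - (pi / (2 * d)) = d * (pi / (2 * d))"
    proof -
      have "real a * q + real b * - q = d * q" for q by (simp add: d_def algebra_simps)
      thus ?thesis .
    qed
    also have "\<dots> = pi / 2" using d by simp
    finally show ?thesis by simp
  qed
  have "(LINT z|lborel. h z) = (LINT z|distr lborel borel (\<lambda>z. w * z). h z)"
    using w by (simp add: lborel_distr_rotation)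
  also have "\<dots> = (LINT z|lborel. h (w * z))"
    using True by (subst integral_distr) (auto simp flip: h_def)
  also have "\<dots> = (LINT z|lborel. (w ^ a * cnj w ^ b) * h z)"
    by (intro Bochner_Integration.integral_cong) (simp_all add: h_def norm_mult w power_mult_distrib)
  also have "\<dots> = \<i> * (LINT z|lborel. h z)" unfolding wab by simp
  finally have "(1 - \<i>) * (LINT z|lborel. h z) = 0" by (simp add: algebra_simps)
  moreover have "1 - \<i> \<noteq> 0" by (simp add: complex_eq_iff)
  ultimately show ?thesis unfolding h_def by simp
qed

text \<open>The disc of radius \<open>sqrt x\<close> has area \<open>pi * x\<close>, so the squared modulus of a uniformly distributed point of
  the disc is uniformly distributed.\<close>

lemma distr_cmod_square:
  "distr (uniform_measure lborel (ball (0::complex) 1)) borel (\<lambda>z. (cmod z)\<^sup>2)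
   = uniform_measure lborel {0..1}" (is "?D = ?V")
proof (rule measure_eqI_lessThan)
  have eb: "emeasure lborel (ball (0::complex) 1) = ennreal pi"
    by (simp add: emeasure_ball unit_ball_vol_2)
  let ?U = "uniform_measure lborel (ball (0::complex) 1)"
  have U1: "emeasure ?U UNIV = 1" by (simp add: eb ennreal_divide_self)
  have V1: "emeasure ?V UNIV = 1" by simp
  have D1: "emeasure ?D UNIV = 1" using U1 by (simp add: emeasure_distr)
  interpret V: finite_measure ?V by standard (simp add: V1)
  interpret D: finite_measure ?D by standard (simp add: D1)
  show "emeasure ?D {x<..} < \<infinity>" for x
    using D.emeasure_finite[of "{x<..}"] by (metis infinity_ennreal_def less_top)
  have le: "measure ?D {..x} = measure ?V {..x}" for x
  proof -
    have mD: "measure ?D {..x} = measure lborel (ball 0 1 \<inter> {z::complex. (cmod z)\<^sup>2 \<le> x}) / pi"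
      by (simp add: measure_distr measure_uniform_measure eb vimage_def measure_def[of _ "ball _ _"])
    have mV: "measure ?V {..x} = measure lborel ({0..1} \<inter> {..x})"
      by (simp add: measure_uniform_measure)
    consider "x < 0" | "0 \<le> x" "x < 1" | "1 \<le> x" by linarith
    thus ?thesis
    proof cases
      case 1
      have "\<not> (cmod z)\<^sup>2 \<le> x" for z
        using \<open>x < 0\<close> order_trans[OF zero_le_power2, of "cmod z" x] by (metis not_le)
      hence "ball 0 1 \<inter> {z::complex. (cmod z)\<^sup>2 \<le> x} = {}" "{0..1} \<inter> {..x} = {}"
        using \<open>x < 0\<close> by auto
      thus ?thesis unfolding mD mV by simp
    next
      case 2
      have "(cmod z)\<^sup>2 \<le> x \<longleftrightarrow> cmod z \<le> sqrt x" for z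
        using real_sqrt_le_iff[of "(cmod z)\<^sup>2" x] by simp
      hence "{z::complex. (cmod z)\<^sup>2 \<le> x} = cball 0 (sqrt x)" by (simp add: cball_def)
      moreover have "cball 0 (sqrt x) \<subseteq> ball (0::complex) 1" using 2 by (simp add: cball_subset_ball_iff)
      ultimately have "ball 0 1 \<inter> {z::complex. (cmod z)\<^sup>2 \<le> x} = cball 0 (sqrt x)" by blast
      moreover have "{0..1} \<inter> {..x} = {0..x}" using 2 by auto
      ultimately show ?thesis using 2 unfolding mD mV
        by (simp add: content_cball unit_ball_vol_2)
    next
      case 3
      have "(cmod z)\<^sup>2 \<le> x" if "cmod z < 1" for z
        using that 3 power_le_one[of "cmod z" 2] by simp
      hence "ball 0 1 \<inter> {z::complex. (cmod z)\<^sup>2 \<le> x} = ball 0 1" by auto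
      moreover have "{0..1} \<inter> {..x} = {0..1}" using 3 by auto
      ultimately show ?thesis unfolding mD mV
        by (simp add: content_ball unit_ball_vol_2)
    qed
  qed
  show "emeasure ?D {x<..} = emeasure ?V {x<..}" for x
  proof -
    have eq: "{x<..} = UNIV - {..x}" by auto
    have m1: "measure ?D UNIV = 1" "measure ?V UNIV = 1" unfolding measure_def D1 V1 by simp_all
    have "measure ?D (UNIV - {..x}) = 1 - measure ?D {..x}"
      using D.finite_measure_compl[of "{..x}"] unfolding space_distr space_borel m1 by simp
    moreover have "measure ?V (UNIV - {..x}) = 1 - measure ?V {..x}"
      using V.finite_measure_compl[of "{..x}"] unfolding space_uniform_measure space_lborel m1 by simp
    ultimately show ?thesis unfolding D.emeasure_eq_measure V.emeasure_eq_measure eq le by simp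
  qed
qed simp_all

lemma emeasure_unit_disc: "emeasure lborel (ball (0::complex) 1) = ennreal pi"
  by (simp add: emeasure_ball unit_ball_vol_2)

lemma sets_disc_area [simp, measurable_cong]: "sets disc_area = sets borel"
  by (simp add: disc_area_def)

lemma space_disc_area [simp]: "space disc_area = UNIV"
  by (simp add: disc_area_def)

lemma finite_disc_area: "finite_measure disc_area"
proof (rule finite_measureI)
  have "emeasure disc_area UNIV = 1"
    by (simp add: disc_area_def emeasure_unit_disc ennreal_divide_self)
  thus "emeasure disc_area (space disc_area) \<noteq> \<infinity>" by simp
qed

lemma integral_disc_area:
  fixes f :: "complex \<Rightarrow> complex"
  assumes "f \<in> borel_measurable borel"
  shows "(LINT z|disc_area. f z) = (LINT z|lborel. of_real (indicator (ball 0 1) z / pi) * f z)"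
proof -
  have eq: "disc_area = density lborel (\<lambda>z. ennreal (indicator (ball 0 1) z / pi))"
    unfolding disc_area_def uniform_measure_def emeasure_unit_disc
    using divide_ennreal[of 1 pi] by (intro density_cong) (auto simp: indicator_def)
  have "(LINT z|disc_area. f z) = (LINT z|lborel. (indicator (ball 0 1) z / pi) *\<^sub>R f z)"
    unfolding eq
    by (rule integral_density) (use assms in \<open>auto intro!: borel_measurable_divide borel_measurable_indicator\<close>)
  thus ?thesis by (simp add: scaleR_conv_of_real)
qed

text \<open>The variable \<open>t\<close> stands for \<open>(cmod z)\<^sup>2\<close>, which is uniformly distributed on the unit interval
  (\<open>distr_cmod_square\<close>).\<close>

definition radial_moment :: "real \<Rightarrow> nat \<Rightarrow> nat \<Rightarrow> real" where
  "radial_moment R q m = integral {0..R\<^sup>2} (\<lambda>t. t ^ m * (1 - t) ^ q)"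

definition disc_weight :: "real \<Rightarrow> nat \<Rightarrow> complex \<Rightarrow> real" where
  "disc_weight R q z = indicator (cball 0 R) z * (1 - (cmod z)\<^sup>2) ^ q"

lemma disc_weight_measurable [measurable]: "disc_weight R q \<in> borel_measurable borel"
  unfolding disc_weight_def[abs_def]
  by (intro borel_measurable_times borel_measurable_indicator borel_measurable_continuous_onI continuous_intros) auto

lemma disc_weight_bounds:
  assumes "R \<le> 1" shows "0 \<le> disc_weight R q z" "disc_weight R q z \<le> 1"
proof -
  have "(cmod z)\<^sup>2 \<le> 1" if "cmod z \<le> R" using that assms by (intro power_le_one) auto
  thus "0 \<le> disc_weight R q z" "disc_weight R q z \<le> 1"
    by (auto simp: disc_weight_def indicator_def intro!: power_le_one)
qed

lemma monomial_measurable [measurable]: "(\<lambda>z::complex. z ^ a * cnj z ^ b) \<in> borel_measurable borel"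
  by (intro borel_measurable_continuous_onI continuous_intros)

lemma disc_moment:
  assumes R: "0 \<le> R" "R < 1"
  shows "(LINT z|disc_area. of_real (disc_weight R q z) * (z ^ a * cnj z ^ b))
     = (if a = b then of_real (radial_moment R q a) else 0)"
proof (cases "a = b")
  case False
  let ?v = "\<lambda>s::real. indicator {..<1} s / pi * (indicator {..R} s * (1 - s\<^sup>2) ^ q)"
  have "(LINT z|disc_area. of_real (disc_weight R q z) * (z ^ a * cnj z ^ b))
    = (LINT z|lborel. of_real (indicator (ball 0 1) z / pi) * (of_real (disc_weight R q z) * (z ^ a * cnj z ^ b)))"
    by (rule integral_disc_area) measurable
  also have "\<dots> = (LINT z|lborel. of_real (?v (cmod z)) * (z ^ a * cnj z ^ b))"
    by (intro Bochner_Integration.integral_cong refl) (auto simp: disc_weight_def indicator_def)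
  also have "\<dots> = 0" using False by (rule integral_monomial_orthogonal)
  finally show ?thesis using False by simp
next
  case True
  define h :: "real \<Rightarrow> real" where "h t = indicator {..R\<^sup>2} t * ((1 - t) ^ q * t ^ a)" for t
  have h[measurable]: "h \<in> borel_measurable borel" unfolding h_def[abs_def] by measurable
  have le: "(cmod z)\<^sup>2 \<le> R\<^sup>2 \<longleftrightarrow> cmod z \<le> R" for z using R(1) by simp
  have "of_real (disc_weight R q z) * (z ^ a * cnj z ^ b) = complex_of_real (h ((cmod z)\<^sup>2))" for z
  proof -
    have "z ^ a * cnj z ^ b = complex_of_real (((cmod z)\<^sup>2) ^ a)"
    proof -
      have "z ^ a * cnj z ^ b = (z * cnj z) ^ a" using True by (simp add: power_mult_distrib)
      also have "\<dots> = complex_of_real ((cmod z)\<^sup>2) ^ a" by (simp only: complex_norm_square)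
      finally show ?thesis by (simp only: of_real_power)
    qed
    thus ?thesis using le[of z] by (auto simp: disc_weight_def h_def indicator_def)
  qed
  hence "(LINT z|disc_area. of_real (disc_weight R q z) * (z ^ a * cnj z ^ b))
    = of_real (LINT z|disc_area. h ((cmod z)\<^sup>2))" by simp
  also have "(LINT z|disc_area. h ((cmod z)\<^sup>2)) = (LINT t|distr disc_area borel (\<lambda>z. (cmod z)\<^sup>2). h t)"
    by (rule integral_distr[symmetric]) auto
  also have "\<dots> = (LINT t|uniform_measure lborel {0..1}. h t)"
    unfolding disc_area_def distr_cmod_square ..
  also have "uniform_measure lborel {0..1} = density lborel (\<lambda>t. ennreal (indicator {0..1::real} t))"
    unfolding uniform_measure_def by (intro density_cong) (auto simp: indicator_def)
  also have "(LINT t|density lborel (\<lambda>t. ennreal (indicator {0..1::real} t)). h t) = (LINT t|lborel. indicator {0..1} t *\<^sub>R h t)"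
    by (rule integral_density) auto
  also have "\<dots> = (LINT t:{0..R\<^sup>2}|lborel. t ^ a * (1 - t) ^ q)"
    unfolding set_lebesgue_integral_def
    using R by (intro Bochner_Integration.integral_cong refl)
      (auto simp: h_def indicator_def power_le_one dest: order_trans[of _ "R\<^sup>2" 1])
  also have "\<dots> = radial_moment R q a"
    unfolding radial_moment_def
    by (rule set_borel_integral_eq_integral(2)) (intro borel_integrable_atLeastAtMost' continuous_intros)
  finally show ?thesis using True by simp
qed

lemma radial_moment_nonneg: 
  assumes "0 \<le> R" "R < 1" shows "radial_moment R q m \<ge> 0"
  unfolding radial_moment_def using assms power_le_one[of R 2]
  by (intro integral_nonneg integrable_continuous_interval continuous_intros) (auto intro!: mult_nonneg_nonneg zero_le_power)

text \<open>This is the fundamental theorem of calculus for \<open>t ^ Suc m * (1 - t) ^ Suc q\<close>, whose boundary value at \<open>R\<^sup>2\<close> is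
  the extra term on the left; it also shows that moments are positive. With \<open>n = Suc q\<close>, it makes
  \<open>(m + n)\<close> times the \<open>m\<close>-th moment decreasing.\<close>

lemma radial_moment_step:
  assumes R: "0 \<le> R" "R < 1"
  shows "real (Suc (m + Suc q)) * radial_moment R q (Suc m) + R ^ (2 * Suc m) * (1 - R\<^sup>2) ^ Suc q
     \<le> real (m + Suc q) * radial_moment R q m"
proof -
  let ?x = "R\<^sup>2"
  have int: "(\<lambda>t::real. t ^ m * (1 - t) ^ q) integrable_on {0..?x}" for m
    by (intro integrable_continuous_interval continuous_intros)
  \<comment> \<open>The derivative of \<open>?F\<close> is the integrand of \<open>Suc m * \<kappa>(m) - (m + q + 2) * \<kappa>(m + 1)\<close>, where \<open>\<kappa>\<close> is the moment.\<close>
  let ?F = "\<lambda>t::real. t ^ Suc m * (1 - t) ^ Suc q"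
  let ?F' = "\<lambda>t::real. real (Suc m) * (t ^ m * (1 - t) ^ q) - real (m + Suc (Suc q)) * (t ^ Suc m * (1 - t) ^ q)"
  have "(?F has_vector_derivative ?F' t) (at t within {0..?x})" for t
  proof -
    have "(?F has_real_derivative (real (Suc m) * t ^ m * (1 - t) ^ Suc q - t ^ Suc m * (real (Suc q) * (1 - t) ^ q))) (at t within {0..?x})"
      by (auto intro!: derivative_eq_intros simp del: power_Suc of_nat_Suc)
    moreover have "real (Suc m) * t ^ m * (1 - t) ^ Suc q - t ^ Suc m * (real (Suc q) * (1 - t) ^ q) = ?F' t"
      by (simp add: algebra_simps)
    ultimately show ?thesis by (simp only: has_real_derivative_iff_has_vector_derivative)
  qed
  hence "(?F' has_integral (?F ?x - ?F 0)) {0..?x}"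
    by (intro fundamental_theorem_of_calculus) auto
  moreover have "(?F' has_integral (real (Suc m) * radial_moment R q m - real (m + Suc (Suc q)) * radial_moment R q (Suc m))) {0..?x}"
    unfolding radial_moment_def
    by (intro has_integral_diff has_integral_mult_right integrable_integral int)
  ultimately have "real (Suc m) * radial_moment R q m - real (m + Suc (Suc q)) * radial_moment R q (Suc m) = ?F ?x - ?F 0"
    by (rule has_integral_unique[rotated])
  moreover have "?F ?x - ?F 0 = R ^ (2 * Suc m) * (1 - R\<^sup>2) ^ Suc q" by (simp only: power_mult power_0_Suc mult_zero_left diff_zero)
  moreover have "real (m + Suc q) * radial_moment R q m - real (Suc m) * radial_moment R q m = real q * radial_moment R q m"
    by (simp add: algebra_simps)
  moreover have "real q * radial_moment R q m \<ge> 0" using radial_moment_nonneg[OF R] by simp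
  ultimately show ?thesis by (simp only: add_Suc_right)
qed

lemma radial_moment_pos:
  assumes R: "0 < R" "R < 1" shows "radial_moment R q m > 0"
proof -
  have "R\<^sup>2 < 1" using R by (simp add: power_less_one_iff)
  hence "0 < R ^ (2 * Suc m) * (1 - R\<^sup>2) ^ Suc q" using R by (intro mult_pos_pos zero_less_power) auto
  also have "\<dots> \<le> real (m + Suc q) * radial_moment R q m"
    using radial_moment_step[of R m q] radial_moment_nonneg[of R q "Suc m"] R
    by (smt (verit) mult_nonneg_nonneg of_nat_0_le_iff)
  finally show ?thesis by (simp add: zero_less_mult_iff)
qed

lemma radial_moment_unweighted: 
  assumes "0 \<le> R" shows "radial_moment R 0 m = (R\<^sup>2) ^ Suc m / real (Suc m)"
proof -
  have "((\<lambda>t. t ^ Suc m / real (Suc m)) has_vector_derivative t ^ m) (at t within {0..R\<^sup>2})" for t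
    unfolding has_real_derivative_iff_has_vector_derivative[symmetric]
    by (auto intro!: derivative_eq_intros simp del: of_nat_Suc power_Suc)
  hence "((\<lambda>t. t ^ m) has_integral ((R\<^sup>2) ^ Suc m / real (Suc m) - 0 ^ Suc m / real (Suc m))) {0..R\<^sup>2}"
    by (intro fundamental_theorem_of_calculus) auto
  thus ?thesis by (simp add: radial_moment_def integral_unique)
qed

section \<open>Nonnegative min-max kernels\<close>

text \<open>Since \<open>v (min j k) * v (max j k) = v j * v k\<close>, the kernel is \<open>v j * v k\<close> times the value of \<open>u / v\<close> at \<open>min j k\<close>. That value is
  the sum of the increments \<open>d m\<close> of \<open>u / v\<close> over \<open>m \<le> j\<close> and \<open>m \<le> k\<close>, so the sum is a combination with
  coefficients \<open>d m \<ge> 0\<close> of the form \<open>\<alpha>\<close> at the tails \<open>P m\<close> of \<open>v\<close>.\<close>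

lemma min_max_kernel_nonneg:
  fixes \<alpha> :: "nat \<Rightarrow> nat \<Rightarrow> real" and u v :: "nat \<Rightarrow> real"
  assumes pos: "\<And>p :: nat \<Rightarrow> real. (\<Sum>j<N. \<Sum>k<N. p j * p k * \<alpha> j k) \<ge> 0"
    and v: "\<And>m. v m > 0" and u0: "u 0 \<ge> 0"
    and mono: "\<And>m. u m * v (Suc m) \<le> u (Suc m) * v m"
  shows "(\<Sum>j<N. \<Sum>k<N. u (min j k) * v (max j k) * \<alpha> j k) \<ge> 0"
proof -
  define d where "d m = (case m of 0 \<Rightarrow> u 0 / v 0 | Suc l \<Rightarrow> u m / v m - u l / v l)" for m
  define P where "P m j = (if m \<le> j then v j else 0)" for m j :: nat
  have d_nonneg: "d m \<ge> 0" for m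
    using v u0 mono by (cases m) (auto simp: d_def field_simps)
  have d_sum: "(\<Sum>m\<le>l. d m) = u l / v l" for l
    by (induction l) (auto simp: d_def)
  have *: "u (min j k) * v (max j k) = (\<Sum>m<N. d m * (P m j * P m k))" if "j < N" "k < N" for j k
  proof -
    have "(\<Sum>m<N. d m * (P m j * P m k)) = (\<Sum>m\<le>min j k. d m * (v j * v k))"
      using that by (intro sum.mono_neutral_cong_right) (auto simp: P_def)
    also have "\<dots> = u (min j k) / v (min j k) * (v j * v k)"
      by (simp add: d_sum flip: sum_distrib_right)
    also have "v j * v k = v (min j k) * v (max j k)" by (simp add: min_def max_def)
    finally show ?thesis using v[of "min j k"] by simp
  qed
  have "(\<Sum>j<N. \<Sum>k<N. u (min j k) * v (max j k) * \<alpha> j k)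
     = (\<Sum>j<N. \<Sum>k<N. \<Sum>m<N. d m * (P m j * P m k * \<alpha> j k))"
    by (intro sum.cong refl) (simp add: * sum_distrib_left sum_distrib_right mult_ac)
  also have "\<dots> = (\<Sum>j<N. \<Sum>m<N. \<Sum>k<N. d m * (P m j * P m k * \<alpha> j k))"
    by (intro sum.cong refl sum.swap)
  also have "\<dots> = (\<Sum>m<N. \<Sum>j<N. \<Sum>k<N. d m * (P m j * P m k * \<alpha> j k))"
    by (rule sum.swap)
  also have "\<dots> = (\<Sum>m<N. d m * (\<Sum>j<N. \<Sum>k<N. P m j * P m k * \<alpha> j k))"
    by (simp add: sum_distrib_left)
  also have "\<dots> \<ge> 0" by (intro sum_nonneg mult_nonneg_nonneg d_nonneg pos)
  finally show ?thesis .
qed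

text \<open>The terms \<open>r ^ (p - i)\<close> and \<open>r ^ (p + i)\<close> have geometric mean \<open>r ^ p\<close>.\<close>

lemma power_mean_le_geometric_sum:
  fixes r :: real assumes "0 \<le> r"
  shows "real (2 * p + 1) * r ^ p \<le> (\<Sum>i\<le>2 * p. r ^ i)"
proof (induction p)
  case (Suc p)
  have "0 \<le> (1 - r ^ Suc p)\<^sup>2" by simp
  hence amgm: "2 * r ^ Suc p \<le> 1 + r ^ (2 * Suc p)"
    unfolding power2_diff power_mult[symmetric] power_one by (simp only: mult.commute[of "Suc p" 2])
  have "(\<Sum>i\<le>2 * Suc p. r ^ i) = 1 + r * (\<Sum>i\<le>2 * p. r ^ i) + r ^ (2 * Suc p)"
  proof -
    have "(\<Sum>i\<le>Suc (2 * p). r ^ i) = r ^ 0 + (\<Sum>i\<le>2 * p. r ^ Suc i)" by (rule sum.atMost_Suc_shift)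
    thus ?thesis by (simp add: sum_distrib_left)
  qed
  moreover have "r * (real (2 * p + 1) * r ^ p) \<le> r * (\<Sum>i\<le>2 * p. r ^ i)"
    using Suc assms by (rule mult_left_mono)
  ultimately show ?case using amgm by (simp add: algebra_simps)
qed simp

text \<open>In other words, \<open>p * (1 + r ^ p) / (1 - r ^ p)\<close> increases with \<open>p\<close>. After multiplying out, this is the comparison of
  \<open>r ^ p\<close> with the mean of \<open>1, r, ..., r ^ (2 * p)\<close>.\<close>

lemma power_ratio_mono:
  fixes r :: real assumes "0 \<le> r" "r \<le> 1"
  shows "real p * ((1 + r ^ p) * (1 - r ^ Suc p)) \<le> real (Suc p) * ((1 + r ^ Suc p) * (1 - r ^ p))"
proof -
  have "(1 - r) * (real (2 * p + 1) * r ^ p) \<le> (1 - r) * (\<Sum>i\<le>2 * p. r ^ i)"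
    using assms by (intro mult_left_mono power_mean_le_geometric_sum) auto
  also have "\<dots> = 1 - r ^ Suc (2 * p)" by (rule sum_gp_basic)
  finally show ?thesis by (simp add: algebra_simps power_mult power2_eq_square)
qed

text \<open>With \<open>s m = r ^ (m + n)\<close>, the difference of the two sides has the kernel \<open>\<kappa> (max j k) * (1 - s j * s k)\<close>, which is
  half the sum of the kernels in the steps \<open>A\<close> and \<open>B\<close> of the proof. For \<open>A\<close> the monotonicity required by
  \<open>min_max_kernel_nonneg\<close> comes from the decrease of \<open>\<kappa>\<close>, for \<open>B\<close> it comes from the decrease
  of \<open>(m + n) * \<kappa> m\<close> together with \<open>power_ratio_mono\<close>.\<close>

lemma dilation_kernel_le:
  fixes \<alpha> :: "nat \<Rightarrow> nat \<Rightarrow> real" and \<kappa> :: "nat \<Rightarrow> real"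
  assumes pos: "\<And>p :: nat \<Rightarrow> real. (\<Sum>j<N. \<Sum>k<N. p j * p k * \<alpha> j k) \<ge> 0"
    and \<kappa>: "\<And>m. \<kappa> m > 0" "\<And>m. real (Suc (m + n)) * \<kappa> (Suc m) \<le> real (m + n) * \<kappa> m"
    and n: "n > 0" and r: "0 < r" "r < 1"
  shows "(\<Sum>j<N. \<Sum>k<N. r ^ (j + n) * r ^ (k + n) * \<kappa> (max j k) * \<alpha> j k)
       \<le> (\<Sum>j<N. \<Sum>k<N. \<kappa> (max j k) * \<alpha> j k)"
proof -
  define s where "s m = r ^ (m + n)" for m
  have s: "0 < s m" "s m < 1" "s (Suc m) \<le> s m" for m
    using r n by (simp_all add: s_def power_less_one_iff mult_le_cancel_right1 power_Suc_less_one less_imp_le)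
  have \<kappa>_dec: "\<kappa> (Suc m) \<le> \<kappa> m" for m
  proof -
    have "real (m + n) * \<kappa> (Suc m) \<le> real (Suc (m + n)) * \<kappa> (Suc m)"
      using \<kappa>(1)[of "Suc m"] by (intro mult_right_mono) auto
    also note \<kappa>(2)[of m]
    finally show ?thesis using n by simp
  qed
  have A: "(\<Sum>j<N. \<Sum>k<N. (1 - s (min j k)) * (\<kappa> (max j k) * (1 + s (max j k))) * \<alpha> j k) \<ge> 0"
  proof (rule min_max_kernel_nonneg[OF pos])
    show "(1 - s m) * (\<kappa> (Suc m) * (1 + s (Suc m))) \<le> (1 - s (Suc m)) * (\<kappa> m * (1 + s m))" for m
      using s[of m] s[of "Suc m"] \<kappa>(1)[of m] \<kappa>(1)[of "Suc m"] \<kappa>_dec[of m]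
      by (intro mult_mono) auto
  qed (use s \<kappa>(1) in \<open>auto intro!: mult_pos_pos add_pos_pos simp: less_imp_le\<close>)
  have B: "(\<Sum>j<N. \<Sum>k<N. (1 + s (min j k)) * (\<kappa> (max j k) * (1 - s (max j k))) * \<alpha> j k) \<ge> 0"
  proof (rule min_max_kernel_nonneg[OF pos])
    show "(1 + s m) * (\<kappa> (Suc m) * (1 - s (Suc m))) \<le> (1 + s (Suc m)) * (\<kappa> m * (1 - s m))" for m
    proof -
      let ?p = "real (m + n)" let ?q = "real (Suc (m + n))"
      have "?q * ((1 + s m) * (\<kappa> (Suc m) * (1 - s (Suc m)))) = (?q * \<kappa> (Suc m)) * ((1 + s m) * (1 - s (Suc m)))"
        by (simp add: mult_ac)
      also have "\<dots> \<le> (?p * \<kappa> m) * ((1 + s m) * (1 - s (Suc m)))"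
        using s[of m] s[of "Suc m"] by (intro mult_right_mono \<kappa>(2)) auto
      also have "\<dots> = \<kappa> m * (?p * ((1 + s m) * (1 - s (Suc m))))" by (simp add: mult_ac)
      also have "\<dots> \<le> \<kappa> m * (?q * ((1 + s (Suc m)) * (1 - s m)))"
        using power_ratio_mono[of r "m + n"] \<kappa>(1)[of m] r by (intro mult_left_mono) (simp_all add: s_def)
      also have "\<dots> = ?q * ((1 + s (Suc m)) * (\<kappa> m * (1 - s m)))" by (simp add: mult_ac)
      finally show ?thesis by (rule mult_left_le_imp_le) simp
    qed
  qed (use s \<kappa>(1) in \<open>auto intro!: mult_pos_pos add_nonneg_nonneg simp: less_imp_le\<close>)
  have "(\<Sum>j<N. \<Sum>k<N. \<kappa> (max j k) * \<alpha> j k) - (\<Sum>j<N. \<Sum>k<N. s j * s k * \<kappa> (max j k) * \<alpha> j k)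
    = (\<Sum>j<N. \<Sum>k<N. ((1 - s (min j k)) * (\<kappa> (max j k) * (1 + s (max j k))) * \<alpha> j k
        + (1 + s (min j k)) * (\<kappa> (max j k) * (1 - s (max j k))) * \<alpha> j k) / 2)"
    unfolding sum_subtractf[symmetric]
    by (intro sum.cong refl) (simp add: min_def max_def field_simps)
  also have "\<dots> = ((\<Sum>j<N. \<Sum>k<N. (1 - s (min j k)) * (\<kappa> (max j k) * (1 + s (max j k))) * \<alpha> j k)
     + (\<Sum>j<N. \<Sum>k<N. (1 + s (min j k)) * (\<kappa> (max j k) * (1 - s (max j k))) * \<alpha> j k)) / 2"
    by (simp only: sum_divide_distrib[symmetric] sum.distrib)
  also have "\<dots> \<ge> 0" using A B by simp
  finally show ?thesis by (simp add: s_def)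
qed

section \<open>Energies with respect to a positive harmonic operator function\<close>

text \<open>Functions that are only known to be measurable on smaller discs are measurable on the unit disc, and
  their integrals are limits along radii \<open>\<rho> k\<close> increasing to 1.\<close>

lemma nn_integral_disc_exhaustion:
  fixes F :: "complex \<Rightarrow> ennreal"
  assumes "\<And>R. 0 < R \<Longrightarrow> R < 1 \<Longrightarrow> (\<lambda>z. F z * indicator (cball 0 R) z) \<in> borel_measurable disc_area"
  defines "\<rho> \<equiv> \<lambda>k. 1 - 1 / real (k + 2)"
  shows "(\<lambda>z. F z * indicator (ball 0 1) z) \<in> borel_measurable disc_area"
    and "(\<integral>\<^sup>+z\<in>ball 0 1. F z \<partial>disc_area) = (SUP k. \<integral>\<^sup>+z\<in>cball 0 (\<rho> k). F z \<partial>disc_area)"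
proof -
  have \<rho>: "0 < \<rho> k" "\<rho> k < 1" for k by (simp_all add: \<rho>_def)
  have \<rho>_mono: "\<rho> i \<le> \<rho> k" if "i \<le> k" for i k
    using that unfolding \<rho>_def by (intro diff_left_mono frac_le) auto
  have meas: "(\<lambda>z. F z * indicator (cball 0 (\<rho> k)) z) \<in> borel_measurable disc_area" for k
    by (rule assms(1)[OF \<rho>])
  have sup: "F z * indicator (ball 0 1) z = (SUP k. F z * indicator (cball 0 (\<rho> k)) z)" for z
  proof (cases "cmod z < 1")
    case True
    obtain k :: nat where "1 / (1 - cmod z) < real k" using reals_Archimedean2 by blast
    hence "1 / (1 - cmod z) < real (k + 2)" by simp
    hence "1 / real (k + 2) < 1 - cmod z" using True by (simp add: field_simps)
    hence k: "z \<in> cball 0 (\<rho> k)" by (simp add: \<rho>_def)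
    show ?thesis
    proof (rule antisym)
      show "F z * indicator (ball 0 1) z \<le> (SUP k. F z * indicator (cball 0 (\<rho> k)) z)"
        by (rule SUP_upper2[of k]) (use k True in auto)
      show "(SUP k. F z * indicator (cball 0 (\<rho> k)) z) \<le> F z * indicator (ball 0 1) z"
        using True by (intro SUP_least) (auto simp: indicator_def)
    qed
  next
    case False
    hence "z \<notin> cball 0 (\<rho> k)" for k using \<rho>(2)[of k] by simp
    thus ?thesis using False by (simp add: indicator_def)
  qed
  show "(\<lambda>z. F z * indicator (ball 0 1) z) \<in> borel_measurable disc_area"
    unfolding sup using meas by (intro borel_measurable_SUP) auto
  have "incseq (\<lambda>k z. F z * indicator (cball 0 (\<rho> k)) z)"
    using order_trans[OF _ \<rho>_mono] by (intro incseq_SucI le_funI) (auto simp: indicator_def intro: \<rho>_mono)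
  thus "(\<integral>\<^sup>+z\<in>ball 0 1. F z \<partial>disc_area) = (SUP k. \<integral>\<^sup>+z\<in>cball 0 (\<rho> k). F z \<partial>disc_area)"
    unfolding sup using meas by (rule nn_integral_monotone_convergence_SUP)
qed

lemma bounded_clinear_sum:
  "bounded_clinear T \<Longrightarrow> T (\<Sum>i\<in>I. x i) = (\<Sum>i\<in>I. T (x i))"
  unfolding bounded_clinear_def by (auto intro: linear_sum bounded_linear.linear)

text \<open>These are the properties of the Poisson integral of a semi-spectral measure on which the energy
  estimates rest. The bounds \<open>B\<close> on the Fourier coefficients may depend on the two vectors, because
  only finitely many pairs of vectors occur at a time.\<close>

locale positive_harmonic_operator =
  fixes P :: "complex \<Rightarrow> 'a::complex_hilbert_space \<Rightarrow> 'a" and C :: real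
  assumes lin: "\<And>z. cmod z < 1 \<Longrightarrow> bounded_clinear (P z)"
    and nonneg: "\<And>z x. cmod z < 1 \<Longrightarrow> 0 \<le> Re (cinner (P z x) x)"
    and bound: "\<And>z x. cmod z < 1 \<Longrightarrow> Re (cinner (P z x) x) \<le> C / (1 - cmod z) * (norm x)\<^sup>2"
    and expansion: "\<And>x y. \<exists>c B. (\<forall>m. cmod (c m) \<le> B) \<and>
        (\<forall>z. cmod z < 1 \<longrightarrow> harmonic_term c z sums cinner (P z x) y)"
begin

definition q :: "complex \<Rightarrow> 'a \<Rightarrow> real" where "q z x = Re (cinner (P z x) x)"

text \<open>Integrating the Fourier expansion term by term, only the frequency \<open>\<bar>k - j\<bar>\<close> survives, by
  \<open>disc_moment\<close>.\<close>

lemma integral_sesquilinear_monomial: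
  fixes l j k :: nat and x y :: 'a
  assumes c: "\<And>m. cmod (c m) \<le> B" "\<And>z. cmod z < 1 \<Longrightarrow> harmonic_term c z sums cinner (P z x) y"
    and R: "0 \<le> R" "R < 1"
  defines "f \<equiv> \<lambda>z. of_real (disc_weight R l z) * (z ^ j * cnj z ^ k * cinner (P z x) y)"
  shows "integrable disc_area f"
    and "(LINT z|disc_area. f z) = of_real (radial_moment R l (max j k)) * c (int k - int j)"
proof -
  interpret finite_measure disc_area by (rule finite_disc_area)
  define F where "F m z = of_real (disc_weight R l z) * (z ^ j * cnj z ^ k * harmonic_term c z m)" for m z
  have B: "B \<ge> 0" using c(1)[of 0] norm_ge_zero order_trans by blast
  have F_meas: "F m \<in> borel_measurable borel" for m
  proof -
    have "(\<lambda>z. z ^ j * cnj z ^ k * harmonic_term c z m) \<in> borel_measurable borel"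
      unfolding harmonic_term_def
      by (intro borel_measurable_continuous_onI, cases "m = 0") (auto intro!: continuous_intros)
    thus ?thesis unfolding F_def[abs_def] by measurable
  qed
  have F_norm: "norm (F m z) \<le> 2 * B * R ^ m" for m z
  proof (cases "cmod z \<le> R")
    case True
    have z1: "cmod z \<le> 1" using True R by simp
    have "cmod (harmonic_term c z m) \<le> 2 * B * R ^ m"
    proof (cases "m = 0")
      case True thus ?thesis using c(1)[of 0] B by (simp add: harmonic_term_def)
    next
      case False
      have "cmod (harmonic_term c z m) \<le> cmod (z ^ m * c (int m)) + cmod (cnj z ^ m * c (- int m))"
        using False by (simp add: harmonic_term_def norm_triangle_ineq)
      also have "\<dots> \<le> R ^ m * B + R ^ m * B"
        unfolding norm_mult norm_power complex_mod_cnj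
        using \<open>cmod z \<le> R\<close> c(1) R by (intro add_mono mult_mono power_mono) auto
      finally show ?thesis by simp
    qed
    moreover have "cmod (z ^ j * cnj z ^ k) \<le> 1"
      using z1 by (simp add: norm_mult norm_power mult_le_one power_le_one)
    ultimately have "cmod (z ^ j * cnj z ^ k * harmonic_term c z m) \<le> 1 * (2 * B * R ^ m)"
      unfolding norm_mult[of "z ^ j * cnj z ^ k"] by (intro mult_mono) auto
    moreover have "norm (F m z) \<le> 1 * cmod (z ^ j * cnj z ^ k * harmonic_term c z m)"
      unfolding F_def norm_mult[of "of_real _"] norm_of_real
      using disc_weight_bounds[of R l z] R by (intro mult_right_mono) auto
    ultimately show ?thesis by simp
  next
    case False thus ?thesis using B R by (simp add: F_def disc_weight_def)
  qed
  have F_int: "integrable disc_area (F m)" for m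
    by (rule integrable_const_bound[where B="2 * B * R ^ m"]) (use F_norm F_meas in auto)
  have geo: "summable (\<lambda>m. K * R ^ m)" for K using R by (intro summable_mult summable_geometric) simp
  have hyp: "AE z in disc_area. summable (\<lambda>m. norm (F m z))"
    by (intro AE_I2 summable_comparison_test'[OF geo[of "2 * B"], of 0]) (use F_norm in auto)
  have hyp2: "summable (\<lambda>m. LINT z|disc_area. norm (F m z))"
  proof (rule summable_comparison_test')
    show "summable (\<lambda>m. measure disc_area UNIV * (2 * B) * R ^ m)" by (rule geo)
    show "norm (LINT z|disc_area. norm (F m z)) \<le> measure disc_area UNIV * (2 * B) * R ^ m" if "m \<ge> 0" for m
    proof -
      have "(LINT z|disc_area. norm (F m z)) \<le> (LINT z|disc_area. 2 * B * R ^ m)"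
        using F_norm F_int by (intro integral_mono integrable_norm) auto
      thus ?thesis by simp
    qed
  qed
  have Ff: "(\<Sum>m. F m z) = f z" for z
  proof (cases "cmod z \<le> R")
    case True
    hence "harmonic_term c z sums cinner (P z x) y" using R by (intro c(2)) auto
    hence "F_sum sums f z" if "F_sum = (\<lambda>m. F m z)" for F_sum
      unfolding that F_def f_def by (intro sums_mult)
    thus ?thesis by (simp add: sums_iff)
  qed (simp add: F_def f_def disc_weight_def)
  show "integrable disc_area f"
    using integrable_suminf[OF F_int hyp hyp2] by (simp add: Ff)
  have "(\<lambda>m. LINT z|disc_area. F m z) sums (LINT z|disc_area. f z)"
    using sums_integral[OF F_int hyp hyp2] by (simp add: Ff)
  moreover have "(LINT z|disc_area. F m z)
     = (if m = nat \<bar>int k - int j\<bar> then of_real (radial_moment R l (max j k)) * c (int k - int j) else 0)" for m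
  proof -
    have mono_int: "integrable disc_area (\<lambda>z. of_real (disc_weight R l z) * (z ^ a * cnj z ^ b))" for a b
    proof (rule integrable_const_bound[where B=1])
      show "AE z in disc_area. norm (of_real (disc_weight R l z) * (z ^ a * cnj z ^ b)) \<le> 1"
      proof (intro AE_I2)
        fix z
        show "norm (of_real (disc_weight R l z) * (z ^ a * cnj z ^ b)) \<le> 1"
        proof (cases "cmod z \<le> R")
          case True
          hence "cmod z \<le> 1" using R by simp
          hence "cmod (z ^ a * cnj z ^ b) \<le> 1" by (simp add: norm_mult norm_power mult_le_one power_le_one)
          thus ?thesis using disc_weight_bounds[of R l z] R by (simp add: norm_mult[of "of_real _"] mult_le_one)
        qed (simp add: disc_weight_def)
      qed
    qed measurable
    show ?thesis
    proof (cases "m = 0")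
      case True
      have "(LINT z|disc_area. F m z) = (LINT z|disc_area. c 0 * (of_real (disc_weight R l z) * (z ^ j * cnj z ^ k)))"
        using True by (intro Bochner_Integration.integral_cong) (auto simp: F_def harmonic_term_def)
      thus ?thesis using True by (auto simp: disc_moment[OF R])
    next
      case False
      have "(LINT z|disc_area. F m z) = (LINT z|disc_area. c (int m) * (of_real (disc_weight R l z) * (z ^ (j + m) * cnj z ^ k))
          + c (- int m) * (of_real (disc_weight R l z) * (z ^ j * cnj z ^ (k + m))))"
        using False by (intro Bochner_Integration.integral_cong) (auto simp: F_def harmonic_term_def power_add algebra_simps)
      also have "\<dots> = c (int m) * (if j + m = k then of_real (radial_moment R l (j + m)) else 0)
          + c (- int m) * (if j = k + m then of_real (radial_moment R l j) else 0)"
        using mono_int by (subst Bochner_Integration.integral_add) (auto simp: disc_moment[OF R] simp del: power_add)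
      finally show ?thesis using False by (auto simp: max_def split: if_splits)
    qed
  qed
  ultimately have "(\<lambda>m. if m = nat \<bar>int k - int j\<bar> then of_real (radial_moment R l (max j k)) * c (int k - int j) else 0)
      sums (LINT z|disc_area. f z)" by simp
  moreover have "(\<lambda>m. if m = nat \<bar>int k - int j\<bar> then of_real (radial_moment R l (max j k)) * c (int k - int j) else 0)
      sums (of_real (radial_moment R l (max j k)) * c (int k - int j))" by (rule sums_single)
  ultimately show "(LINT z|disc_area. f z) = of_real (radial_moment R l (max j k)) * c (int k - int j)"
    by (rule sums_unique2)
qed

text \<open>The real parts of the Fourier coefficients at \<open>k - j\<close> are the numbers \<open>\<alpha> j k\<close>. It is essential that they depend neither on the
  radius, nor on the weight, nor on the factors \<open>p\<close>: dilation changes \<open>p\<close>, and positivity of \<open>\<alpha>\<close>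
  is proved with a different weight and all radii.\<close>

lemma polynomial_energy:
  fixes b :: "nat \<Rightarrow> 'a" and N :: nat
  shows "\<exists>\<alpha> :: nat \<Rightarrow> nat \<Rightarrow> real. \<forall>R l p. 0 \<le> R \<longrightarrow> R < 1 \<longrightarrow>
        integrable disc_area (\<lambda>z. disc_weight R l z * q z (\<Sum>j<N. z ^ j *\<^sub>C (p j *\<^sub>R b j))) \<and>
        (LINT z|disc_area. disc_weight R l z * q z (\<Sum>j<N. z ^ j *\<^sub>C (p j *\<^sub>R b j)))
        = (\<Sum>j<N. \<Sum>k<N. p j * p k * (radial_moment R l (max j k) * \<alpha> j k))"
proof -
  have "\<forall>x y. \<exists>c. \<exists>B. (\<forall>m. cmod (c m) \<le> B) \<and>
        (\<forall>z. cmod z < 1 \<longrightarrow> harmonic_term c z sums cinner (P z x) y)" using expansion by blast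
  then obtain c where c: "\<And>x y. \<exists>B. (\<forall>m. cmod (c x y m) \<le> B) \<and>
        (\<forall>z. cmod z < 1 \<longrightarrow> harmonic_term (c x y) z sums cinner (P z x) y)" by metis
  define f where "f R l j k z = complex_of_real (disc_weight R l z) * (z ^ j * cnj z ^ k * cinner (P z (b j)) (b k))"
    for R l j k z
  have f: "integrable disc_area (f R l j k)"
    "(LINT z|disc_area. f R l j k z) = of_real (radial_moment R l (max j k)) * c (b j) (b k) (int k - int j)"
    if R: "0 \<le> R" "R < 1" for R l j k
  proof -
    obtain B where "\<And>m. cmod (c (b j) (b k) m) \<le> B"
      "\<And>z. cmod z < 1 \<Longrightarrow> harmonic_term (c (b j) (b k)) z sums cinner (P z (b j)) (b k)"
      using c[of "b j" "b k"] by blast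
    from integral_sesquilinear_monomial[OF this R] show "integrable disc_area (f R l j k)"
      "(LINT z|disc_area. f R l j k z) = of_real (radial_moment R l (max j k)) * c (b j) (b k) (int k - int j)"
      unfolding f_def[abs_def] by blast+
  qed
  define G where "G R l p z = (\<Sum>j<N. \<Sum>k<N. of_real (p j * p k) * f R l j k z)" for R l p z
  have G: "disc_weight R l z * q z (\<Sum>j<N. z ^ j *\<^sub>C (p j *\<^sub>R b j)) = Re (G R l p z)"
    if R: "0 \<le> R" "R < 1" for R l p z
  proof (cases "cmod z \<le> R")
    case True
    hence z: "cmod z < 1" using R by simp
    have "cinner (P z (\<Sum>j<N. z ^ j *\<^sub>C (p j *\<^sub>R b j))) (\<Sum>k<N. z ^ k *\<^sub>C (p k *\<^sub>R b k))
      = (\<Sum>j<N. \<Sum>k<N. of_real (p j * p k) * (z ^ j * cnj z ^ k * cinner (P z (b j)) (b k)))"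
      unfolding bounded_clinear_sum[OF lin[OF z]] scaleR_scaleC bounded_clinear_scaleC[OF lin[OF z]]

      by (subst cinner_sum_left, intro sum.cong refl, subst cinner_sum_right, intro sum.cong refl)
        (simp add: cinner_scaleC_left cinner_scaleC_right mult_ac)
    hence "of_real (disc_weight R l z) * cinner (P z (\<Sum>j<N. z ^ j *\<^sub>C (p j *\<^sub>R b j))) (\<Sum>k<N. z ^ k *\<^sub>C (p k *\<^sub>R b k))
      = G R l p z"
      by (simp add: G_def f_def sum_distrib_left mult_ac)
    from arg_cong[where f=Re, OF this] show ?thesis by (simp add: q_def)
  qed (simp add: G_def f_def disc_weight_def)
  have G_int: "integrable disc_area (G R l p)" if R: "0 \<le> R" "R < 1" for R l p
    unfolding G_def[abs_def] by (intro Bochner_Integration.integrable_sum integrable_mult_right f(1)[OF R])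
  show ?thesis
  proof (intro exI allI impI conjI)
    fix R :: real and l p assume R: "0 \<le> R" "R < 1"
    show "integrable disc_area (\<lambda>z. disc_weight R l z * q z (\<Sum>j<N. z ^ j *\<^sub>C (p j *\<^sub>R b j)))"
      unfolding G[OF R] by (rule integrable_bounded_linear[OF bounded_linear_Re G_int[OF R]])
    have "(LINT z|disc_area. Re (G R l p z)) = Re (LINT z|disc_area. G R l p z)"
      by (rule integral_bounded_linear[OF bounded_linear_Re G_int[OF R]])
    also have "(LINT z|disc_area. G R l p z) = (\<Sum>j<N. \<Sum>k<N. of_real (p j * p k) * (LINT z|disc_area. f R l j k z))"
      unfolding G_def
      by (simp add: Bochner_Integration.integral_sum Bochner_Integration.integrable_sum integrable_mult_right f(1)[OF R])
    finally show "(LINT z|disc_area. disc_weight R l z * q z (\<Sum>j<N. z ^ j *\<^sub>C (p j *\<^sub>R b j)))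
        = (\<Sum>j<N. \<Sum>k<N. p j * p k * (radial_moment R l (max j k) * Re (c (b j) (b k) (int k - int j))))"
      unfolding G[OF R] by (simp add: f(2)[OF R] mult_ac)
  qed
qed

lemma weighted_q_nonneg: "R < 1 \<Longrightarrow> disc_weight R l z * q z x \<ge> 0"
  using disc_weight_bounds(1)[of R l z] nonneg[of z x]
  by (cases "cmod z \<le> R") (auto simp: q_def disc_weight_def)

text \<open>The unweighted energy of a polynomial over the disc of radius \<open>R\<close> increases with \<open>R\<close>, so its
  derivative in \<open>y = R\<^sup>2\<close>, which is the sum of \<open>p j * p k * \<alpha> j k * y ^ max j k\<close>, is nonnegative; the claim
  is the limit as \<open>y\<close> tends to 1.\<close>

lemma boundary_form_nonneg:
  fixes \<alpha> :: "nat \<Rightarrow> nat \<Rightarrow> real" and b :: "nat \<Rightarrow> 'a"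
  assumes int: "\<And>R p. 0 \<le> R \<Longrightarrow> R < 1 \<Longrightarrow>
        integrable disc_area (\<lambda>z. disc_weight R 0 z * q z (\<Sum>j<N. z ^ j *\<^sub>C (p j *\<^sub>R b j)))"
    and energy: "\<And>R p. 0 \<le> R \<Longrightarrow> R < 1 \<Longrightarrow>
        (LINT z|disc_area. disc_weight R 0 z * q z (\<Sum>j<N. z ^ j *\<^sub>C (p j *\<^sub>R b j)))
        = (\<Sum>j<N. \<Sum>k<N. p j * p k * (radial_moment R 0 (max j k) * \<alpha> j k))"
  shows "(\<Sum>j<N. \<Sum>k<N. p j * p k * \<alpha> j k) \<ge> 0"
proof -
  define H where "H y = (\<Sum>j<N. \<Sum>k<N. p j * p k * (y ^ Suc (max j k) / real (Suc (max j k)) * \<alpha> j k))" for y :: real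
  define H' where "H' y = (\<Sum>j<N. \<Sum>k<N. p j * p k * (y ^ max j k * \<alpha> j k))" for y :: real
  have H_mono: "H x \<le> H y" if "0 \<le> x" "x \<le> y" "y < 1" for x y
  proof -
    have e: "(LINT z|disc_area. disc_weight (sqrt t) 0 z * q z (\<Sum>j<N. z ^ j *\<^sub>C (p j *\<^sub>R b j))) = H t"
      if "0 \<le> t" "t < 1" for t
      using that by (subst energy) (simp_all add: H_def radial_moment_unweighted del: of_nat_Suc power_Suc)
    have "(LINT z|disc_area. disc_weight (sqrt x) 0 z * q z (\<Sum>j<N. z ^ j *\<^sub>C (p j *\<^sub>R b j)))
       \<le> (LINT z|disc_area. disc_weight (sqrt y) 0 z * q z (\<Sum>j<N. z ^ j *\<^sub>C (p j *\<^sub>R b j)))"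
    proof (intro integral_mono int)
      fix z
      have "sqrt x \<le> sqrt y" "sqrt y < 1" using that by auto
      hence "cmod z \<le> sqrt x \<Longrightarrow> cmod z \<le> sqrt y" "cmod z \<le> sqrt y \<Longrightarrow> cmod z < 1" by linarith+
      thus "disc_weight (sqrt x) 0 z * q z (\<Sum>j<N. z ^ j *\<^sub>C (p j *\<^sub>R b j))
        \<le> disc_weight (sqrt y) 0 z * q z (\<Sum>j<N. z ^ j *\<^sub>C (p j *\<^sub>R b j))"
        using nonneg[of z "\<Sum>j<N. z ^ j *\<^sub>C (p j *\<^sub>R b j)"]
        by (auto simp: disc_weight_def indicator_def q_def)
    qed (use that in auto)
    thus ?thesis using that by (simp add: e)
  qed
  have H_deriv: "(H has_real_derivative H' y) (at y)" for y
    unfolding H_def[abs_def] H'_def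
    by (auto intro!: derivative_eq_intros sum.cong simp del: of_nat_Suc power_Suc)
  have H'_nonneg: "H' y \<ge> 0" if "0 < y" "y < 1" for y
  proof (rule ccontr)
    assume "\<not> H' y \<ge> 0"
    then obtain d where d: "d > 0" "\<And>h. 0 < h \<Longrightarrow> h < d \<Longrightarrow> H y < H (y - h)"
      using DERIV_neg_dec_left[OF H_deriv, of y] by auto
    define h where "h = min (d / 2) (y / 2)"
    have "0 < h" "h < d" "h < y" using d(1) that by (auto simp: h_def min_def)
    thus False using d(2)[of h] H_mono[of "y - h" y] that by simp
  qed
  have "continuous_on UNIV H'" unfolding H'_def by (intro continuous_intros)
  hence "(H' \<longlongrightarrow> H' 1) (at_left 1)"
    by (simp add: continuous_on_eq_continuous_at isCont_def filterlim_at_split)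
  moreover have "\<forall>\<^sub>F y in at_left 1. 0 \<le> H' y"
    using eventually_at_left_real[OF zero_less_one] by eventually_elim (use H'_nonneg in auto)
  ultimately have "0 \<le> H' 1" by (intro tendsto_lowerbound) auto
  thus ?thesis by (simp add: H'_def)
qed

lemma polynomial_dilation_le:
  fixes b :: "nat \<Rightarrow> 'a" and l N :: nat
  assumes R: "0 < R" "R < 1" and r: "0 < r" "r < 1"
  defines "E \<equiv> \<lambda>p. LINT z|disc_area. disc_weight R l z * q z (\<Sum>j<N. z ^ j *\<^sub>C (p j *\<^sub>R b j))"
  shows "E (\<lambda>j. r ^ (j + Suc l)) \<le> E (\<lambda>j. 1)"
proof -
  obtain \<alpha> :: "nat \<Rightarrow> nat \<Rightarrow> real" where \<alpha>:
    "\<And>R l p. 0 \<le> R \<Longrightarrow> R < 1 \<Longrightarrow>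
        integrable disc_area (\<lambda>z. disc_weight R l z * q z (\<Sum>j<N. z ^ j *\<^sub>C (p j *\<^sub>R b j)))"
    "\<And>R l p. 0 \<le> R \<Longrightarrow> R < 1 \<Longrightarrow>
        (LINT z|disc_area. disc_weight R l z * q z (\<Sum>j<N. z ^ j *\<^sub>C (p j *\<^sub>R b j)))
        = (\<Sum>j<N. \<Sum>k<N. p j * p k * (radial_moment R l (max j k) * \<alpha> j k))"
    using polynomial_energy[where N=N and b=b] by blast
  have "(\<Sum>j<N. \<Sum>k<N. r ^ (j + Suc l) * r ^ (k + Suc l) * radial_moment R l (max j k) * \<alpha> j k)
     \<le> (\<Sum>j<N. \<Sum>k<N. radial_moment R l (max j k) * \<alpha> j k)"
  proof (rule dilation_kernel_le)
    show "(\<Sum>j<N. \<Sum>k<N. p j * p k * \<alpha> j k) \<ge> 0" for p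
      by (rule boundary_form_nonneg[OF \<alpha>])
    show "radial_moment R l m > 0" for m using R by (rule radial_moment_pos)
    show "real (Suc (m + Suc l)) * radial_moment R l (Suc m) \<le> real (m + Suc l) * radial_moment R l m" for m
    proof -
      have "0 \<le> R ^ (2 * Suc m) * (1 - R\<^sup>2) ^ Suc l"
        using R power_le_one[of R 2] by (intro mult_nonneg_nonneg zero_le_power) auto
      thus ?thesis using radial_moment_step[of R m l] R by linarith
    qed
  qed (use r in auto)
  thus ?thesis unfolding E_def \<alpha>(2)[OF less_imp_le[OF R(1)] R(2)] by (simp add: mult_ac)
qed

lemma q_bound_on_cball:
  assumes "cmod z \<le> R" "R < 1" "norm x \<le> K"
  shows "q z x \<le> \<bar>C\<bar> / (1 - R) * K\<^sup>2"
proof -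
  have "q z x \<le> C / (1 - cmod z) * (norm x)\<^sup>2" unfolding q_def using assms by (intro bound) auto
  also have "\<dots> \<le> \<bar>C\<bar> / (1 - R) * K\<^sup>2"
    using assms by (intro mult_mono frac_le power_mono) auto
  finally show ?thesis .
qed

lemma tendsto_q:
  assumes z: "cmod z < 1" and "(x \<longlongrightarrow> y) F"
  shows "((\<lambda>t. q z (x t)) \<longlongrightarrow> q z y) F"
proof -
  have "bounded_linear (P z)" using lin[OF z] by (simp add: bounded_clinear_def)
  thus ?thesis unfolding q_def
    by (intro tendsto_Re tendsto_cinner bounded_linear.tendsto[of "P z"] assms(2))
qed

text \<open>The partial sums are bounded on the disc of radius \<open>R\<close>, where \<open>q\<close> is bounded on bounded sets, so dominated
  convergence applies.\<close>

lemma disc_power_series_limit: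
  fixes g :: "complex \<Rightarrow> 'a" and l :: nat
  assumes b: "disc_power_series b g" and R: "0 \<le> R" "R < 1"
  defines "E \<equiv> \<lambda>h. LINT z|disc_area. disc_weight R l z * q z (h z)"
  shows "integrable disc_area (\<lambda>z. disc_weight R l z * q z (g z))"
    and "(\<lambda>N. E (\<lambda>z. \<Sum>j<N. z ^ j *\<^sub>C b j)) \<longlonglongrightarrow> E g"
proof -
  interpret finite_measure disc_area by (rule finite_disc_area)
  define K where "K = (\<Sum>j. norm (b j) * R ^ j)"
  have sK: "summable (\<lambda>j. norm (b j) * R ^ j)"
  proof -
    have "summable (\<lambda>j. norm (b j) * cmod (of_real R) ^ j)"
      using b R unfolding disc_power_series_def by (auto dest: spec[of _ "complex_of_real R"])
    thus ?thesis using R by simp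
  qed
  let ?s = "\<lambda>N z. disc_weight R l z * q z (\<Sum>j<N. z ^ j *\<^sub>C b j)"
  let ?g = "\<lambda>z. disc_weight R l z * q z (g z)"
  have lim: "(\<lambda>N. ?s N z) \<longlonglongrightarrow> ?g z" for z
  proof (cases "cmod z \<le> R")
    case True
    hence z: "cmod z < 1" using R by simp
    hence "(\<lambda>N. \<Sum>j<N. z ^ j *\<^sub>C b j) \<longlonglongrightarrow> g z" using b by (simp add: disc_power_series_def sums_def)
    thus ?thesis by (intro tendsto_mult tendsto_const tendsto_q z)
  qed (simp add: disc_weight_def)
  have bnd: "norm (?s N z) \<le> \<bar>C\<bar> / (1 - R) * K\<^sup>2" for N z
  proof (cases "cmod z \<le> R")
    case True
    have "norm (\<Sum>j<N. z ^ j *\<^sub>C b j) \<le> (\<Sum>j<N. norm (z ^ j *\<^sub>C b j))" by (rule norm_sum)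
    also have "\<dots> \<le> (\<Sum>j<N. norm (b j) * R ^ j)"
    proof (rule sum_mono)
      fix j
      have "cmod z ^ j \<le> R ^ j" using True by (intro power_mono) auto
      from mult_left_mono[OF this, of "norm (b j)"]
      show "norm (z ^ j *\<^sub>C b j) \<le> norm (b j) * R ^ j" by (simp add: norm_power mult.commute)
    qed
    also have "\<dots> \<le> K" unfolding K_def using R by (intro sum_le_suminf sK) auto
    finally have "q z (\<Sum>j<N. z ^ j *\<^sub>C b j) \<le> \<bar>C\<bar> / (1 - R) * K\<^sup>2"
      using True R by (intro q_bound_on_cball) auto
    moreover have "q z (\<Sum>j<N. z ^ j *\<^sub>C b j) \<ge> 0" using nonneg True R by (simp add: q_def)
    moreover have "?s N z \<le> 1 * q z (\<Sum>j<N. z ^ j *\<^sub>C b j)"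
      using calculation(2) disc_weight_bounds(2)[of R l z] R by (intro mult_right_mono) auto
    moreover have "?s N z \<ge> 0" using R by (intro weighted_q_nonneg) auto
    ultimately show ?thesis by simp
  next
    case False
    thus ?thesis using R by (simp add: disc_weight_def)
  qed
  have s_int: "integrable disc_area (?s N)" for N
  proof -
    obtain \<alpha> :: "nat \<Rightarrow> nat \<Rightarrow> real" where
      "\<And>R l p. 0 \<le> R \<Longrightarrow> R < 1 \<Longrightarrow>
        integrable disc_area (\<lambda>z. disc_weight R l z * q z (\<Sum>j<N. z ^ j *\<^sub>C (p j *\<^sub>R b j)))"
      using polynomial_energy[where N=N and b=b] by blast
    from this[OF R, of l "\<lambda>_. 1"] show ?thesis by simp
  qed
  have g_meas: "?g \<in> borel_measurable disc_area"
    by (rule borel_measurable_LIMSEQ_real[of disc_area ?s]) (use lim s_int in auto)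
  note dom = g_meas borel_measurable_integrable[OF s_int] integrable_const[of "\<bar>C\<bar> / (1 - R) * K\<^sup>2"]
    AE_I2[of disc_area, OF lim] AE_I2[of disc_area, OF bnd]
  show "integrable disc_area ?g" by (rule integrable_dominated_convergence[OF dom])
  show "(\<lambda>N. E (\<lambda>z. \<Sum>j<N. z ^ j *\<^sub>C b j)) \<longlonglongrightarrow> E g"
    unfolding E_def by (rule integral_dominated_convergence[OF dom])
qed

text \<open>The inequality for polynomials passes to the limit along the partial sums, since the dilated function has
  the dilated coefficients.\<close>

lemma truncated_dilation_le:
  fixes g :: "complex \<Rightarrow> 'a" and l :: nat
  assumes b: "disc_power_series b g" and R: "0 < R" "R < 1" and r: "0 < r" "r < 1"
  defines "gr \<equiv> \<lambda>z. of_real (r ^ Suc l) *\<^sub>C g (of_real r * z)"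
  shows "disc_power_series (\<lambda>j. r ^ (j + Suc l) *\<^sub>R b j) gr"
    and "(LINT z|disc_area. disc_weight R l z * q z (gr z)) \<le> (LINT z|disc_area. disc_weight R l z * q z (g z))"
proof -
  show br: "disc_power_series (\<lambda>j. r ^ (j + Suc l) *\<^sub>R b j) gr"
    unfolding disc_power_series_def
  proof (intro allI impI conjI)
    fix z :: complex assume z: "cmod z < 1"
    hence rz: "cmod (of_real r * z) < 1" using r by (intro cmod_dilate_less_one)
    have "summable (\<lambda>k. r ^ Suc l * (norm (b k) * cmod (of_real r * z) ^ k))"
      using b rz by (intro summable_mult) (auto simp: disc_power_series_def)
    thus "summable (\<lambda>k. norm (r ^ (k + Suc l) *\<^sub>R b k) * cmod z ^ k)"
      using r by (simp add: norm_mult power_mult_distrib power_add abs_mult mult_ac)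
    have "(\<lambda>k. of_real (r ^ Suc l) *\<^sub>C ((of_real r * z) ^ k *\<^sub>C b k)) sums gr z"
      unfolding gr_def using b rz
      by (intro bounded_linear.sums[OF bounded_bilinear.bounded_linear_right[OF bounded_bilinear_scaleC]])
        (auto simp: disc_power_series_def)
    thus "(\<lambda>k. z ^ k *\<^sub>C r ^ (k + Suc l) *\<^sub>R b k) sums gr z"
      by (simp add: scaleR_scaleC scaleC_scaleC power_mult_distrib power_add mult_ac)
  qed
  have le: "(LINT z|disc_area. disc_weight R l z * q z (\<Sum>j<N. z ^ j *\<^sub>C (r ^ (j + Suc l) *\<^sub>R b j)))
      \<le> (LINT z|disc_area. disc_weight R l z * q z (\<Sum>j<N. z ^ j *\<^sub>C b j))" for N
    using polynomial_dilation_le[OF R r, where l=l and N=N and b=b] by simp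
  show "(LINT z|disc_area. disc_weight R l z * q z (gr z)) \<le> (LINT z|disc_area. disc_weight R l z * q z (g z))"
    using disc_power_series_limit(2)[OF br, of R l] disc_power_series_limit(2)[OF b, of R l] R le
    by (intro LIMSEQ_le) auto
qed

definition energy :: "nat \<Rightarrow> (complex \<Rightarrow> 'a) \<Rightarrow> ennreal" where
  "energy l g = (\<integral>\<^sup>+z\<in>ball 0 1. ennreal (q z (g z) * (1 - (cmod z)\<^sup>2) ^ l) \<partial>disc_area)"

lemma truncated_energy:
  assumes b: "disc_power_series b g" and R: "0 < R" "R < 1"
  shows "(\<lambda>z. ennreal (q z (g z) * (1 - (cmod z)\<^sup>2) ^ l) * indicator (cball 0 R) z) \<in> borel_measurable disc_area"
    and "(\<integral>\<^sup>+z\<in>cball 0 R. ennreal (q z (g z) * (1 - (cmod z)\<^sup>2) ^ l) \<partial>disc_area)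
      = ennreal (LINT z|disc_area. disc_weight R l z * q z (g z))"
proof -
  have int: "integrable disc_area (\<lambda>z. disc_weight R l z * q z (g z))"
    using R by (intro disc_power_series_limit(1)[OF b]) auto
  have eq: "ennreal (q z (g z) * (1 - (cmod z)\<^sup>2) ^ l) * indicator (cball 0 R) z = ennreal (disc_weight R l z * q z (g z))" for z
    by (auto simp: disc_weight_def indicator_def mult.commute)
  show "(\<lambda>z. ennreal (q z (g z) * (1 - (cmod z)\<^sup>2) ^ l) * indicator (cball 0 R) z) \<in> borel_measurable disc_area"
    unfolding eq using int by measurable
  show "(\<integral>\<^sup>+z\<in>cball 0 R. ennreal (q z (g z) * (1 - (cmod z)\<^sup>2) ^ l) \<partial>disc_area)
      = ennreal (LINT z|disc_area. disc_weight R l z * q z (g z))"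
    unfolding eq using int weighted_q_nonneg[OF R(2)] by (intro nn_integral_eq_integral) auto
qed

lemma energy_measurable:
  assumes "disc_power_series b g"
  shows "(\<lambda>z. ennreal (q z (g z) * (1 - (cmod z)\<^sup>2) ^ l) * indicator (ball 0 1) z) \<in> borel_measurable disc_area"
  by (rule nn_integral_disc_exhaustion(1)) (rule truncated_energy(1)[OF assms])

lemma energy_dilation_le:
  assumes b: "disc_power_series b g" and r: "0 < r" "r < 1"
  shows "energy l (\<lambda>z. of_real (r ^ Suc l) *\<^sub>C g (of_real r * z)) \<le> energy l g"
proof -
  define gr where "gr z = of_real (r ^ Suc l) *\<^sub>C g (of_real r * z)" for z
  have gr: "disc_power_series (\<lambda>j. r ^ (j + Suc l) *\<^sub>R b j) gr"
    unfolding gr_def[abs_def] by (rule truncated_dilation_le(1)[OF b _ _ r, of "1/2"]) auto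
  have "(\<integral>\<^sup>+z\<in>cball 0 R. ennreal (q z (gr z) * (1 - (cmod z)\<^sup>2) ^ l) \<partial>disc_area)
     \<le> (\<integral>\<^sup>+z\<in>cball 0 R. ennreal (q z (g z) * (1 - (cmod z)\<^sup>2) ^ l) \<partial>disc_area)" if R: "0 < R" "R < 1" for R
    unfolding truncated_energy(2)[OF b R] truncated_energy(2)[OF gr R]
    by (rule ennreal_leI[OF truncated_dilation_le(2)[OF b R r, of l, folded gr_def]])
  moreover have exhaust: "energy l h = (SUP k. \<integral>\<^sup>+z\<in>cball 0 (1 - 1 / real (k + 2)).
      ennreal (q z (h z) * (1 - (cmod z)\<^sup>2) ^ l) \<partial>disc_area)" if "disc_power_series d h" for d h
    unfolding energy_def by (rule nn_integral_disc_exhaustion(2)) (rule truncated_energy(1)[OF that])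
  ultimately have "energy l gr \<le> energy l g"
    unfolding exhaust[OF gr] exhaust[OF b] by (intro SUP_mono') simp
  thus ?thesis by (simp add: gr_def[abs_def])
qed

lemma disc_power_series_combine:
  assumes "disc_power_series a f" "disc_power_series b g"
  shows "disc_power_series (\<lambda>k. a k + b k) (\<lambda>z. f z + g z)"
    and "disc_power_series (\<lambda>k. a k - b k) (\<lambda>z. f z - g z)"
proof -
  have s: "summable (\<lambda>k. norm (a k) * cmod z ^ k + norm (b k) * cmod z ^ k)" if "cmod z < 1" for z
    using assms that by (intro summable_add) (auto simp: disc_power_series_def)
  have "norm (a k + b k) * cmod z ^ k \<le> norm (a k) * cmod z ^ k + norm (b k) * cmod z ^ k"
    "norm (a k - b k) * cmod z ^ k \<le> norm (a k) * cmod z ^ k + norm (b k) * cmod z ^ k" for z k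
    unfolding distrib_right[symmetric]
    by (intro mult_right_mono norm_triangle_ineq norm_triangle_ineq4; simp)+
  hence sum: "summable (\<lambda>k. norm (a k + b k) * cmod z ^ k)" "summable (\<lambda>k. norm (a k - b k) * cmod z ^ k)"
    if "cmod z < 1" for z
    by (auto intro!: summable_comparison_test'[OF s[OF that], of 0])
  show "disc_power_series (\<lambda>k. a k + b k) (\<lambda>z. f z + g z)" 
    unfolding disc_power_series_def scaleC_add_right using assms sum(1)
    by (auto simp: disc_power_series_def intro!: sums_add)
  show "disc_power_series (\<lambda>k. a k - b k) (\<lambda>z. f z - g z)" 
    unfolding disc_power_series_def scaleC_diff_right using assms sum(2)
    by (auto simp: disc_power_series_def intro!: sums_diff)
qed

lemma q_parallelogram:
  assumes "cmod z < 1"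
  shows "q z (x + y) + q z (x - y) = 2 * q z x + 2 * q z y"
  using arg_cong[where f=Re, OF parallelogram[OF lin[OF assms], of x y]] by (simp add: q_def)

lemma energy_parallelogram:
  assumes f: "disc_power_series a f" and g: "disc_power_series b g"
  shows "energy l (\<lambda>z. f z - g z) + energy l (\<lambda>z. f z + g z) = 2 * energy l f + 2 * energy l g"
proof -
  let ?e = "\<lambda>h z. ennreal (q z (h z) * (1 - (cmod z)\<^sup>2) ^ l) * indicator (ball 0 1) z"
  have pt: "?e (\<lambda>z. f z - g z) z + ?e (\<lambda>z. f z + g z) z = 2 * ?e f z + 2 * ?e g z" for z
  proof (cases "cmod z < 1")
    case True
    hence w: "(1 - (cmod z)\<^sup>2) ^ l \<ge> 0" by (intro zero_le_power) (simp add: power_le_one)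
    have n: "q z x * (1 - (cmod z)\<^sup>2) ^ l \<ge> 0" for x using w nonneg[OF True] by (simp add: q_def)
    have "?e (\<lambda>z. f z - g z) z + ?e (\<lambda>z. f z + g z) z
        = ennreal ((q z (f z - g z) + q z (f z + g z)) * (1 - (cmod z)\<^sup>2) ^ l)"
      using True n by (simp add: distrib_right ennreal_plus)
    also have "q z (f z - g z) + q z (f z + g z) = 2 * q z (f z) + 2 * q z (g z)"
      using q_parallelogram[OF True, of "f z" "g z"] by simp
    also have "ennreal ((2 * q z (f z) + 2 * q z (g z)) * (1 - (cmod z)\<^sup>2) ^ l)
       = ennreal (2 * (q z (f z) * (1 - (cmod z)\<^sup>2) ^ l) + 2 * (q z (g z) * (1 - (cmod z)\<^sup>2) ^ l))"
      by (simp add: algebra_simps)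
    also have "\<dots> = ennreal (2 * (q z (f z) * (1 - (cmod z)\<^sup>2) ^ l)) + ennreal (2 * (q z (g z) * (1 - (cmod z)\<^sup>2) ^ l))"
      using n by (intro ennreal_plus) auto
    also have "\<dots> = 2 * ?e f z + 2 * ?e g z"
      using True by (simp add: ennreal_mult')
    finally show ?thesis .
  qed simp
  note m = energy_measurable[OF f, of l] energy_measurable[OF g, of l]
    energy_measurable[OF disc_power_series_combine(1)[OF f g], of l]
    energy_measurable[OF disc_power_series_combine(2)[OF f g], of l]
  have "energy l (\<lambda>z. f z - g z) + energy l (\<lambda>z. f z + g z)
     = (\<integral>\<^sup>+z. ?e (\<lambda>z. f z - g z) z + ?e (\<lambda>z. f z + g z) z \<partial>disc_area)"
    unfolding energy_def by (rule nn_integral_add[OF m(4) m(3), symmetric])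
  also have "\<dots> = (\<integral>\<^sup>+z. 2 * ?e f z + 2 * ?e g z \<partial>disc_area)" unfolding pt ..
  also have "\<dots> = 2 * energy l f + 2 * energy l g"
    unfolding energy_def using m(1,2)
    by (subst nn_integral_add) (auto simp: nn_integral_cmult intro: borel_measurable_times_ennreal)
  finally show ?thesis .
qed

text \<open>By the parallelogram law the energies of \<open>gs i - g\<close> and \<open>gs i + g\<close> add up to at most four times the energy
  of \<open>g\<close>, and by Fatou's lemma the second of them is in the limit at least that large, which leaves
  nothing for the first.\<close>

lemma energy_tendsto_zero:
  fixes g :: "complex \<Rightarrow> 'a" and gs :: "nat \<Rightarrow> complex \<Rightarrow> 'a"
  assumes gs: "\<And>i. disc_power_series (bs i) (gs i)" and g: "disc_power_series b g"
    and lim: "\<And>z. cmod z < 1 \<Longrightarrow> (\<lambda>i. gs i z) \<longlonglongrightarrow> g z"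
    and le: "\<And>i. energy l (gs i) \<le> energy l g" and fin: "energy l g < \<infinity>"
  shows "(\<lambda>i. energy l (\<lambda>z. gs i z - g z)) \<longlonglongrightarrow> 0"
proof -
  let ?e = "\<lambda>h z. ennreal (q z (h z) * (1 - (cmod z)\<^sup>2) ^ l) * indicator (ball 0 1) z"
  define D where "D = enn2real (energy l g)"
  have D: "energy l g = ennreal D" "D \<ge> 0" using fin by (simp_all add: D_def)
  have "(\<lambda>i. ?e (\<lambda>z. gs i z + g z) z) \<longlonglongrightarrow> 4 * ?e g z" for z
  proof (cases "cmod z < 1")
    case True
    have "q z (g z + g z) = 4 * q z (g z)"
      using q_parallelogram[OF True, of "g z" "g z"] bounded_clinear_scaleC[OF lin[OF True], of 0 0] by (simp add: q_def)
    moreover have "(\<lambda>i. ennreal (q z (gs i z + g z) * (1 - (cmod z)\<^sup>2) ^ l)) \<longlonglongrightarrow>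
        ennreal (q z (g z + g z) * (1 - (cmod z)\<^sup>2) ^ l)"
      by (intro tendsto_ennrealI tendsto_mult tendsto_q True tendsto_add lim[OF True] tendsto_const)
    ultimately show ?thesis using True by (simp add: ennreal_mult' mult.assoc)
  qed simp
  hence liminf: "liminf (\<lambda>i. ?e (\<lambda>z. gs i z + g z) z) = 4 * ?e g z" for z
    by (intro lim_imp_Liminf) auto
  have "4 * energy l g = (\<integral>\<^sup>+z. 4 * ?e g z \<partial>disc_area)"
    unfolding energy_def by (rule nn_integral_cmult[OF energy_measurable[OF g], symmetric])
  also have "\<dots> \<le> liminf (\<lambda>i. energy l (\<lambda>z. gs i z + g z))"
    unfolding liminf[symmetric] energy_def
    by (intro nn_integral_liminf energy_measurable[OF disc_power_series_combine(1)[OF gs g]])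
  finally have fatou: "ennreal (4 * D) \<le> liminf (\<lambda>i. energy l (\<lambda>z. gs i z + g z))"
    using D by (simp add: ennreal_mult')
  have sum_le: "energy l (\<lambda>z. gs i z - g z) + energy l (\<lambda>z. gs i z + g z) \<le> ennreal (4 * D)" for i
  proof -
    have "energy l (\<lambda>z. gs i z - g z) + energy l (\<lambda>z. gs i z + g z) \<le> 2 * energy l g + 2 * energy l g"
      unfolding energy_parallelogram[OF gs g] by (intro add_mono mult_left_mono le) auto
    also have "\<dots> = ennreal (4 * D)" using D by (simp add: ennreal_mult' flip: distrib_right)
    finally show ?thesis .
  qed
  define x y where "x i = enn2real (energy l (\<lambda>z. gs i z - g z))"
    and "y i = enn2real (energy l (\<lambda>z. gs i z + g z))" for i
  have le4: "energy l (\<lambda>z. gs i z - g z) \<le> ennreal (4 * D)" "energy l (\<lambda>z. gs i z + g z) \<le> ennreal (4 * D)" for i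
    by (rule order_trans[OF add_increasing2[OF zero_le order_refl] sum_le],
        rule order_trans[OF add_increasing[OF zero_le order_refl] sum_le])
  have "energy l (\<lambda>z. gs i z - g z) < \<infinity>" "energy l (\<lambda>z. gs i z + g z) < \<infinity>" for i
    using le4[of i] by (auto intro: order_le_less_trans)
  hence xy: "energy l (\<lambda>z. gs i z - g z) = ennreal (x i)" "energy l (\<lambda>z. gs i z + g z) = ennreal (y i)" for i
    by (simp_all add: x_def y_def)
  have xy0: "x i \<ge> 0" "y i \<ge> 0" for i by (simp_all add: x_def y_def)
  have xy_le: "x i + y i \<le> 4 * D" for i
  proof -
    have "ennreal (x i + y i) \<le> ennreal (4 * D)" using sum_le[of i] xy0 by (simp add: xy ennreal_plus)
    thus ?thesis using D(2) by (simp add: ennreal_le_iff)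
  qed
  have "y \<longlonglongrightarrow> 4 * D"
  proof (rule order_tendstoI)
    fix a assume a: "a < 4 * D"
    show "\<forall>\<^sub>F i in sequentially. a < y i"
    proof (cases "a < 0")
      case True
      thus ?thesis using xy0(2) by (intro always_eventually) (auto intro: order_less_le_trans)
    next
      case False
      hence "ennreal a < ennreal (4 * D)" using a by (simp add: ennreal_less_iff)
      hence "ennreal a < liminf (\<lambda>i. energy l (\<lambda>z. gs i z + g z))" using fatou by (rule order_less_le_trans)
      hence "\<forall>\<^sub>F i in sequentially. ennreal a < ennreal (y i)" unfolding xy by (rule less_LiminfD)
      thus ?thesis by eventually_elim (use False in \<open>simp add: ennreal_less_iff\<close>)
    qed
  next
    fix a assume a: "4 * D < a"
    have "y i < a" for i using xy_le[of i] xy0(1)[of i] a by linarith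
    thus "\<forall>\<^sub>F i in sequentially. y i < a" by simp
  qed
  hence "(\<lambda>i. 4 * D - y i) \<longlonglongrightarrow> 4 * D - 4 * D" by (intro tendsto_diff tendsto_const)
  hence "x \<longlonglongrightarrow> 0"
    by (intro tendsto_sandwich[of "\<lambda>_. 0" x sequentially "\<lambda>i. 4 * D - y i" 0])
      (use xy0 xy_le in \<open>auto simp: le_diff_eq intro!: always_eventually\<close>)
  hence "(\<lambda>i. ennreal (x i)) \<longlonglongrightarrow> ennreal 0" by (rule tendsto_ennrealI)
  thus ?thesis by (simp add: xy)
qed

end

section \<open>Dilations in Dirichlet-type spaces\<close>

theorem theorem1p1:
  fixes \<mu> :: "complex set \<Rightarrow> 'a::complex_hilbert_space \<Rightarrow> 'a"
    and n :: nat
    and f :: "complex \<Rightarrow> 'a"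
  assumes "separable_space (euclidean :: 'a topology)"
    and "semi_spectral_measure \<mu>"
    and "n > 0"
    and "f \<in> dirichlet_space \<mu> n"
  shows "(\<forall>r. 0 < r \<and> r < 1 \<longrightarrow>
            dirichlet_integral \<mu> n (dilation r f) \<le> dirichlet_integral \<mu> n f) \<and>
         ((\<lambda>r. dirichlet_integral \<mu> n (\<lambda>z. dilation r f z - f z)) \<longlongrightarrow> 0) (at_left 1)"
proof -
  have f: "holomorphic_on_disc f" "dirichlet_integral \<mu> n f < \<infinity>"
    using assms(4) by (auto simp: dirichlet_space_def)
  obtain C where C: "\<And>z x. cmod z < 1 \<Longrightarrow> 0 \<le> Re (cinner (poisson_integral \<mu> z x) x)
      \<and> Re (cinner (poisson_integral \<mu> z x) x) \<le> C / (1 - cmod z) * (norm x)\<^sup>2"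
    using poisson_integral_bounds[OF assms(2)] by blast
  interpret positive_harmonic_operator "poisson_integral \<mu>" C
  proof
    show "\<exists>c B. (\<forall>m. cmod (c m) \<le> B) \<and>
        (\<forall>z. cmod z < 1 \<longrightarrow> harmonic_term c z sums cinner (poisson_integral \<mu> z x) y)" for x y
      by (rule poisson_integral_sums[OF assms(2), of x y]) blast
  qed (use C bounded_clinear_poisson_integral[OF assms(2)] in auto)
  define l where "l = n - 1"
  have n: "n = Suc l" using assms(3) by (simp add: l_def)
  define c where "c = ennreal (1 / (fact n * fact (n - 1)))"
  have c: "0 < c" "c < \<infinity>" by (simp_all add: c_def)
  have D: "dirichlet_integral \<mu> n h = c * energy l ((cderiv ^^ n) h)" for h
    by (simp add: dirichlet_integral_def energy_def c_def q_def l_def)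
  have energy_cong: "energy l g = energy l h" if "\<And>z. cmod z < 1 \<Longrightarrow> g z = h z" for g h
    unfolding energy_def by (intro nn_integral_cong) (auto simp: indicator_def that)
  define g where "g = (cderiv ^^ n) f"
  define G where "G r z = of_real (r ^ n) *\<^sub>C g (of_real r * z)" for r z
  obtain b where b: "disc_power_series b g"
    using holomorphic_on_disc_power_series[OF holomorphic_on_disc_funpow_cderiv[OF f(1)]] unfolding g_def by blast
  have G: "(cderiv ^^ n) (dilation r f) z = G r z" if "0 < r" "r < 1" "cmod z < 1" for r z
    unfolding G_def g_def by (rule funpow_cderiv_dilation[OF f(1) that])
  have G_series: "disc_power_series (\<lambda>j. r ^ (j + n) *\<^sub>R b j) (G r)" if "0 < r" "r < 1" for r
    unfolding G_def[abs_def] n by (rule truncated_dilation_le(1)[OF b _ _ that, of "1/2"]) auto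
  have G_le: "energy l (G r) \<le> energy l g" if "0 < r" "r < 1" for r
    unfolding G_def[abs_def] n by (rule energy_dilation_le[OF b that])
  have fin: "energy l g < \<infinity>"
    using f(2) c unfolding D g_def[symmetric] by (auto simp: ennreal_mult_less_top)
  have le: "dirichlet_integral \<mu> n (dilation r f) \<le> dirichlet_integral \<mu> n f" if "0 < r" "r < 1" for r
  proof -
    have "energy l ((cderiv ^^ n) (dilation r f)) = energy l (G r)" by (rule energy_cong) (rule G[OF that])
    thus ?thesis unfolding D using G_le[OF that] by (simp add: g_def mult_left_mono)
  qed
  have "((\<lambda>r. dirichlet_integral \<mu> n (\<lambda>z. dilation r f z - f z)) \<longlongrightarrow> 0) (at_left 1)"
  proof (rule tendsto_at_left_sequentially[of 0])
    fix S :: "nat \<Rightarrow> real" assume S: "\<And>i. S i < 1" "\<And>i. 0 < S i" "S \<longlonglongrightarrow> 1"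
    have "(\<lambda>i. G (S i) z) \<longlonglongrightarrow> g z" if z: "cmod z < 1" for z
    proof -
      have "holomorphic_on_disc g" unfolding g_def by (rule holomorphic_on_disc_funpow_cderiv[OF f(1)])
      hence "continuous_on (ball 0 1) g" by (rule continuous_on_holomorphic_on_disc)
      hence "isCont g z" using z by (simp add: continuous_on_eq_continuous_at)
      moreover have "(\<lambda>i. of_real (S i) * z) \<longlonglongrightarrow> of_real 1 * z" by (intro tendsto_intros S(3))
      hence "(\<lambda>i. of_real (S i) * z) \<longlonglongrightarrow> z" by simp
      ultimately have "(\<lambda>i. g (of_real (S i) * z)) \<longlonglongrightarrow> g z" by (rule isCont_tendsto_compose)
      moreover have "(\<lambda>i. of_real (S i ^ n)) \<longlonglongrightarrow> complex_of_real (1 ^ n)" by (intro tendsto_intros S(3))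
      ultimately have "(\<lambda>i. G (S i) z) \<longlonglongrightarrow> of_real (1 ^ n) *\<^sub>C g z"
        unfolding G_def by (intro tendsto_scaleC)
      thus ?thesis by simp
    qed
    hence "(\<lambda>i. energy l (\<lambda>z. G (S i) z - g z)) \<longlonglongrightarrow> 0"
      using S G_le fin by (intro energy_tendsto_zero[OF G_series b]) auto
    hence "(\<lambda>i. c * energy l (\<lambda>z. G (S i) z - g z)) \<longlonglongrightarrow> c * 0"
      using c by (intro ennreal_tendsto_cmult) auto
    moreover have "dirichlet_integral \<mu> n (\<lambda>z. dilation (S i) f z - f z) = c * energy l (\<lambda>z. G (S i) z - g z)" for i
    proof -
      have "energy l ((cderiv ^^ n) (\<lambda>z. dilation (S i) f z - f z)) = energy l (\<lambda>z. G (S i) z - g z)"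
        by (rule energy_cong)
          (simp add: funpow_cderiv_diff[OF holomorphic_on_disc_dilation[OF f(1) S(2,1)] f(1)] G[OF S(2,1)] g_def)
      thus ?thesis by (simp add: D)
    qed
    ultimately show "(\<lambda>i. dirichlet_integral \<mu> n (\<lambda>z. dilation (S i) f z - f z)) \<longlonglongrightarrow> 0" by simp
  qed simp
  thus ?thesis using le by blast
qed

end
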